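(* Let $X=(X_1,\ldots,X_{d_X})$ and $Y=(Y_1,\ldots,Y_{d_Y})$ be real random vectors of respective dimensions $d_X$ and $d_Y$ (defined on a common probability space), and let $f\in\mathbb F$. (i) Let $C_{(X,Y)}$ be a copula for $(X,Y)$, with corresponding marginal copulas $C_X$ and $C_Y$. Then $$S_f(X,Y)\le D_f(C_X\otimes C_Y\,\Vert\,C_{(X,Y)}).$$ (ii) Let $C^{\mathrm{ip}}_{(X,Y)}$ be an interpolating copula of $(X,Y)$ given by the cdf of $(U,V)$, $U=(U_1,\ldots,U_{d_X})$, $V=(V_1,\ldots,V_{d_Y})$, where $$U_i=F_{X_i}(X_i-)+\sum_{x\in\Delta(X_i)}\mathbb P(X_i=x)\,T_{i,x}\,\mathbf 1_{\{X_i=x\}},\quad i\in\{1,\ldots,d_X\},$$ $$V_j=F_{Y_j}(Y_j-)+\sum_{y\in\Delta(Y_j)}\mathbb P(Y_j=y)\,W_{j,y}\,\mathbf 1_{\{Y_j=y\}},\quad j\in\{1,\ldots,d_Y\},$$ with $T=(T_{i,x})_{i\in\{1,\ldots,d_X\},\,x\in\Delta(X_i)}$ and $W=(W_{j,y})_{j\in\{1,\ldots,d_Y\},\,y\in\Delta(Y_j)}$ families having one-dimensional marginals uniform on $[0,1]$, such that $T$ and $W$ are independent, and $(T,W)$ is independent of $(X,Y)$ (no independence is assumed within $T$ or within $W$). Let $C^{\mathrm{ip}}_X$ and $C^{\mathrm{ip}}_Y$ be the marginal copulas of $C^{\mathrm{ip}}_{(X,Y)}$, that is, the cdfs of $U$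 and of $V$. Then $$S_f(X,Y)=D_f(C^{\mathrm{ip}}_X\otimes C^{\mathrm{ip}}_Y\,\Vert\,C^{\mathrm{ip}}_{(X,Y)}).$$ (iii) In particular, with $C^{\mathrm{cb}}_X$, $C^{\mathrm{cb}}_Y$, $C^{\mathrm{cb}}_{(X,Y)}$ the checkerboard copulas for $X$, $Y$ and $(X,Y)$ respectively, $$S_f(X,Y)=D_f(C^{\mathrm{cb}}_X\otimes C^{\mathrm{cb}}_Y\,\Vert\,C^{\mathrm{cb}}_{(X,Y)})=\min D_f(C_X\otimes C_Y\,\Vert\,C_{(X,Y)}),$$ where the minimum is over all copulas $C_{(X,Y)}$ of $(X,Y)$, with $C_X$, $C_Y$ their corresponding marginal copulas.
   Context: A proper convex function on $\mathbb R$ is a convex function with values in $(-\infty,+\infty]$ finite at some point; $\mathrm{dom}(f)=f^{-1}(\mathbb R)$. $\mathbb F$ is the set of proper convex functions $f$ on $\mathbb R$ with $\mathrm{dom}(f)\subset[0,\infty)$, right continuous at $0$ (i.e. $f(0)=\lim_{t\to0+}f(t)\in(-\infty,+\infty]$), $f(1)=0$, and $1$ in the interior of $\mathrm{dom}(f)$. For $f\in\mathbb F$, $f^*(0):=\lim_{t\to+\infty}f(t)/t$. For probability measures $P,Q$ on the same measurable space, with densities $p,q$ w.r.t. a dominating $\sigma$-finite measure, $\frac{dP}{dQ}:=p/q\in[0,+\infty]$ (convention $0/0=0$), defined $(P+Q)$-a.e., and $$D_f(P\Vert Q)=\int f\left(\frac{dP}{dQ}\right)dQ+f^*(0)\,P\left(\frac{dP}{dQ}=+\infty\right),$$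 the last term being $0$ by convention if $P\ll Q$. The Csiszár index is $S_f(X,Y)=D_f(P_X\otimes P_Y\,\Vert\,P_{(X,Y)})$, with $P_Z$ the distribution of $Z$; it may be infinite. For a real random variable $Z$, $F_Z$ is its cdf, $F_Z(z-)$ the left limit at $z$, and $\Delta(Z)=\{z\in\mathbb R:\mathbb P(Z=z)>0\}$ its set of atoms. A $d$-dimensional copula is the restriction to $[0,1]^d$ of the cdf of a $[0,1]^d$-valued random vector whose one-dimensional marginals are uniform on $[0,1]$. A copula $C$ is a copula for $Z=(Z_1,\ldots,Z_d)$ if $F_Z(z_1,\ldots,z_d)=C(F_{Z_1}(z_1),\ldots,F_{Z_d}(z_d))$ for all $z_1,\ldots,z_d\in\mathbb R$, where $F_Z$ is the cdf of $Z$. If $C_{(X,Y)}$ is a copula for the $\mathbb R^{d_X+d_Y}$-valued vector $(X,Y)$, its marginal copulas are $C_X(x)=C_{(X,Y)}(x,1,\ldots,1)$ for $x\in[0,1]^{d_X}$ and $C_Y(y)=C_{(X,Y)}(1,\ldots,1,y)$ for $y\in[0,1]^{d_Y}$; they are copulas for $X$ and for $Y$. $(C_X\otimes C_Y)(x,y)=C_X(x)C_Y(y)$. In $D_f$, a copula is identified with the probability measure on $[0,1]^d$ of which it is the cdf. An interpolating copula for $Z=(Z_1,\ldots,Z_d)$ is the cdf of a $[0,1]^d$-valued random vector $(U_1,\ldots,U_d)$ with $U_i=F_{Z_i}(Z_i-)+\sum_{x\in\Delta(Z_i)}\mathbb P(Z_i=x)\,T_{i,x}\mathbf 1_{\{Z_i=x\}}$,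 where $(T_{i,x})_{1\le i\le d,\,x\in\Delta(Z_i)}$ are $[0,1]$-uniform random variables (possibly dependent on each other), independent of $Z$. The (unique) checkerboard copula $C^{\mathrm{cb}}_Z$ for $Z$ is the interpolating copula obtained when, for every $i$, all $T_{i,x}$, $x\in\Delta(Z_i)$, are equal to a common variable $T_i$, where $T_1,\ldots,T_d$ are uniform on $[0,1]$, independent, and independent of $Z$. An interpolating copula for $Z$ is a copula for $Z$, and the marginal copulas of $C^{\mathrm{cb}}_{(X,Y)}$ are $C^{\mathrm{cb}}_X$ and $C^{\mathrm{cb}}_Y$. *)

theory Defs
  imports "HOL-Probability.Probability"
begin

section \<open>Csiszar divergences\<close>

definition effective_domain :: "(real \<Rightarrow> ereal) \<Rightarrow> real set" where
  "effective_domain f = {t. f t \<noteq> \<infinity> \<and> f t \<noteq> - \<infinity>}"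

definition proper_convex :: "(real \<Rightarrow> ereal) \<Rightarrow> bool" where
  "proper_convex f \<longleftrightarrow>
     (\<forall>t. f t \<noteq> - \<infinity>) \<and> (\<exists>t. f t \<noteq> \<infinity>) \<and>
     (\<forall>s t. \<forall>u\<in>{0..1}. f ((1 - u) * s + u * t) \<le> ereal (1 - u) * f s + ereal u * f t)"

definition csiszar_class :: "(real \<Rightarrow> ereal) set" where
  "csiszar_class = {f. proper_convex f \<and> effective_domain f \<subseteq> {0..} \<and>
     (f \<longlongrightarrow> f 0) (at_right 0) \<and> f 1 = 0 \<and> 1 \<in> interior (effective_domain f)}"

definition conj_slope :: "(real \<Rightarrow> ereal) \<Rightarrow> ereal" where
  "conj_slope f = Lim at_top (\<lambda>t. f t / ereal t)"

text \<open>Integral of an extended real function, as positive part minus negative part.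
  For \<open>f\<close> in \<^const>\<open>csiszar_class\<close> the negative part arising below has finite
  integral (\<open>f\<close> has an affine minorant), so the subtraction is never
  \<open>\<infinity> - \<infinity>\<close>.\<close>

definition ext_integral :: "'a measure \<Rightarrow> ('a \<Rightarrow> ereal) \<Rightarrow> ereal" where
  "ext_integral M g = enn2ereal (\<integral>\<^sup>+x. e2ennreal (g x) \<partial>M) - enn2ereal (\<integral>\<^sup>+x. e2ennreal (- g x) \<partial>M)"

text \<open>In \<^typ>\<open>ennreal\<close> we have \<open>0 / 0 = 0\<close> and \<open>a / 0 = \<infinity>\<close> for \<open>a > 0\<close>.\<close>

definition likelihood_ratio :: "'a measure \<Rightarrow> 'a measure \<Rightarrow> 'a measure \<Rightarrow> 'a \<Rightarrow> ennreal" where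
  "likelihood_ratio \<mu> P Q x = RN_deriv \<mu> P x / RN_deriv \<mu> Q x"

text \<open>The ratio is \<open>Q\<close>-almost everywhere finite, so the value \<open>enn2real \<infinity> = 0\<close> plays no role in
  the integral. As \<open>\<infinity> * 0 = 0\<close> in \<^typ>\<open>ereal\<close>, the second summand vanishes if
  \<open>P\<close> is absolutely continuous with respect to \<open>Q\<close>.\<close>

definition f_divergence_wrt ::
  "'a measure \<Rightarrow> (real \<Rightarrow> ereal) \<Rightarrow> 'a measure \<Rightarrow> 'a measure \<Rightarrow> ereal" where
  "f_divergence_wrt \<mu> f P Q =
     ext_integral Q (\<lambda>x. f (enn2real (likelihood_ratio \<mu> P Q x))) +
     conj_slope f * ereal (measure P {x \<in> space P. likelihood_ratio \<mu> P Q x = \<infinity>})"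

definition add_measure :: "'a measure \<Rightarrow> 'a measure \<Rightarrow> 'a measure" where
  "add_measure P Q = measure_of (space P) (sets P) (\<lambda>A. emeasure P A + emeasure Q A)"

text \<open>The dominating measure is taken to be \<open>P + Q\<close>; by the lemma \<open>f_divergence_eq_wrt\<close> below,
  every \<open>\<sigma>\<close>-finite dominating measure gives the same value.\<close>

definition f_divergence :: "(real \<Rightarrow> ereal) \<Rightarrow> 'a measure \<Rightarrow> 'a measure \<Rightarrow> ereal" where
  "f_divergence f P Q = f_divergence_wrt (add_measure P Q) f P Q"

lemma space_add_measure [simp]: "space (add_measure P Q) = space P"
  and sets_add_measure [simp, measurable_cong]: "sets (add_measure P Q) = sets P"
  by (auto simp: add_measure_def)

lemma emeasure_add_measure:
  assumes "sets Q = sets P" "A \<in> sets P"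
  shows "emeasure (add_measure P Q) A = emeasure P A + emeasure Q A"
  unfolding add_measure_def
proof (rule emeasure_measure_of_sigma)
  show "countably_additive (sets P) (\<lambda>A. emeasure P A + emeasure Q A)"
    using assms(1) by (auto simp: countably_additive_def suminf_add[symmetric] suminf_emeasure)
qed (auto simp: positive_def assms sets.sigma_algebra_axioms)

lemma f_divergence_eq_wrt:
  assumes "finite_measure P" "finite_measure Q" "sigma_finite_measure \<mu>"
    and sets: "sets P = sets \<mu>" "sets Q = sets \<mu>"
    and ac: "absolutely_continuous \<mu> P" "absolutely_continuous \<mu> Q"
  shows "f_divergence f P Q = f_divergence_wrt \<mu> f P Q"
proof -
  interpret P: finite_measure P by fact
  interpret Q: finite_measure Q by fact
  interpret \<mu>: sigma_finite_measure \<mu> by fact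
  define \<sigma> where "\<sigma> = add_measure P Q"
  define p q p' q' where defs: "p = RN_deriv \<mu> P" "q = RN_deriv \<mu> Q"
    "p' = RN_deriv \<sigma> P" "q' = RN_deriv \<sigma> Q"
  have sets\<sigma>: "sets \<sigma> = sets \<mu>" using sets by (simp add: \<sigma>_def)
  have em\<sigma>: "emeasure \<sigma> A = emeasure P A + emeasure Q A" if "A \<in> sets \<mu>" for A
    using that sets by (simp add: \<sigma>_def emeasure_add_measure)
  have [measurable]: "p \<in> borel_measurable \<mu>" "q \<in> borel_measurable \<mu>"
    "p' \<in> borel_measurable \<mu>" "q' \<in> borel_measurable \<mu>"
    using borel_measurable_RN_deriv[of \<sigma> P] borel_measurable_RN_deriv[of \<sigma> Q]
    by (auto simp: defs measurable_cong_sets[OF sets\<sigma> refl])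
  have dP: "density \<mu> p = P" and dQ: "density \<mu> q = Q"
    unfolding defs by (intro \<mu>.density_RN_deriv ac sets)+
  interpret \<sigma>: finite_measure \<sigma>
    by (rule finite_measureI) (use sets_eq_imp_space_eq[OF sets\<sigma>] em\<sigma>[of "space \<mu>"]
      sets_eq_imp_space_eq[OF sets(1)] sets_eq_imp_space_eq[OF sets(2)]
      P.emeasure_finite[of "space \<mu>"] Q.emeasure_finite[of "space \<mu>"] in auto)
  have ac\<sigma>: "absolutely_continuous \<sigma> P" "absolutely_continuous \<sigma> Q"
    using sets sets\<sigma> em\<sigma> by (auto simp: absolutely_continuous_def null_sets_def)
  have dP': "density \<sigma> p' = P" and dQ': "density \<sigma> q' = Q"
    unfolding defs by (intro \<sigma>.density_RN_deriv ac\<sigma>; simp add: sets sets\<sigma>)+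
  have d\<sigma>: "\<sigma> = density \<mu> (\<lambda>x. p x + q x)"
  proof (rule measure_eqI)
    fix A assume "A \<in> sets \<sigma>"
    then have A: "A \<in> sets \<mu>" by (simp add: sets\<sigma>)
    have "emeasure \<sigma> A = emeasure (density \<mu> p) A + emeasure (density \<mu> q) A"
      using em\<sigma>[OF A] by (simp add: dP dQ)
    also have "\<dots> = emeasure (density \<mu> (\<lambda>x. p x + q x)) A"
      using A by (simp add: emeasure_density nn_integral_add[symmetric] distrib_right)
    finally show "emeasure \<sigma> A = emeasure (density \<mu> (\<lambda>x. p x + q x)) A" .
  qed (simp add: sets\<sigma>)
  have eqp: "AE x in \<mu>. (p x + q x) * p' x = p x"
  proof (rule \<mu>.density_unique)
    show "density \<mu> (\<lambda>x. (p x + q x) * p' x) = density \<mu> p"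
      using dP' d\<sigma> by (subst density_density_eq[symmetric]) (auto simp: dP)
  qed auto
  have eqq: "AE x in \<mu>. (p x + q x) * q' x = q x"
  proof (rule \<mu>.density_unique)
    show "density \<mu> (\<lambda>x. (p x + q x) * q' x) = density \<mu> q"
      using dQ' d\<sigma> by (subst density_density_eq[symmetric]) (auto simp: dQ)
  qed auto
  have fin: "AE x in \<mu>. p x \<noteq> \<infinity>" "AE x in \<mu>. q x \<noteq> \<infinity>"
    unfolding defs
    by (intro \<mu>.RN_deriv_finite P.sigma_finite_measure_axioms Q.sigma_finite_measure_axioms ac sets)+
  have cancel: "(c * a) / (c * b) = a / b" if "c \<noteq> 0" "c \<noteq> \<infinity>" for a b c :: ennreal
  proof -
    have c: "c * inverse c = 1" using that
      by (simp add: ennreal_mult_divide_eq[of c 1, simplified] divide_ennreal_def[symmetric] less_top)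
    have "(c * a) / (c * b) = (c * inverse c) * (a * inverse b)"
      using that by (subst divide_ennreal_def, subst ennreal_inverse_mult')
        (auto simp: less_top zero_less_iff_neq_zero mult_ac)
    then show ?thesis by (simp add: c divide_ennreal_def)
  qed
  have ratio: "AE x in \<mu>. p x + q x \<noteq> 0 \<longrightarrow> likelihood_ratio \<mu> P Q x = likelihood_ratio \<sigma> P Q x"
    using eqp eqq fin
  proof eventually_elim
    case (elim x)
    show ?case
    proof
      assume "p x + q x \<noteq> 0"
      then have "((p x + q x) * p' x) / ((p x + q x) * q' x) = p' x / q' x"
        using elim by (intro cancel) auto
      with elim show "likelihood_ratio \<mu> P Q x = likelihood_ratio \<sigma> P Q x"
        by (simp add: likelihood_ratio_def flip: defs)
    qed
  qed
  have ratioP: "AE x in P. likelihood_ratio \<mu> P Q x = likelihood_ratio \<sigma> P Q x"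
    unfolding dP[symmetric] AE_density[OF \<open>p \<in> borel_measurable \<mu>\<close>]
    using ratio by eventually_elim (auto simp: dP)
  have ratioQ: "AE x in Q. likelihood_ratio \<mu> P Q x = likelihood_ratio \<sigma> P Q x"
    unfolding dQ[symmetric] AE_density[OF \<open>q \<in> borel_measurable \<mu>\<close>]
    using ratio by eventually_elim (auto simp: dQ)
  have [measurable]: "p \<in> borel_measurable P" "q \<in> borel_measurable P"
    "p' \<in> borel_measurable P" "q' \<in> borel_measurable P"
    by (simp_all add: measurable_cong_sets[OF sets(1) refl])
  have "ext_integral Q (\<lambda>x. f (enn2real (likelihood_ratio \<mu> P Q x))) =
        ext_integral Q (\<lambda>x. f (enn2real (likelihood_ratio \<sigma> P Q x)))"
    unfolding ext_integral_def
    by (intro arg_cong2[where f="(-)"] arg_cong[where f=enn2ereal] nn_integral_cong_AE;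
        use ratioQ in eventually_elim) auto
  moreover have "measure P {x \<in> space P. likelihood_ratio \<mu> P Q x = \<infinity>} =
        measure P {x \<in> space P. likelihood_ratio \<sigma> P Q x = \<infinity>}"
    by (rule P.finite_measure_eq_AE)
       (use ratioP in \<open>auto simp: likelihood_ratio_def simp flip: defs\<close>)
  ultimately show ?thesis
    by (simp add: f_divergence_def f_divergence_wrt_def \<sigma>_def)
qed

definition csiszar_index ::
  "(real \<Rightarrow> ereal) \<Rightarrow> 'w measure \<Rightarrow> 'a measure \<Rightarrow> 'b measure \<Rightarrow> ('w \<Rightarrow> 'a) \<Rightarrow> ('w \<Rightarrow> 'b) \<Rightarrow> ereal" where
  "csiszar_index f M S T X Y =
     f_divergence f (distr M S X \<Otimes>\<^sub>M distr M T Y) (distr M (S \<Otimes>\<^sub>M T) (\<lambda>\<omega>. (X \<omega>, Y \<omega>)))"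


section \<open>Copulas\<close>

text \<open>The order on \<^typ>\<open>real^'d\<close> is componentwise, so \<open>{..z}\<close> is a lower orthant and
  \<open>{0..1}\<close> is the unit cube.\<close>

definition joint_cdf :: "(real^'d) measure \<Rightarrow> real^'d \<Rightarrow> real" where
  "joint_cdf \<mu> z = measure \<mu> {..z}"

definition copula_law :: "(real^'d) measure \<Rightarrow> bool" where
  "copula_law \<mu> \<longleftrightarrow> prob_space \<mu> \<and> sets \<mu> = sets borel \<and> (AE x in \<mu>. x \<in> {0..1}) \<and>
     (\<forall>i. distr \<mu> borel (\<lambda>x. x $ i) = uniform_measure lborel {0..1})"

text \<open>A copula is represented by a function on the whole space whose values outside the
  unit cube are irrelevant.\<close>

definition is_copula :: "(real^'d \<Rightarrow> real) \<Rightarrow> bool" where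
  "is_copula C \<longleftrightarrow> (\<exists>\<mu>. copula_law \<mu> \<and> (\<forall>u\<in>{0..1}. C u = joint_cdf \<mu> u))"

definition copula_measure :: "(real^'d \<Rightarrow> real) \<Rightarrow> (real^'d) measure" where
  "copula_measure C = (THE \<mu>. copula_law \<mu> \<and> (\<forall>u\<in>{0..1}. C u = joint_cdf \<mu> u))"

lemma copula_law_unique:
  fixes \<mu> \<nu> :: "(real^'d) measure"
  assumes "copula_law \<mu>" "copula_law \<nu>" and eq: "\<forall>u\<in>{0..1}. joint_cdf \<mu> u = joint_cdf \<nu> u"
  shows "\<mu> = \<nu>"
proof -
  have "measure \<rho> {..z} = (if 0 \<le> z then joint_cdf \<rho> (\<chi> i. min (z $ i) 1) else 0)"
    if "copula_law \<rho>" for \<rho> :: "(real^'d) measure" and z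
  proof -
    interpret prob_space \<rho> using that by (simp add: copula_law_def)
    have sets[simp]: "sets \<rho> = sets borel" and ae: "AE x in \<rho>. x \<in> {0..1}"
      and unif: "\<And>i. distr \<rho> borel (\<lambda>x. x $ i) = uniform_measure lborel {0..1}"
      using that by (auto simp: copula_law_def)
    have sp[simp]: "space \<rho> = UNIV" using sets_eq_imp_space_eq[OF sets] by simp
    have cl[measurable]: "{..u} \<in> sets borel" for u :: "real^'d"
    proof -
      have "{..u} = {x. \<forall>i. x $ i \<le> u $ i}" by (auto simp: less_eq_vec_def)
      then show ?thesis by (simp add: closed_Collect_all closed_Collect_le continuous_intros borel_closed)
    qed
    show ?thesis
    proof (cases "0 \<le> z")
      case True
      have "AE x in \<rho>. x \<in> {..z} \<longleftrightarrow> x \<in> {..(\<chi> i. min (z $ i) 1)}"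
        using ae by eventually_elim (auto simp: less_eq_vec_def)
      with True show ?thesis by (auto simp: joint_cdf_def intro!: finite_measure_eq_AE)
    next
      case False
      then have "AE x in \<rho>. x \<notin> {..z}"
        using ae by (auto elim!: eventually_mono dest: order_trans)
      then have "measure \<rho> {..z} = measure \<rho> {}"
        by (intro finite_measure_eq_AE) (auto elim!: eventually_mono)
      with False show ?thesis by simp
    qed
  qed
  note m = this
  have eq': "measure \<mu> {..z} = measure \<nu> {..z}" for z
    using eq by (simp add: m[OF assms(1)] m[OF assms(2)] less_eq_vec_def)
  interpret \<mu>: prob_space \<mu> using assms by (simp add: copula_law_def)
  interpret \<nu>: prob_space \<nu> using assms by (simp add: copula_law_def)
  let ?E = "range (\<lambda>a::real^'d. {..a})"
  have b: "sets borel = sigma_sets UNIV ?E"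
    by (subst borel_eq_atMost) (simp add: sets_measure_of)
  show ?thesis
  proof (rule measure_eqI_generator_eq[where E="?E" and \<Omega>=UNIV and A="\<lambda>n::nat. {..(\<chi> i. real n)}"])
    show "Int_stable ?E"
    proof (rule Int_stableI, safe)
      fix a b :: "real^'d"
      have "{..a} \<inter> {..b} = {..(\<chi> i. min (a $ i) (b $ i))}"
        by (auto simp: less_eq_vec_def)
      then show "{..a} \<inter> {..b} \<in> ?E" by blast
    qed
    show "emeasure \<mu> A = emeasure \<nu> A" if "A \<in> ?E" for A
      using that eq' by (auto simp: \<mu>.emeasure_eq_measure \<nu>.emeasure_eq_measure)
    show "(\<Union>n. {..(\<chi> i. real n)::real^'d}) = UNIV"
    proof safe
      fix x :: "real^'d"
      obtain n :: nat where n: "Max (range (($) x)) \<le> real n" using real_arch_simple by blast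
      have "x $ i \<le> real n" for i using n Max_ge[of "range (($) x)" "x $ i"] by simp
      then show "x \<in> (\<Union>n. {..(\<chi> i. real n)})" by (auto simp: less_eq_vec_def)
    qed simp
  qed (use assms b in \<open>auto simp: copula_law_def\<close>)
qed

lemma copula_measure:
  assumes "is_copula C"
  shows "copula_law (copula_measure C)" "\<And>u. u \<in> {0..1} \<Longrightarrow> joint_cdf (copula_measure C) u = C u"
proof -
  have "\<exists>!\<mu>. copula_law \<mu> \<and> (\<forall>u\<in>{0..1}. C u = joint_cdf \<mu> u)"
    using assms copula_law_unique unfolding is_copula_def by metis
  from theI'[OF this] show "copula_law (copula_measure C)"
    "\<And>u. u \<in> {0..1} \<Longrightarrow> joint_cdf (copula_measure C) u = C u"
    by (auto simp: copula_measure_def)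
qed

definition is_copula_for ::
  "'w measure \<Rightarrow> ('w \<Rightarrow> real^'d) \<Rightarrow> (real^'d \<Rightarrow> real) \<Rightarrow> bool" where
  "is_copula_for M Z C \<longleftrightarrow> is_copula C \<and>
     (\<forall>z. joint_cdf (distr M borel Z) z = C (\<chi> i. cdf (distr M borel (\<lambda>\<omega>. Z \<omega> $ i)) (z $ i)))"

text \<open>Vectors of dimension \<open>d\<^sub>X + d\<^sub>Y\<close> are indexed by the sum of the two index types.\<close>

definition join_vec :: "real^'m \<Rightarrow> real^'n \<Rightarrow> real^('m::finite + 'n::finite)" where
  "join_vec x y = (\<chi> k. case k of Inl i \<Rightarrow> x $ i | Inr j \<Rightarrow> y $ j)"

definition joint_rv :: "('w \<Rightarrow> real^'m) \<Rightarrow> ('w \<Rightarrow> real^'n) \<Rightarrow> 'w \<Rightarrow> real^('m::finite + 'n::finite)" where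
  "joint_rv X Y \<omega> = join_vec (X \<omega>) (Y \<omega>)"

definition left_part :: "real^('m::finite + 'n::finite) \<Rightarrow> real^'m" where
  "left_part z = (\<chi> i. z $ Inl i)"

definition right_part :: "real^('m::finite + 'n::finite) \<Rightarrow> real^'n" where
  "right_part z = (\<chi> j. z $ Inr j)"

definition left_marginal :: "(real^('m::finite + 'n::finite) \<Rightarrow> real) \<Rightarrow> real^'m \<Rightarrow> real" where
  "left_marginal C x = C (join_vec x 1)"

definition right_marginal :: "(real^('m::finite + 'n::finite) \<Rightarrow> real) \<Rightarrow> real^'n \<Rightarrow> real" where
  "right_marginal C y = C (join_vec 1 y)"

definition tensor_copula ::
  "(real^'m \<Rightarrow> real) \<Rightarrow> (real^'n \<Rightarrow> real) \<Rightarrow> real^('m::finite + 'n::finite) \<Rightarrow> real" where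
  "tensor_copula C D z = C (left_part z) * D (right_part z)"

definition copula_divergence ::
  "(real \<Rightarrow> ereal) \<Rightarrow> (real^'d \<Rightarrow> real) \<Rightarrow> (real^'d \<Rightarrow> real) \<Rightarrow> ereal" where
  "copula_divergence f C D = f_divergence f (copula_measure C) (copula_measure D)"


section \<open>Interpolating copulas\<close>

definition atoms :: "'w measure \<Rightarrow> ('w \<Rightarrow> real) \<Rightarrow> real set" where
  "atoms M Z = {z. measure M {\<omega> \<in> space M. Z \<omega> = z} > 0}"

text \<open>The sum over the (possibly infinitely many) atoms has at most one nonzero summand.\<close>

definition interpolated ::
  "'w measure \<Rightarrow> ('w \<Rightarrow> real^'d) \<Rightarrow> ('d \<Rightarrow> real \<Rightarrow> 'w \<Rightarrow> real) \<Rightarrow> 'w \<Rightarrow> real^'d" where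
  "interpolated M Z T \<omega> = (\<chi> i.
     Lim (at_left (Z \<omega> $ i)) (cdf (distr M borel (\<lambda>\<omega>'. Z \<omega>' $ i))) +
     (\<Sum>\<^sub>\<infinity>x\<in>atoms M (\<lambda>\<omega>'. Z \<omega>' $ i).
        measure M {\<omega>' \<in> space M. Z \<omega>' $ i = x} * T i x \<omega> * of_bool (Z \<omega> $ i = x)))"

definition atom_index :: "'w measure \<Rightarrow> ('w \<Rightarrow> real^'d) \<Rightarrow> ('d \<times> real) set" where
  "atom_index M Z = (SIGMA i:UNIV. atoms M (\<lambda>\<omega>. Z \<omega> $ i))"

definition uniform_01 :: "'w measure \<Rightarrow> ('w \<Rightarrow> real) \<Rightarrow> bool" where
  "uniform_01 M T \<longleftrightarrow> T \<in> borel_measurable M \<and> distr M borel T = uniform_measure lborel {0..1}"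

text \<open>Heterogeneous version of \<^const>\<open>prob_space.indep_var\<close>, which requires the two variables
  to have the same range type.\<close>

definition indep_rvs ::
  "'w measure \<Rightarrow> 'a measure \<Rightarrow> ('w \<Rightarrow> 'a) \<Rightarrow> 'b measure \<Rightarrow> ('w \<Rightarrow> 'b) \<Rightarrow> bool" where
  "indep_rvs M S A T B \<longleftrightarrow> A \<in> measurable M S \<and> B \<in> measurable M T \<and>
     prob_space.indep_set M {A -` E \<inter> space M | E. E \<in> sets S} {B -` E \<inter> space M | E. E \<in> sets T}"

text \<open>The family \<open>(T\<^sub>i\<^sub>,\<^sub>x)\<close>, for \<open>x\<close> an atom of \<open>Z\<^sub>i\<close>, as a random element of a product space.\<close>

definition family_rv ::
  "'w measure \<Rightarrow> ('w \<Rightarrow> real^'d) \<Rightarrow> ('d \<Rightarrow> real \<Rightarrow> 'w \<Rightarrow> real) \<Rightarrow> 'w \<Rightarrow> ('d \<times> real \<Rightarrow> real)" where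
  "family_rv M Z T \<omega> = (\<lambda>(i, x)\<in>atom_index M Z. T i x \<omega>)"

abbreviation family_space :: "'w measure \<Rightarrow> ('w \<Rightarrow> real^'d) \<Rightarrow> ('d \<times> real \<Rightarrow> real) measure" where
  "family_space M Z \<equiv> PiM (atom_index M Z) (\<lambda>_. borel)"

text \<open>The checkerboard copula is realised on the extension of \<open>M\<close> by an independent vector
  of independent uniform variables \<open>T\<^sub>i\<close>, each used for all the atoms of \<open>Z\<^sub>i\<close>.\<close>

definition checkerboard_space :: "'w measure \<Rightarrow> ('w \<times> ('d::finite \<Rightarrow> real)) measure" where
  "checkerboard_space M = M \<Otimes>\<^sub>M PiM UNIV (\<lambda>_. uniform_measure lborel {0..1})"

definition checkerboard_copula :: "'w measure \<Rightarrow> ('w \<Rightarrow> real^'d) \<Rightarrow> real^'d \<Rightarrow> real" where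
  "checkerboard_copula M Z =
     joint_cdf (distr (checkerboard_space M) borel
       (interpolated (checkerboard_space M) (\<lambda>p. Z (fst p)) (\<lambda>i x p. snd p i)))"

end

theory Submission
  imports Defs "HOL-Real_Asymp.Real_Asymp"
begin

text \<open>
  Both halves of the theorem are instances of the data processing inequality: a measurable map
  applied to two probability measures cannot increase their \<open>f\<close>-divergence
  (\<open>f_divergence_distr_le\<close>).

  If \<open>C\<close> is a copula for \<open>(X, Y)\<close>, the coordinatewise quantile transform carries the
  probability measure of \<open>C\<close> to the law of \<open>(X, Y)\<close>, and hence the product of the
  marginal copulas to the product of the laws of \<open>X\<close> and \<open>Y\<close>. This gives the inequality
  for an arbitrary copula (\<open>csiszar_index_le_copula_divergence\<close>).

  For an interpolating copula there is also a map in the other direction, once randomness is added: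
  \<open>U\<close> is a measurable function of \<open>X\<close> and \<open>T\<close>, and \<open>V\<close> is one of \<open>Y\<close> and
  \<open>W\<close>. Replacing both arguments of a divergence by their products with one and the same law
  leaves it unchanged (\<open>f_divergence_pair_measure\<close>). As \<open>T\<close>, \<open>W\<close> and
  \<open>(X, Y)\<close> are independent, the law of \<open>(U, V)\<close> and the product of the laws of \<open>U\<close>
  and \<open>V\<close> are images, under one map, of such products built from the law of \<open>(X, Y)\<close> and
  from the product of the laws of \<open>X\<close> and \<open>Y\<close> (\<open>f_divergence_randomized_le\<close>). The
  reverse inequality holds because an interpolating copula is a copula for \<open>(X, Y)\<close>, which is
  the distributional transform (\<open>distributional_transform\<close>). The checkerboard copula is the case
  in which all atoms of a coordinate share one uniform variable, realised on an extension of the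
  probability space; it attains the minimum.

  Data processing rests on a symmetric form of the divergence. With \<open>\<sigma> = P + Q\<close> and \<open>p\<close>
  the density of \<open>P\<close>, the density of \<open>Q\<close> is \<open>1 - p\<close>. Subtracting from \<open>f\<close> a
  supporting line at \<open>1\<close>, of the form \<open>c * (t - 1)\<close>, does not change the divergence but makes
  \<open>f\<close> nonnegative, and the two terms of the divergence, regular and singular, merge into one
  integral of a convex function of \<open>p\<close> on \<open>[0, 1]\<close> with values in \<open>[0, \<infinity>]\<close>
  (\<open>f_divergence_eq_perspective\<close>). The density of an image measure is a conditional expectation
  of \<open>p\<close>, so what remains is the conditional Jensen inequality. The function \<open>f\<close> may fail
  to be lower semicontinuous at an end point of its domain, so it need not be a supremum of affine
  functions there. Such end points are treated separately: a conditional expectation can reach an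
  extreme value of \<open>p\<close> only where \<open>p\<close> itself has that value (\<open>conditional_jensen\<close>).
\<close>

section \<open>Supporting lines and the slope at infinity\<close>

lemma proper_convexD:
  assumes "proper_convex f" "0 \<le> u" "u \<le> 1"
  shows "f ((1 - u) * s + u * t) \<le> ereal (1 - u) * f s + ereal u * f t"
  using assms unfolding proper_convex_def by (meson atLeastAtMost_iff)

lemma convex_effective_domain:
  assumes "proper_convex f"
  shows "convex (effective_domain f)"
proof (unfold convex_alt, intro ballI allI impI)
  fix x y u :: real assume x: "x \<in> effective_domain f" and y: "y \<in> effective_domain f" and u: "0 \<le> u \<and> u \<le> 1"
  have "f ((1 - u) * x + u * y) \<le> ereal (1 - u) * f x + ereal u * f y"
    using proper_convexD[OF assms] u by blast
  moreover obtain fx fy where "f x = ereal fx" "f y = ereal fy"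
    using x y by (cases "f x"; cases "f y") (auto simp: effective_domain_def)
  moreover have "f ((1 - u) * x + u * y) \<noteq> - \<infinity>"
    using assms by (auto simp: proper_convex_def)
  ultimately show "(1 - u) *\<^sub>R x + u *\<^sub>R y \<in> effective_domain f"
    by (auto simp: effective_domain_def)
qed

lemma proper_convex_finite_between:
  assumes "proper_convex f" "f a < \<infinity>" "f b < \<infinity>" "a \<le> u" "u \<le> b"
  shows "f u < \<infinity>"
proof -
  have "a \<in> effective_domain f" "b \<in> effective_domain f"
    using assms by (auto simp: effective_domain_def proper_convex_def)
  then have "u \<in> effective_domain f"
    using convex_effective_domain[OF assms(1)] assms(4,5)
    by (metis (no_types) is_interval_convex_1 mem_is_interval_1_I)
  then show ?thesis by (auto simp: effective_domain_def)
qed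

text \<open>At an end point of the effective domain the only supporting line may be vertical; finiteness on
  both sides of \<open>u\<close> excludes this and yields a finite slope.\<close>

lemma proper_convex_supporting_line:
  assumes f: "proper_convex f" and fin: "f a < \<infinity>" "f b < \<infinity>" and u: "a < u" "u < b"
  obtains s k where "f u = ereal (s * u + k)" "\<And>v. ereal (s * v + k) \<le> f v"
proof -
  define I where "I = effective_domain f"
  define g where "g = (\<lambda>x. real_of_ereal (f x))"
  have fg: "f x = ereal (g x)" if "x \<in> I" for x
    using that by (auto simp: I_def g_def effective_domain_def ereal_real)
  have cv: "convex I" unfolding I_def by (rule convex_effective_domain[OF f])
  have "convex_on I g"
    unfolding convex_on_alt
  proof (intro conjI cv ballI allI impI)
    fix x y t :: real assume x: "x \<in> I" and y: "y \<in> I" and t: "0 \<le> t \<and> t \<le> 1"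
    have in_I: "t *\<^sub>R x + (1 - t) *\<^sub>R y \<in> I"
      using cv x y t by (auto simp: convex_def)
    have "f ((1 - (1 - t)) * x + (1 - t) * y) \<le> ereal (1 - (1 - t)) * f x + ereal (1 - t) * f y"
      by (rule proper_convexD[OF f]) (use t in auto)
    then show "g (t *\<^sub>R x + (1 - t) *\<^sub>R y) \<le> t * g x + (1 - t) * g y"
      using fg[OF in_I] fg[OF x] fg[OF y] by simp
  qed
  moreover have "u \<in> interior I"
  proof (rule interiorI[of "{a<..<b}"])
    show "{a<..<b} \<subseteq> I"
      using proper_convex_finite_between[OF f fin] f
      by (auto simp: I_def effective_domain_def proper_convex_def less_imp_le)
  qed (use u in auto)
  ultimately obtain s where s: "g v \<ge> g u + s * (v - u)" if "v \<in> I" for v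
    using convex_le_Inf_differential[of I g u] by blast
  have "u \<in> I" using \<open>u \<in> interior I\<close> interior_subset by blast
  show ?thesis
  proof (rule that[of s "g u - s * u"])
    show "f u = ereal (s * u + (g u - s * u))" using fg[OF \<open>u \<in> I\<close>] by simp
    fix v show "ereal (s * v + (g u - s * u)) \<le> f v"
    proof (cases "v \<in> I")
      case True then show ?thesis using s[of v] fg by (simp add: algebra_simps)
    next
      case False
      then show ?thesis using f by (auto simp: I_def effective_domain_def proper_convex_def)
    qed
  qed
qed

text \<open>Strict sublevel sets of a convex function are intervals.\<close>

lemma proper_convex_borel_measurable:
  assumes "proper_convex f"
  shows "f \<in> borel_measurable borel"
proof (rule borel_measurable_ereal_iff_Iio[THEN iffD2], intro allI)
  fix c :: ereal
  have "is_interval {x. f x < c}"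
    unfolding is_interval_1
  proof safe
    fix x y z assume x: "f x < c" and y: "f y < c" and z: "x \<le> z" "z \<le> y"
    show "f z < c"
    proof (cases "x < y")
      case True
      define u where "u = (z - x) / (y - x)"
      have u: "0 \<le> u" "u \<le> 1" using z True by (auto simp: u_def)
      have "(y - x) * u = z - x" using True by (simp add: u_def)
      then have zz: "z = (1 - u) * x + u * y" by (simp add: algebra_simps)
      have "f z \<le> ereal (1 - u) * f x + ereal u * f y"
        unfolding zz by (rule proper_convexD[OF assms u])
      also have "\<dots> \<le> ereal (1 - u) * max (f x) (f y) + ereal u * max (f x) (f y)"
        using u by (intro add_mono ereal_mult_left_mono) auto
      also have "\<dots> = max (f x) (f y)"
        using u by (subst ereal_left_distrib[symmetric]) (auto simp flip: one_ereal_def)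
      also have "\<dots> < c" using x y by simp
      finally show ?thesis .
    next
      case False then show ?thesis using x z by (metis order_antisym_conv order_trans not_le)
    qed
  qed
  then show "f -` {..<c} \<inter> space borel \<in> sets borel"
    by (auto simp: vimage_def intro: real_interval_borel_measurable)
qed

lemma csiszar_classD:
  assumes "f \<in> csiszar_class"
  shows "proper_convex f" "f 1 = 0" "\<And>t. f t \<noteq> - \<infinity>"
  using assms by (auto simp: csiszar_class_def proper_convex_def)

text \<open>This is a supporting line at \<open>1\<close>. It is the right function to subtract from \<open>f\<close>: the
  integral of \<open>c * (dP/dQ - 1)\<close> with respect to \<open>Q\<close> is \<open>- c\<close> times the mass of the
  singular part of \<open>P\<close>, and the slope at infinity of \<open>f\<close> drops by \<open>c\<close>.\<close>

lemma csiszar_class_minorant: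
  assumes f: "f \<in> csiszar_class"
  obtains c where "\<And>t. ereal (c * (t - 1)) \<le> f t"
proof -
  note D = csiszar_classD[OF f]
  have "1 \<in> interior (effective_domain f)" using f by (simp add: csiszar_class_def)
  then obtain e where e: "e > 0" "cball 1 e \<subseteq> effective_domain f"
    by (meson mem_interior_cball)
  have "1 - e \<in> effective_domain f" "1 + e \<in> effective_domain f"
    using e by (auto simp: subset_iff dist_real_def)
  then have "f (1 - e) < \<infinity>" "f (1 + e) < \<infinity>" by (auto simp: effective_domain_def)
  from proper_convex_supporting_line[OF D(1) this, of 1] e obtain s k where
    "f 1 = ereal (s * 1 + k)" "\<And>v. ereal (s * v + k) \<le> f v" by auto
  moreover from this have "k = - s" using D(2) by (auto simp: zero_ereal_def)
  ultimately show ?thesis using that[of s] by (simp add: algebra_simps)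
qed

text \<open>Slopes of chords from the point \<open>(1, 0)\<close> of the graph increase. They control \<open>f t / t\<close> for
  large \<open>t\<close>, because \<open>(t - 1) / t\<close> tends to \<open>1\<close>.\<close>

lemma chord_slope_mono:
  assumes f: "f \<in> csiszar_class" and st: "1 < s" "s \<le> t"
  shows "f s / ereal (s - 1) \<le> f t / ereal (t - 1)"
proof -
  note D = csiszar_classD[OF f]
  define u where "u = (s - 1) / (t - 1)"
  have u: "0 < u" "u \<le> 1" using st by (auto simp: u_def)
  have "u * (t - 1) = s - 1" using st by (simp add: u_def)
  then have eq: "(1 - u) * 1 + u * t = s" by (simp add: algebra_simps)
  have "f s \<le> ereal (1 - u) * f 1 + ereal u * f t"
    using proper_convexD[OF D(1), of u 1 t] u eq by simp
  then have le: "f s \<le> ereal u * f t" using D(2) by simp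
  have "f s / ereal (s - 1) \<le> (ereal u * f t) / ereal (s - 1)"
    using le st by (intro ereal_divide_right_mono) auto
  also have "\<dots> = f t / ereal (t - 1)"
  proof (cases "f t")
    case (real r)
    have "u * r / (s - 1) = r / (t - 1)" using st by (simp add: u_def)
    then show ?thesis using real st by simp
  qed (use D(3)[of t] st u in auto)
  finally show ?thesis .
qed

text \<open>The limit that defines the slope at infinity exists, possibly as \<open>\<infinity>\<close>: it is the supremum
  of the chord slopes.\<close>

lemma conj_slope_tendsto:
  assumes f: "f \<in> csiszar_class"
  shows "((\<lambda>t. f t / ereal t) \<longlongrightarrow> conj_slope f) at_top"
proof -
  note D = csiszar_classD[OF f]
  define q where "q t = f t / ereal (t - 1)" for t
  define L where "L = (SUP t\<in>{1<..}. q t)"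
  have q_lim: "(q \<longlongrightarrow> L) at_top"
  proof (rule order_tendstoI)
    fix a assume "a < L"
    then obtain s where s: "1 < s" "a < q s" by (auto simp: L_def less_SUP_iff)
    then have "a < q t" if "s \<le> t" for t
      using chord_slope_mono[OF f s(1) that] by (auto simp: q_def)
    then show "\<forall>\<^sub>F t in at_top. a < q t" by (auto simp: eventually_at_top_linorder)
  next
    fix a assume a: "L < a"
    have "q t < a" if "1 < t" for t
      using that a by (intro le_less_trans[OF _ a]) (auto simp: L_def intro: SUP_upper)
    then show "\<forall>\<^sub>F t in at_top. q t < a" by (auto simp: eventually_at_top_dense)
  qed
  have "((\<lambda>t. ereal ((t - 1) / t)) \<longlongrightarrow> ereal 1) at_top"
    by (intro tendsto_ereal) real_asymp
  then have "((\<lambda>t. q t * ereal ((t - 1) / t)) \<longlongrightarrow> L * ereal 1) at_top"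
    by (intro tendsto_mult_ereal q_lim) auto
  moreover have "\<forall>\<^sub>F t in at_top. q t * ereal ((t - 1) / t) = f t / ereal t"
    using eventually_gt_at_top[of 1]
  proof eventually_elim
    case (elim t)
    then show ?case using D(3)[of t] by (cases "f t") (auto simp: q_def divide_ereal_def field_simps)
  qed
  ultimately have "((\<lambda>t. f t / ereal t) \<longlongrightarrow> L) at_top"
    by (simp add: tendsto_cong flip: one_ereal_def)
  moreover from this have "conj_slope f = L"
    unfolding conj_slope_def by (intro tendsto_Lim) auto
  ultimately show ?thesis by simp
qed

lemma conj_slope_ge_minorant_slope:
  assumes f: "f \<in> csiszar_class" and l: "\<And>t. ereal (s * t + k) \<le> f t"
  shows "ereal s \<le> conj_slope f"
proof (rule tendsto_le[OF _ conj_slope_tendsto[OF f]])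
  show "((\<lambda>t. ereal (s + k / t)) \<longlongrightarrow> ereal s) at_top"
    by (intro tendsto_ereal) real_asymp
  show "\<forall>\<^sub>F t in at_top. ereal (s + k / t) \<le> f t / ereal t"
    using eventually_gt_at_top[of 0]
  proof eventually_elim
    case (elim t)
    have "ereal (s * t + k) / ereal t \<le> f t / ereal t"
      using elim by (intro ereal_divide_right_mono l) auto
    then show ?case using elim by (simp add: field_simps)
  qed
qed auto

text \<open>An infinite value makes all later chord slopes infinite.\<close>

lemma finite_if_conj_slope_finite:
  assumes f: "f \<in> csiszar_class" and "conj_slope f < \<infinity>" and u: "1 < u"
  shows "f u < \<infinity>"
proof (rule ccontr)
  assume "\<not> f u < \<infinity>"
  then have "f u = \<infinity>" by simp
  then have "f u / ereal (u - 1) = \<infinity>" using u by simp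
  then have inf: "f t / ereal (t - 1) = \<infinity>" if "u \<le> t" for t
    using chord_slope_mono[OF f u that] by simp
  have "f t = \<infinity>" if "u \<le> t" for t
    using inf[OF that] that u csiszar_classD(3)[OF f, of t] by (cases "f t") auto
  then have "\<forall>\<^sub>F t in at_top. f t / ereal t = \<infinity>"
    using u by (auto simp: eventually_at_top_linorder intro!: exI[of _ u])
  then have "((\<lambda>t. f t / ereal t) \<longlongrightarrow> \<infinity>) at_top" by (rule tendsto_eventually)
  then have "conj_slope f = \<infinity>"
    using conj_slope_tendsto[OF f] tendsto_unique by (metis trivial_limit_at_top_linorder)
  with assms(2) show False by simp
qed

section \<open>Conditional Jensen inequality without semicontinuity\<close>

text \<open>That is, \<open>r\<close> is the conditional expectation of \<open>p\<close> given \<open>r\<close>, whenever both are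
  integrable.\<close>

definition averages :: "'a measure \<Rightarrow> ('a \<Rightarrow> real) \<Rightarrow> ('a \<Rightarrow> real) \<Rightarrow> bool" where
  "averages M p r \<longleftrightarrow> (\<forall>E\<in>sets borel. (\<integral>x. indicator E (r x) * p x \<partial>M) = (\<integral>x. indicator E (r x) * r x \<partial>M))"

text \<open>The functions \<open>g\<close> for which Jensen's inequality holds with \<open>g\<close> on the side of the average
  and \<open>H\<close> on the side of the averaged function, restricted to every event determined by
  \<open>r\<close>. The restriction is what makes this class stable under suprema.\<close>

definition localized_jensen :: "'a measure \<Rightarrow> ('a \<Rightarrow> real) \<Rightarrow> ('a \<Rightarrow> real) \<Rightarrow> (real \<Rightarrow> ennreal) \<Rightarrow> (real \<Rightarrow> ennreal) \<Rightarrow> bool" where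
  "localized_jensen M p r H g \<longleftrightarrow> g \<in> borel_measurable borel \<and>
     (\<forall>E\<in>sets borel. (\<integral>\<^sup>+x. indicator E (r x) * g (r x) \<partial>M) \<le> (\<integral>\<^sup>+x. indicator E (r x) * H (p x) \<partial>M))"

text \<open>Every event is split according to which of the two functions of \<open>r\<close> is larger.\<close>

lemma localized_jensen_sup:
  assumes [measurable]: "p \<in> borel_measurable M" "r \<in> borel_measurable M" "H \<in> borel_measurable borel"
    and g1: "localized_jensen M p r H g1" and g2: "localized_jensen M p r H g2"
  shows "localized_jensen M p r H (\<lambda>t. sup (g1 t) (g2 t))"
  unfolding localized_jensen_def
proof (intro conjI ballI)
  have [measurable]: "g1 \<in> borel_measurable borel" "g2 \<in> borel_measurable borel"
    using g1 g2 by (auto simp: localized_jensen_def)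
  show "(\<lambda>t. sup (g1 t) (g2 t)) \<in> borel_measurable borel" by measurable
  fix E :: "real set" assume [measurable]: "E \<in> sets borel"
  define A where "A = E \<inter> {t. g2 t \<le> g1 t}"
  define B where "B = E \<inter> {t. g1 t < g2 t}"
  have [measurable]: "A \<in> sets borel" "B \<in> sets borel" unfolding A_def B_def by measurable
  have "(\<integral>\<^sup>+x. indicator E (r x) * sup (g1 (r x)) (g2 (r x)) \<partial>M) =
      (\<integral>\<^sup>+x. indicator A (r x) * g1 (r x) + indicator B (r x) * g2 (r x) \<partial>M)"
    by (intro nn_integral_cong) (auto simp: A_def B_def indicator_def sup_max max_def not_le)
  also have "\<dots> = (\<integral>\<^sup>+x. indicator A (r x) * g1 (r x) \<partial>M) + (\<integral>\<^sup>+x. indicator B (r x) * g2 (r x) \<partial>M)"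
    by (rule nn_integral_add) measurable
  also have "\<dots> \<le> (\<integral>\<^sup>+x. indicator A (r x) * H (p x) \<partial>M) + (\<integral>\<^sup>+x. indicator B (r x) * H (p x) \<partial>M)"
    using g1 g2 by (intro add_mono) (auto simp: localized_jensen_def)
  also have "\<dots> = (\<integral>\<^sup>+x. indicator A (r x) * H (p x) + indicator B (r x) * H (p x) \<partial>M)"
    by (rule nn_integral_add[symmetric]) measurable
  also have "\<dots> = (\<integral>\<^sup>+x. indicator E (r x) * H (p x) \<partial>M)"
    by (intro nn_integral_cong) (auto simp: A_def B_def indicator_def)
  finally show "(\<integral>\<^sup>+x. indicator E (r x) * sup (g1 (r x)) (g2 (r x)) \<partial>M) \<le> \<dots>" .
qed

text \<open>Finite maxima are covered by \<open>localized_jensen_sup\<close>; monotone convergence does the rest.\<close>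

lemma localized_jensen_SUP:
  fixes g :: "nat \<Rightarrow> real \<Rightarrow> ennreal"
  assumes [measurable]: "p \<in> borel_measurable M" "r \<in> borel_measurable M" "H \<in> borel_measurable borel"
    and g: "\<And>n. localized_jensen M p r H (g n)"
  shows "localized_jensen M p r H (\<lambda>t. SUP n. g n t)"
  unfolding localized_jensen_def
proof (intro conjI ballI)
  have [measurable]: "g n \<in> borel_measurable borel" for n
    using g by (auto simp: localized_jensen_def)
  show "(\<lambda>t. SUP n. g n t) \<in> borel_measurable borel" by measurable
  define m where "m = (\<lambda>n t. SUP k\<in>{..n}. g k t)"
  have m: "localized_jensen M p r H (m n)" for n
  proof (induction n)
    case (Suc n)
    have "m (Suc n) = (\<lambda>t. sup (g (Suc n) t) (m n t))"
      by (auto simp: m_def atMost_Suc)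
    then show ?case using localized_jensen_sup[OF assms(1-3) g Suc] by simp
  qed (use g in \<open>simp add: m_def\<close>)
  then have [measurable]: "m n \<in> borel_measurable borel" for n
    by (auto simp: localized_jensen_def)
  have SUP_m: "(SUP n. g n t) = (SUP n. m n t)" for t
    unfolding m_def
    by (intro antisym SUP_least) (auto intro: SUP_upper2 SUP_upper)
  have inc: "incseq (\<lambda>n. m n t)" for t
    unfolding m_def by (auto simp: incseq_def intro!: SUP_subset_mono)
  fix E :: "real set" assume [measurable]: "E \<in> sets borel"
  have "(\<integral>\<^sup>+x. indicator E (r x) * (SUP n. g n (r x)) \<partial>M) = (\<integral>\<^sup>+x. (SUP n. indicator E (r x) * m n (r x)) \<partial>M)"
    by (simp add: SUP_m SUP_mult_left_ennreal)
  also have "\<dots> = (SUP n. \<integral>\<^sup>+x. indicator E (r x) * m n (r x) \<partial>M)"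
    using inc by (intro nn_integral_monotone_convergence_SUP)
      (auto simp: incseq_def le_fun_def intro!: mult_left_mono)
  also have "\<dots> \<le> (\<integral>\<^sup>+x. indicator E (r x) * H (p x) \<partial>M)"
    using m by (intro SUP_least) (auto simp: localized_jensen_def)
  finally show "(\<integral>\<^sup>+x. indicator E (r x) * (SUP n. g n (r x)) \<partial>M) \<le> \<dots>" .
qed

text \<open>For an affine function the averaging property gives an equality of integrals. It is used on the
  event that the function of \<open>r\<close> is nonnegative, since \<^const>\<open>ennreal\<close> truncates at zero.\<close>

lemma localized_jensen_affine:
  fixes s k :: real
  assumes M: "finite_measure M"
    and [measurable]: "p \<in> borel_measurable M" "r \<in> borel_measurable M" "H \<in> borel_measurable borel"
    and p: "\<And>x. x \<in> space M \<Longrightarrow> p x \<in> {0..1}" and r: "\<And>x. x \<in> space M \<Longrightarrow> r x \<in> {0..1}"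
    and av: "averages M p r"
    and le: "\<And>t. t \<in> {0..1} \<Longrightarrow> ennreal (s * t + k) \<le> H t"
  shows "localized_jensen M p r H (\<lambda>t. ennreal (s * t + k))"
  unfolding localized_jensen_def
proof (intro conjI ballI)
  interpret finite_measure M by fact
  show "(\<lambda>t. ennreal (s * t + k)) \<in> borel_measurable borel" by measurable
  fix E :: "real set" assume [measurable]: "E \<in> sets borel"
  define A where "A = E \<inter> {t. 0 \<le> s * t + k}"
  have A[measurable]: "A \<in> sets borel" unfolding A_def by measurable
  have int: "integrable M (\<lambda>x. indicator A (r x) * q x)"
    if [measurable]: "q \<in> borel_measurable M" and "\<And>x. x \<in> space M \<Longrightarrow> q x \<in> {0..1}" for q :: "'a \<Rightarrow> real"
    using that(2) by (intro integrable_const_bound[where B=1]) (auto simp: indicator_def)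
  have one: "integrable M (\<lambda>x. indicator A (r x) :: real)"
    by (intro integrable_const_bound[where B=1]) (auto simp: indicator_def)
  have "(\<integral>\<^sup>+x. indicator E (r x) * ennreal (s * r x + k) \<partial>M) =
      (\<integral>\<^sup>+x. ennreal (indicator A (r x) * (s * r x + k)) \<partial>M)"
    by (intro nn_integral_cong) (auto simp: A_def indicator_def ennreal_neg)
  also have "\<dots> = ennreal (\<integral>x. indicator A (r x) * (s * r x + k) \<partial>M)"
  proof (rule nn_integral_eq_integral)
    show "integrable M (\<lambda>x. indicator A (r x) * (s * r x + k))"
      using Bochner_Integration.integrable_add[OF integrable_mult_right[OF int[of r], of s] integrable_mult_right[OF one, of k]] r
      by (simp add: algebra_simps)
  qed (auto simp: A_def indicator_def)
  also have "(\<integral>x. indicator A (r x) * (s * r x + k) \<partial>M) = (\<integral>x. indicator A (r x) * (s * p x + k) \<partial>M)"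
  proof -
    have *: "(\<integral>x. indicator A (r x) * (s * q x + k) \<partial>M) =
        s * (\<integral>x. indicator A (r x) * q x \<partial>M) + k * (\<integral>x. indicator A (r x) \<partial>M)"
      if "integrable M (\<lambda>x. indicator A (r x) * q x)" for q
    proof -
      have "(\<integral>x. indicator A (r x) * (s * q x + k) \<partial>M) =
          (\<integral>x. s * (indicator A (r x) * q x) + k * indicator A (r x) \<partial>M)"
        by (simp add: algebra_simps)
      also have "\<dots> = s * (\<integral>x. indicator A (r x) * q x \<partial>M) + k * (\<integral>x. indicator A (r x) \<partial>M)"
        using that one by simp
      finally show ?thesis .
    qed
    show ?thesis
      using av A int[of r] int[of p] p r by (simp add: * averages_def)
  qed
  also have "ennreal \<dots> \<le> (\<integral>\<^sup>+x. ennreal (indicator A (r x) * (s * p x + k)) \<partial>M)"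
  proof -
    have "integrable M (\<lambda>x. indicator A (r x) * (s * p x + k))"
      using Bochner_Integration.integrable_add[OF integrable_mult_right[OF int[of p], of s] integrable_mult_right[OF one, of k]] p
      by (simp add: algebra_simps)
    then have int: "integrable M (\<lambda>x. max 0 (indicator A (r x) * (s * p x + k)))" and
      le: "(\<integral>x. indicator A (r x) * (s * p x + k) \<partial>M) \<le> (\<integral>x. max 0 (indicator A (r x) * (s * p x + k)) \<partial>M)"
      by (auto intro!: integral_mono)
    have "(\<integral>\<^sup>+x. ennreal (indicator A (r x) * (s * p x + k)) \<partial>M) =
        (\<integral>\<^sup>+x. ennreal (max 0 (indicator A (r x) * (s * p x + k))) \<partial>M)"
      by (intro nn_integral_cong) (auto simp: max_def ennreal_neg)
    also have "\<dots> = ennreal (\<integral>x. max 0 (indicator A (r x) * (s * p x + k)) \<partial>M)"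
      by (intro nn_integral_eq_integral int) auto
    finally show ?thesis using le by (simp add: ennreal_leI)
  qed
  also have "\<dots> \<le> (\<integral>\<^sup>+x. indicator E (r x) * H (p x) \<partial>M)"
    using le p by (intro nn_integral_mono) (auto simp: A_def indicator_def)
  finally show "(\<integral>\<^sup>+x. indicator E (r x) * ennreal (s * r x + k) \<partial>M) \<le> \<dots>" .
qed

text \<open>Countably many minorants suffice, so that \<open>localized_jensen_SUP\<close> applies: on \<open>[0, 1]\<close> a
  supporting line stays a minorant when its slope and its intercept are lowered slightly to rational
  values.\<close>

lemma SUP_rational_minorants:
  fixes H :: "real \<Rightarrow> ennreal"
  assumes t: "t \<in> {0..1}" and eq: "H t = ennreal (s * t + k)"
    and le: "\<And>x. x \<in> {0..1} \<Longrightarrow> ennreal (s * x + k) \<le> H x"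
  shows "H t = (SUP (s, k)\<in>{(s, k). s \<in> \<rat> \<and> k \<in> \<rat> \<and> (\<forall>x\<in>{0..1}. ennreal (s * x + k) \<le> H x)}. ennreal (s * t + k))"
    (is "_ = (SUP (s, k)\<in>?L. _)")
proof (rule antisym)
  show "(SUP (s, k)\<in>?L. ennreal (s * t + k)) \<le> H t"
    using t by (auto intro!: SUP_least)
  show "H t \<le> (SUP (s, k)\<in>?L. ennreal (s * t + k))"
  proof (rule ennreal_le_epsilon)
    fix e :: real assume e: "0 < e"
    obtain s' where s': "s' \<in> \<rat>" "s - e / 4 < s'" "s' < s"
      using Rats_dense_in_real[of "s - e / 4" s] e by auto
    obtain k' where k': "k' \<in> \<rat>" "k - e / 4 < k'" "k' < k"
      using Rats_dense_in_real[of "k - e / 4" k] e by auto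
    have "ennreal (s' * x + k') \<le> H x" if "x \<in> {0..1}" for x
    proof -
      have "s' * x + k' \<le> s * x + k" using that s' k' by (intro add_mono mult_right_mono) auto
      then show ?thesis using le[OF that] by (meson ennreal_leI order_trans)
    qed
    then have L: "(s', k') \<in> ?L"
      using s'(1) k'(1) by simp
    have "(s - s') * t \<le> (e / 4) * 1" using s' t e by (intro mult_mono) auto
    then have "s * t + k \<le> (s' * t + k') + e" using k' e by (simp add: algebra_simps)
    \<comment> \<open>The maximum with zero avoids a case distinction on the sign of the lowered line.\<close>
    then have "H t \<le> ennreal (max 0 (s' * t + k') + e)"
      unfolding eq by (intro ennreal_leI) auto
    also have "\<dots> = ennreal (s' * t + k') + ennreal e"
      using e by (subst ennreal_plus) (auto simp: max_def ennreal_neg)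
    also have "\<dots> \<le> (SUP (s, k)\<in>?L. ennreal (s * t + k)) + ennreal e"
      using SUP_upper[OF L, of "\<lambda>(s, k). ennreal (s * t + k)"] by (intro add_mono) auto
    finally show "H t \<le> (SUP (s, k)\<in>?L. ennreal (s * t + k)) + ennreal e" .
  qed
qed

text \<open>The integral of \<open>p - r\<close> over the event \<open>r \<in> E\<close> vanishes while its integrand has a
  constant sign.\<close>

lemma averages_forced_equal:
  assumes M: "finite_measure M"
    and [measurable]: "p \<in> borel_measurable M" "r \<in> borel_measurable M"
    and p: "\<And>x. x \<in> space M \<Longrightarrow> p x \<in> {0..1}" and r: "\<And>x. x \<in> space M \<Longrightarrow> r x \<in> {0..1}"
    and av: "averages M p r"
    and E[measurable]: "E \<in> sets borel"
    and side: "(AE x in M. r x \<in> E \<longrightarrow> r x \<le> p x) \<or> (AE x in M. r x \<in> E \<longrightarrow> p x \<le> r x)"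
  shows "AE x in M. r x \<in> E \<longrightarrow> p x = r x"
proof -
  interpret finite_measure M by fact
  define d where "d x = indicator E (r x) * p x - indicator E (r x) * r x" for x
  have int: "integrable M (\<lambda>x. indicator E (r x) * p x)" "integrable M (\<lambda>x. indicator E (r x) * r x)"
    using p r by (auto intro!: integrable_const_bound[where B=1] simp: indicator_def)
  then have d: "integrable M d" "integral\<^sup>L M d = 0" "integral\<^sup>L M (\<lambda>x. - d x) = 0"
    using av by (auto simp: d_def[abs_def] averages_def)
  from side have "AE x in M. d x = 0"
  proof
    assume "AE x in M. r x \<in> E \<longrightarrow> r x \<le> p x"
    then have "AE x in M. 0 \<le> d x" by eventually_elim (auto simp: d_def indicator_def)
    then show ?thesis using integral_nonneg_eq_0_iff_AE[OF d(1)] d(2) by simp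
  next
    assume "AE x in M. r x \<in> E \<longrightarrow> p x \<le> r x"
    then have "AE x in M. 0 \<le> - d x" by eventually_elim (auto simp: d_def indicator_def)
    then show ?thesis using integral_nonneg_eq_0_iff_AE[of M "\<lambda>x. - d x"] d by simp
  qed
  then show ?thesis by eventually_elim (auto simp: d_def)
qed

text \<open>Convexity on \<open>[0, 1]\<close>, in the form used for Jensen's inequality. The end points of the set where
  \<open>H\<close> is finite are exempt, because a convex function may jump upwards there.\<close>

definition has_supporting_lines :: "(real \<Rightarrow> ennreal) \<Rightarrow> bool" where
  "has_supporting_lines H \<longleftrightarrow> (\<forall>x\<in>{0..1}. \<forall>t\<in>{0..1}. \<forall>y\<in>{0..1}. x < t \<and> t < y \<and> H x < \<infinity> \<and> H y < \<infinity> \<longrightarrow>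
     (\<exists>s k. H t = ennreal (s * t + k) \<and> (\<forall>z\<in>{0..1}. ennreal (s * z + k) \<le> H z)))"

text \<open>If the right-hand side is finite, then \<open>p\<close> lies almost everywhere between the end points
  \<open>a\<close> and \<open>b\<close> of the set where \<open>H\<close> is finite. Strictly between them \<open>H\<close> is a
  countable supremum of affine minorants. Where \<open>r\<close> is outside the open interval, it
  coincides with \<open>p\<close> almost everywhere, and the two integrands agree.\<close>

lemma conditional_jensen:
  assumes M: "finite_measure M"
    and pr[measurable]: "p \<in> borel_measurable M" "r \<in> borel_measurable M" "H \<in> borel_measurable borel"
    and p: "\<And>x. x \<in> space M \<Longrightarrow> p x \<in> {0..1}" and r: "\<And>x. x \<in> space M \<Longrightarrow> r x \<in> {0..1}"
    and av: "averages M p r"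
    and H: "has_supporting_lines H"
  shows "(\<integral>\<^sup>+x. H (r x) \<partial>M) \<le> (\<integral>\<^sup>+x. H (p x) \<partial>M)"
proof (cases "(\<integral>\<^sup>+x. H (p x) \<partial>M) < \<infinity>")
  case True
  have fin: "AE x in M. H (p x) \<noteq> \<infinity>"
    using True by (intro nn_integral_PInf_AE) auto
  define D where "D = {x\<in>{0..1}. H x < \<infinity>}"
  have AE_D: "AE x in M. p x \<in> D"
    using fin AE_space by eventually_elim (use p in \<open>auto simp: D_def less_top\<close>)
  show ?thesis
  proof (cases "D = {}")
    case True
    then have "AE x in M. H (r x) = 0" using AE_D by auto
    then have "(\<integral>\<^sup>+x. H (r x) \<partial>M) = 0" by (subst nn_integral_0_iff_AE) auto
    then show ?thesis by simp
  next
    case False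
    define a b where "a = Inf D" and "b = Sup D"
    have bdd: "bdd_below D" "bdd_above D" by (auto simp: D_def intro: bdd_belowI[of _ 0] bdd_aboveI[of _ 1])
    have ab: "a \<le> x" "x \<le> b" if "x \<in> D" for x
      using that bdd by (auto simp: a_def b_def intro: cInf_lower cSup_upper)
    have le_p: "AE x in M. r x \<in> {..a} \<longrightarrow> r x \<le> p x"
      using AE_D by eventually_elim (metis ab(1) atMost_iff order_trans)
    have ge_p: "AE x in M. r x \<in> {b..} \<longrightarrow> p x \<le> r x"
      using AE_D by eventually_elim (metis ab(2) atLeast_iff order_trans)
    have "AE x in M. r x \<in> {..a} \<longrightarrow> p x = r x"
      by (rule averages_forced_equal[OF M pr(1,2) p r av _ disjI1[OF le_p]]) auto
    moreover have "AE x in M. r x \<in> {b..} \<longrightarrow> p x = r x"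
      by (rule averages_forced_equal[OF M pr(1,2) p r av _ disjI2[OF ge_p]]) auto
    ultimately have outer: "AE x in M. r x \<notin> {a<..<b} \<longrightarrow> p x = r x"
      by eventually_elim auto
    \<comment> \<open>The zero function belongs to \<open>L\<close>, so \<open>L\<close> can be enumerated.\<close>
    define L where "L = {(s, k). s \<in> \<rat> \<and> k \<in> \<rat> \<and> (\<forall>x\<in>{0..1}. ennreal (s * x + k) \<le> H x)}"
    have "countable L"
      by (rule countable_subset[of _ "\<rat> \<times> \<rat>"]) (auto simp: L_def countable_rat)
    moreover have "(0, 0) \<in> L" by (auto simp: L_def)
    ultimately have range_L: "range (from_nat_into L) = L"
      by (intro range_from_nat_into) auto
    define l where "l = from_nat_into L"
    have l: "range l = L" unfolding l_def by (rule range_L)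
    define g where "g n t = ennreal (fst (l n) * t + snd (l n))" for n :: nat and t
    have g: "localized_jensen M p r H (g n)" for n
    proof -
      have "l n \<in> L" using l by auto
      then have le: "ennreal (fst (l n) * t + snd (l n)) \<le> H t" if "t \<in> {0..1}" for t
        using that by (auto simp: L_def split: prod.splits)
      show ?thesis unfolding g_def by (rule localized_jensen_affine[OF M pr p r av le])
    qed
    have inner: "H t = (SUP n. g n t)" if t: "t \<in> {a<..<b}" for t
    proof -
      obtain x where x: "x \<in> D" "x < t" using t cInf_lessD[OF False, of t] by (auto simp: a_def)
      obtain y where y: "y \<in> D" "t < y" using t less_cSupD[OF False, of t] by (auto simp: b_def)
      have t01: "t \<in> {0..1}" using x y by (auto simp: D_def)
      obtain s k where "H t = ennreal (s * t + k)" "\<And>z. z \<in> {0..1} \<Longrightarrow> ennreal (s * z + k) \<le> H z"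
        using H t01 x y unfolding has_supporting_lines_def D_def by blast
      then have "H t = (SUP (s, k)\<in>L. ennreal (s * t + k))"
        unfolding L_def by (rule SUP_rational_minorants[OF t01])
      also have "\<dots> = (SUP n. g n t)"
        unfolding l[symmetric] by (simp add: g_def image_image case_prod_beta)
      finally show ?thesis .
    qed
    have "(\<integral>\<^sup>+x. H (r x) \<partial>M) =
        (\<integral>\<^sup>+x. indicator {a<..<b} (r x) * (SUP n. g n (r x)) + indicator (- {a<..<b}) (r x) * H (p x) \<partial>M)"
      by (intro nn_integral_cong_AE)
        (use outer in \<open>eventually_elim, auto simp: indicator_def inner\<close>)
    also have "\<dots> = (\<integral>\<^sup>+x. indicator {a<..<b} (r x) * (SUP n. g n (r x)) \<partial>M) +
        (\<integral>\<^sup>+x. indicator (- {a<..<b}) (r x) * H (p x) \<partial>M)"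
      by (intro nn_integral_add) (auto simp: g_def)
    also have "\<dots> \<le> (\<integral>\<^sup>+x. indicator {a<..<b} (r x) * H (p x) \<partial>M) +
        (\<integral>\<^sup>+x. indicator (- {a<..<b}) (r x) * H (p x) \<partial>M)"
      using localized_jensen_SUP[OF pr g] by (intro add_mono) (auto simp: localized_jensen_def)
    also have "\<dots> = (\<integral>\<^sup>+x. indicator {a<..<b} (r x) * H (p x) + indicator (- {a<..<b}) (r x) * H (p x) \<partial>M)"
      by (intro nn_integral_add[symmetric]) auto
    also have "\<dots> = (\<integral>\<^sup>+x. H (p x) \<partial>M)"
      by (intro nn_integral_cong) (auto simp: indicator_def)
    finally show ?thesis .
  qed
next
  case False then show ?thesis by (metis infinity_ennreal_def top.not_eq_extremum top_greatest)
qed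

section \<open>Data processing for f-divergences\<close>

text \<open>If \<open>P\<close> and \<open>Q\<close> have densities \<open>x\<close> and \<open>1 - x\<close>, this is the contribution of a point
  to the divergence generated by \<open>f t - c * (t - 1)\<close>; its value at \<open>1\<close> accounts for the part of
  \<open>P\<close> that is singular to \<open>Q\<close>.\<close>

definition perspective :: "(real \<Rightarrow> ereal) \<Rightarrow> real \<Rightarrow> real \<Rightarrow> ennreal" where
  "perspective f c x =
     (if x < 1 then ennreal (1 - x) * e2ennreal (f (x / (1 - x)) - ereal (c * (x / (1 - x) - 1)))
      else e2ennreal (conj_slope f - ereal c))"

lemma borel_measurable_perspective:
  assumes "f \<in> csiszar_class"
  shows "perspective f c \<in> borel_measurable borel"
proof -
  have [measurable]: "f \<in> borel_measurable borel"
    using assms by (intro proper_convex_borel_measurable csiszar_classD)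
  show ?thesis unfolding perspective_def[abs_def] by measurable
qed

lemma e2ennreal_diff_finite:
  assumes "e2ennreal (a - ereal b) < \<infinity>"
  shows "a < \<infinity>"
  using assms by (cases a) auto

text \<open>The perspective of an affine function is affine, so the supporting line of \<open>f\<close> at
  \<open>t / (1 - t)\<close> becomes one of the perspective at \<open>t\<close>. It stays below the value at
  \<open>1\<close> because the slope of a minorant of \<open>f\<close> is at most the slope at infinity.\<close>

lemma has_supporting_lines_perspective:
  assumes f: "f \<in> csiszar_class"
  shows "has_supporting_lines (perspective f c)"
  unfolding has_supporting_lines_def
proof (intro ballI impI; elim conjE)
  note D = csiszar_classD[OF f]
  fix x t y :: real
  assume x: "x \<in> {0..1}" and t: "t \<in> {0..1}" and y: "y \<in> {0..1}" and xt: "x < t" and ty: "t < y"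
    and Hx: "perspective f c x < \<infinity>" and Hy: "perspective f c y < \<infinity>"
  define \<phi> :: "real \<Rightarrow> real" where "\<phi> z = z / (1 - z)" for z
  have \<phi>: "\<phi> z < \<phi> z'" if "z < z'" "z' < 1" for z z'
    using that by (simp add: \<phi>_def divide_simps) (simp add: algebra_simps)
  have fin: "f (\<phi> z) < \<infinity>" if "z < 1" "perspective f c z < \<infinity>" for z
  proof (rule e2ennreal_diff_finite)
    show "e2ennreal (f (\<phi> z) - ereal (c * (\<phi> z - 1))) < \<infinity>"
      using that by (auto simp: perspective_def \<phi>_def ennreal_mult_less_top)
  qed
  have t1: "t < 1" using ty y by auto
  \<comment> \<open>A finite value at \<open>y = 1\<close> means a finite slope at infinity, so any larger point will do.\<close>
  obtain w where w: "\<phi> t < w" "f w < \<infinity>"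
  proof (cases "y < 1")
    case True
    then show ?thesis using that[of "\<phi> y"] \<phi>[OF ty True] fin[OF True Hy] by blast
  next
    case False
    then have "conj_slope f < \<infinity>"
      using Hy by (intro e2ennreal_diff_finite[of _ c]) (auto simp: perspective_def)
    moreover have "1 < \<phi> t + 2" using t t1 by (simp add: \<phi>_def add_pos_nonneg)
    ultimately show ?thesis using that[of "\<phi> t + 2"] finite_if_conj_slope_finite[OF f] by auto
  qed
  have x1: "x < 1" using xt t1 by simp
  obtain s k where sk: "f (\<phi> t) = ereal (s * \<phi> t + k)" "\<And>v. ereal (s * v + k) \<le> f v"
    using proper_convex_supporting_line[OF D(1) fin[OF x1 Hx] w(2) \<phi>[OF xt t1] w(1)] by blast
  have scale: "ennreal (1 - z) * e2ennreal (ereal (s * \<phi> z + k) - ereal (c * (\<phi> z - 1))) =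
      ennreal ((s - k - 2 * c) * z + (k + c))" if "z < 1" for z
  proof -
    have "ennreal (1 - z) * e2ennreal (ereal (s * \<phi> z + k) - ereal (c * (\<phi> z - 1))) =
        ennreal ((1 - z) * (s * \<phi> z + k - c * (\<phi> z - 1)))"
      using that by (simp add: ennreal_mult'[symmetric])
    also have "(1 - z) * (s * \<phi> z + k - c * (\<phi> z - 1)) =
        (s - c) * ((1 - z) * \<phi> z) + (k + c) * (1 - z)"
      by (simp add: algebra_simps)
    also have "(1 - z) * \<phi> z = z" using that by (simp add: \<phi>_def)
    also have "(s - c) * z + (k + c) * (1 - z) = (s - k - 2 * c) * z + (k + c)"
      by (simp add: algebra_simps)
    finally show ?thesis .
  qed
  show "\<exists>s k. perspective f c t = ennreal (s * t + k) \<and> (\<forall>z\<in>{0..1}. ennreal (s * z + k) \<le> perspective f c z)"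
  proof (intro exI conjI ballI)
    show "perspective f c t = ennreal ((s - k - 2 * c) * t + (k + c))"
      using scale[OF t1] t1 sk(1) by (simp add: perspective_def \<phi>_def)
    fix z :: real assume z: "z \<in> {0..1}"
    show "ennreal ((s - k - 2 * c) * z + (k + c)) \<le> perspective f c z"
    proof (cases "z < 1")
      case True
      have "ennreal (1 - z) * e2ennreal (ereal (s * \<phi> z + k) - ereal (c * (\<phi> z - 1))) \<le>
          ennreal (1 - z) * e2ennreal (f (\<phi> z) - ereal (c * (\<phi> z - 1)))"
        by (intro mult_left_mono e2ennreal_mono ereal_minus_mono sk(2)) auto
      then show ?thesis using True scale[OF True] by (simp add: perspective_def \<phi>_def)
    next
      case False
      then have "z = 1" using z by auto
      moreover have "e2ennreal (ereal s - ereal c) \<le> e2ennreal (conj_slope f - ereal c)"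
        by (intro e2ennreal_mono ereal_minus_mono conj_slope_ge_minorant_slope[OF f sk(2)]) auto
      ultimately show ?thesis by (simp add: perspective_def)
    qed
  qed
qed

text \<open>With \<open>g = G + l\<close>, the pointwise identity \<open>g\<^sup>+ + l\<^sup>- = G + l\<^sup>+ + g\<^sup>-\<close> can be integrated without any
  subtraction; every term but \<open>g\<^sup>+\<close> and \<open>G\<close> has a finite integral.\<close>

lemma ext_integral_add_integrable:
  assumes G[measurable]: "G \<in> borel_measurable M" and pos: "\<And>x. x \<in> space M \<Longrightarrow> 0 \<le> G x"
    and l: "integrable M l"
  shows "ext_integral M (\<lambda>x. G x + ereal (l x)) =
    enn2ereal (\<integral>\<^sup>+x. e2ennreal (G x) \<partial>M) + ereal (\<integral>x. l x \<partial>M)"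
proof -
  have [measurable]: "l \<in> borel_measurable M" using l by auto
  define A where "A = (\<integral>\<^sup>+x. e2ennreal (G x + ereal (l x)) \<partial>M)"
  define B where "B = (\<integral>\<^sup>+x. e2ennreal (- (G x + ereal (l x))) \<partial>M)"
  define lp where "lp = (\<integral>\<^sup>+x. ennreal (l x) \<partial>M)"
  define ln where "ln = (\<integral>\<^sup>+x. ennreal (- l x) \<partial>M)"
  define GI where "GI = (\<integral>\<^sup>+x. e2ennreal (G x) \<partial>M)"
  have fin: "lp < \<infinity>" "ln < \<infinity>"
    using l by (auto simp: lp_def ln_def real_integrable_def less_top)
  have "B \<le> ln"
    unfolding B_def ln_def
  proof (rule nn_integral_mono)
    fix x assume "x \<in> space M"
    then have "- (G x + ereal (l x)) \<le> - ereal (l x)" using pos[of x] by (cases "G x") auto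
    then show "e2ennreal (- (G x + ereal (l x))) \<le> ennreal (- l x)"
      by (metis e2ennreal_ereal e2ennreal_mono uminus_ereal.simps(1))
  qed
  then have "B < \<infinity>" using fin by (meson le_less_trans)
  have pt: "e2ennreal (G x + ereal (l x)) + ennreal (- l x) =
      e2ennreal (G x) + ennreal (l x) + e2ennreal (- (G x + ereal (l x)))" if "x \<in> space M" for x
  proof (cases "G x")
    case (real g)
    then have g: "0 \<le> g" using pos[OF that] by simp
    have "ennreal (g + l x) + ennreal (- l x) = ennreal g + ennreal (l x) + ennreal (- (g + l x))"
    proof (cases "0 \<le> l x")
      case True then show ?thesis using g by (simp add: ennreal_neg)
    next
      case False
      then show ?thesis using g
        by (cases "0 \<le> g + l x") (auto simp: ennreal_neg simp flip: ennreal_plus)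
    qed
    then show ?thesis using real by simp
  qed (use pos[OF that] in auto)
  have "A + ln = (\<integral>\<^sup>+x. e2ennreal (G x + ereal (l x)) + ennreal (- l x) \<partial>M)"
    unfolding A_def ln_def by (rule nn_integral_add[symmetric]) measurable
  also have "\<dots> = (\<integral>\<^sup>+x. e2ennreal (G x) + ennreal (l x) + e2ennreal (- (G x + ereal (l x))) \<partial>M)"
    by (intro nn_integral_cong pt)
  also have "\<dots> = (\<integral>\<^sup>+x. e2ennreal (G x) + ennreal (l x) \<partial>M) + B"
    unfolding B_def by (rule nn_integral_add) measurable
  also have "(\<integral>\<^sup>+x. e2ennreal (G x) + ennreal (l x) \<partial>M) = GI + lp"
    unfolding GI_def lp_def by (rule nn_integral_add) measurable
  finally have eq: "A + ln = GI + lp + B" .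
  have "(\<integral>x. l x \<partial>M) = enn2real lp - enn2real ln"
    using real_lebesgue_integral_def[OF l] by (simp add: lp_def ln_def)
  then show ?thesis
    using eq fin \<open>B < \<infinity>\<close> unfolding ext_integral_def A_def[symmetric] B_def[symmetric] GI_def[symmetric]
    by (cases A; cases B; cases GI; cases lp; cases ln)
      (auto simp flip: ennreal_plus simp: top_unique)
qed

text \<open>The likelihood ratio is \<open>p / (1 - p)\<close>, which is infinite exactly where \<open>p = 1\<close>. The line
  \<open>c * (t - 1)\<close> contributes \<open>- c * \<pi>\<close> to the integral over \<open>Q\<close>, with \<open>\<pi>\<close> the mass that
  \<open>P\<close> gives to this set, and the singular term of the perspective compensates for it.\<close>

lemma f_divergence_eq_perspective:
  assumes f: "f \<in> csiszar_class" and c: "\<And>t. ereal (c * (t - 1)) \<le> f t"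
    and \<sigma>: "finite_measure \<sigma>"
    and p[measurable]: "p \<in> borel_measurable \<sigma>" and p01: "\<And>x. x \<in> space \<sigma> \<Longrightarrow> p x \<in> {0..1}"
    and P: "P = density \<sigma> (\<lambda>x. ennreal (p x))" "prob_space P"
    and Q: "Q = density \<sigma> (\<lambda>x. ennreal (1 - p x))" "prob_space Q"
  shows "f_divergence f P Q = enn2ereal (\<integral>\<^sup>+x. perspective f c (p x) \<partial>\<sigma>)"
proof -
  note D = csiszar_classD[OF f]
  interpret \<sigma>: finite_measure \<sigma> by fact
  interpret P: prob_space P by fact
  interpret Q: prob_space Q by fact
  have [measurable]: "f \<in> borel_measurable borel" by (intro proper_convex_borel_measurable D)
  have setsP: "sets P = sets \<sigma>" and setsQ: "sets Q = sets \<sigma>" using P Q by auto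
  have [simp]: "space P = space \<sigma>" "space Q = space \<sigma>" using P Q by auto
  define \<phi> :: "real \<Rightarrow> real" where "\<phi> z = z / (1 - z)" for z
  have [measurable]: "\<phi> \<in> borel_measurable borel" unfolding \<phi>_def[abs_def] by measurable
  define S where "S = {x \<in> space \<sigma>. p x = 1}"
  have S[measurable]: "S \<in> sets \<sigma>" unfolding S_def by measurable
  let ?r = "likelihood_ratio \<sigma> P Q"
  have div_wrt: "f_divergence f P Q = f_divergence_wrt \<sigma> f P Q"
  proof (rule f_divergence_eq_wrt)
    show "absolutely_continuous \<sigma> P" "absolutely_continuous \<sigma> Q"
      unfolding P(1) Q(1) by (intro absolutely_continuousI_density; measurable)+
  qed (unfold_locales, auto simp: setsP setsQ)
  have ratio: "AE x in \<sigma>. ?r x = ennreal (p x) / ennreal (1 - p x)"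
    using \<sigma>.RN_deriv_unique[OF _ P(1)[symmetric]] \<sigma>.RN_deriv_unique[OF _ Q(1)[symmetric]]
    by (auto simp: likelihood_ratio_def elim!: eventually_elim2)
  have ratioQ: "AE x in Q. enn2real (?r x) = \<phi> (p x)"
    unfolding Q(1)
  proof (subst AE_density)
    show "AE x in \<sigma>. 0 < ennreal (1 - p x) \<longrightarrow> enn2real (likelihood_ratio \<sigma> P (density \<sigma> (\<lambda>x. ennreal (1 - p x))) x) = \<phi> (p x)"
      using ratio AE_space
    proof eventually_elim
      case (elim x)
      then show ?case using p01[of x] Q(1)
        by (auto simp: divide_ennreal \<phi>_def)
    qed
  qed measurable
  have "AE x in \<sigma>. ?r x = \<infinity> \<longleftrightarrow> x \<in> S"
    using ratio AE_space
  proof eventually_elim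
    case (elim x)
    then show ?case using p01[of x]
      by (cases "p x = 1") (auto simp: S_def divide_ennreal ennreal_divide_zero)
  qed
  then have "AE x in P. ?r x = \<infinity> \<longleftrightarrow> x \<in> S"
    unfolding P(1) by (subst AE_density) (auto elim!: eventually_mono)
  then have PS: "measure P {x \<in> space P. ?r x = \<infinity>} = measure P S"
    using sets.sets_into_space[OF S]
    by (intro P.finite_measure_eq_AE)
      (auto simp: likelihood_ratio_def setsP elim!: eventually_mono)
  define \<pi> where "\<pi> = measure P S"
  have emS: "emeasure P S = emeasure \<sigma> S"
    unfolding P(1) by (subst emeasure_density)
      (auto simp: S_def indicator_def intro!: nn_integral_cong simp flip: nn_integral_indicator)
  define l where "l x = c * (\<phi> (p x) - 1)" for x
  define G where "G x = f (\<phi> (p x)) - ereal (l x)" for x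
  have G0: "0 \<le> G x" for x
    using c[of "\<phi> (p x)"] D(3)[of "\<phi> (p x)"] by (cases "f (\<phi> (p x))") (auto simp: G_def l_def)
  have G_l: "f (\<phi> (p x)) = G x + ereal (l x)" for x
    using D(3)[of "\<phi> (p x)"] by (cases "f (\<phi> (p x))") (auto simp: G_def)
  have prod: "(1 - p x) * \<phi> (p x) = p x * indicator (space \<sigma> - S) x" if "x \<in> space \<sigma>" for x
    using that by (auto simp: S_def \<phi>_def)
  have int_p: "integrable \<sigma> (\<lambda>x. p x * indicator (space \<sigma> - S) x)"
    using p01 by (intro \<sigma>.integrable_const_bound[where B=1]) (auto simp: indicator_def)
  have int_\<phi>_\<sigma>: "integrable \<sigma> (\<lambda>x. (1 - p x) * \<phi> (p x))"
    using int_p by (subst Bochner_Integration.integrable_cong[OF refl prod])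
  have int_\<phi>: "integrable Q (\<lambda>x. \<phi> (p x))"
    unfolding Q(1)
    by (subst integrable_real_density)
      (use p01 int_\<phi>_\<sigma> in auto)
  have "(\<integral>x. \<phi> (p x) \<partial>Q) = (\<integral>x. (1 - p x) * \<phi> (p x) \<partial>\<sigma>)"
    unfolding Q(1) by (subst integral_real_density) (use p01 in auto)
  also have "\<dots> = (\<integral>x. p x * indicator (space \<sigma> - S) x \<partial>\<sigma>)"
    by (intro Bochner_Integration.integral_cong prod refl)
  also have "\<dots> = (\<integral>x. indicator (space \<sigma> - S) x \<partial>P)"
    unfolding P(1) by (subst integral_real_density) (use p01 in auto)
  also have "\<dots> = 1 - \<pi>"
    using S P.prob_compl[of S] by (simp add: \<pi>_def setsP)
  finally have int_\<phi>_eq: "(\<integral>x. \<phi> (p x) \<partial>Q) = 1 - \<pi>" .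
  have "(\<integral>x. l x \<partial>Q) = - c * \<pi>"
    unfolding l_def using int_\<phi> Q.prob_space by (simp add: int_\<phi>_eq algebra_simps)
  moreover have "integrable Q l" unfolding l_def[abs_def] using int_\<phi> by auto
  moreover have "G \<in> borel_measurable Q"
    unfolding G_def[abs_def] l_def[abs_def] measurable_cong_sets[OF setsQ refl] by measurable
  moreover have "ext_integral Q (\<lambda>x. f (enn2real (?r x))) = ext_integral Q (\<lambda>x. G x + ereal (l x))"
    unfolding ext_integral_def
    by (intro arg_cong2[where f="(-)"] arg_cong[where f=enn2ereal] nn_integral_cong_AE;
        use ratioQ in eventually_elim) (auto simp: G_l)
  ultimately have div: "f_divergence f P Q =
      enn2ereal (\<integral>\<^sup>+x. e2ennreal (G x) \<partial>Q) + ereal (- c * \<pi>) + conj_slope f * ereal \<pi>"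
    using ext_integral_add_integrable[of G Q l] G0
    unfolding div_wrt f_divergence_wrt_def PS \<pi>_def by simp
  have slope: "ereal c \<le> conj_slope f"
    by (rule conj_slope_ge_minorant_slope[OF f, of _ "- c"]) (use c in \<open>simp add: algebra_simps\<close>)
  have "(\<integral>\<^sup>+x. perspective f c (p x) \<partial>\<sigma>) =
      (\<integral>\<^sup>+x. ennreal (1 - p x) * e2ennreal (G x) + e2ennreal (conj_slope f - ereal c) * indicator S x \<partial>\<sigma>)"
  proof (rule nn_integral_cong)
    fix x assume "x \<in> space \<sigma>"
    then show "perspective f c (p x) =
        ennreal (1 - p x) * e2ennreal (G x) + e2ennreal (conj_slope f - ereal c) * indicator S x"
      using p01[of x] by (cases "p x = 1") (auto simp: perspective_def S_def G_def l_def \<phi>_def)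
  qed
  also have "\<dots> = (\<integral>\<^sup>+x. e2ennreal (G x) \<partial>Q) + e2ennreal (conj_slope f - ereal c) * ennreal \<pi>"
    unfolding Q(1) \<pi>_def P.emeasure_eq_measure[symmetric] emS
    by (subst nn_integral_density, measurable, simp_all add: G_def[abs_def] l_def[abs_def] nn_integral_add nn_integral_cmult)
  finally have persp: "enn2ereal (\<integral>\<^sup>+x. perspective f c (p x) \<partial>\<sigma>) =
      enn2ereal (\<integral>\<^sup>+x. e2ennreal (G x) \<partial>Q) + enn2ereal (e2ennreal (conj_slope f - ereal c) * ennreal \<pi>)"
    by (simp add: plus_ennreal.rep_eq)
  have "ereal (- c * \<pi>) + conj_slope f * ereal \<pi> = enn2ereal (e2ennreal (conj_slope f - ereal c) * ennreal \<pi>)"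
  proof -
    have "0 \<le> \<pi>" by (simp add: \<pi>_def)
    moreover have "0 \<le> conj_slope f - ereal c" using slope by (cases "conj_slope f") auto
    ultimately have "enn2ereal (e2ennreal (conj_slope f - ereal c) * ennreal \<pi>) =
        (conj_slope f - ereal c) * ereal \<pi>"
      by (simp add: times_ennreal.rep_eq enn2ereal_e2ennreal)
    also have "\<dots> = ereal (- c * \<pi>) + conj_slope f * ereal \<pi>"
      using slope \<open>0 \<le> \<pi>\<close> by (cases "conj_slope f") (auto simp: algebra_simps)
    finally show ?thesis by simp
  qed
  then show ?thesis using div persp by (simp add: add.assoc)
qed

text \<open>With respect to \<open>P + Q\<close> the two densities add up to \<open>1\<close> almost everywhere; truncating the
  first one at \<open>1\<close> gives a version with values in \<open>[0, 1]\<close>.\<close>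

lemma density_wrt_sum:
  assumes P: "prob_space P" and Q: "prob_space Q" and sets: "sets P = sets Q"
  obtains \<sigma> p where "finite_measure \<sigma>" "sets \<sigma> = sets P"
    "\<And>A. A \<in> sets P \<Longrightarrow> emeasure \<sigma> A = emeasure P A + emeasure Q A"
    "p \<in> borel_measurable \<sigma>" "\<And>x. p x \<in> {0..1}"
    "P = density \<sigma> (\<lambda>x. ennreal (p x))" "Q = density \<sigma> (\<lambda>x. ennreal (1 - p x))"
proof -
  interpret P: prob_space P by fact
  interpret Q: prob_space Q by fact
  define \<sigma> where "\<sigma> = add_measure P Q"
  have sets\<sigma>: "sets \<sigma> = sets P" by (simp add: \<sigma>_def)
  have em: "emeasure \<sigma> A = emeasure P A + emeasure Q A" if "A \<in> sets P" for A
    using that sets by (simp add: \<sigma>_def emeasure_add_measure)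
  interpret \<sigma>: finite_measure \<sigma>
    by (rule finite_measureI) (use em[of "space P"] sets_eq_imp_space_eq[OF sets\<sigma>] in simp)
  have ac: "absolutely_continuous \<sigma> P" "absolutely_continuous \<sigma> Q"
    using sets sets\<sigma> em by (auto simp: absolutely_continuous_def null_sets_def)
  define dp dq where "dp = RN_deriv \<sigma> P" and "dq = RN_deriv \<sigma> Q"
  have [measurable]: "dp \<in> borel_measurable \<sigma>" "dq \<in> borel_measurable \<sigma>"
    by (auto simp: dp_def dq_def)
  have dP: "density \<sigma> dp = P" and dQ: "density \<sigma> dq = Q"
    unfolding dp_def dq_def using sets sets\<sigma> by (intro \<sigma>.density_RN_deriv ac; simp)+
  have sum1: "AE x in \<sigma>. dp x + dq x = 1"
  proof (rule \<sigma>.density_unique)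
    show "density \<sigma> (\<lambda>x. dp x + dq x) = density \<sigma> (\<lambda>_. 1)"
    proof (rule measure_eqI)
      fix A assume "A \<in> sets (density \<sigma> (\<lambda>x. dp x + dq x))"
      then have A[measurable]: "A \<in> sets \<sigma>" by simp
      have "emeasure (density \<sigma> (\<lambda>x. dp x + dq x)) A = emeasure (density \<sigma> dp) A + emeasure (density \<sigma> dq) A"
        by (simp add: emeasure_density nn_integral_add[symmetric] distrib_right)
      also have "\<dots> = emeasure (density \<sigma> (\<lambda>_. 1)) A"
        using A em[of A] sets\<sigma> by (simp add: dP dQ density_1)
      finally show "emeasure (density \<sigma> (\<lambda>x. dp x + dq x)) A = emeasure (density \<sigma> (\<lambda>_. 1)) A" .
    qed simp
  qed auto
  define p where "p x = min 1 (enn2real (dp x))" for x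
  have "AE x in \<sigma>. dp x = ennreal (p x) \<and> dq x = ennreal (1 - p x)"
    using sum1
  proof eventually_elim
    case (elim x)
    then obtain a b where ab: "dp x = ennreal a" "dq x = ennreal b" "0 \<le> a" "0 \<le> b"
      by (cases "dp x"; cases "dq x") auto
    then have "a + b = 1" using elim by (simp flip: ennreal_plus)
    then show ?case using ab by (auto simp: p_def)
  qed
  then have *: "AE x in \<sigma>. dp x = ennreal (p x)" "AE x in \<sigma>. dq x = ennreal (1 - p x)" by auto
  have [measurable]: "p \<in> borel_measurable \<sigma>" unfolding p_def[abs_def] by measurable
  show ?thesis
  proof (rule that[of \<sigma> p])
    show "P = density \<sigma> (\<lambda>x. ennreal (p x))"
      unfolding dP[symmetric] by (intro density_cong *) auto
    show "Q = density \<sigma> (\<lambda>x. ennreal (1 - p x))"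
      unfolding dQ[symmetric] by (intro density_cong *) auto
  qed (use em sets\<sigma> in \<open>auto simp: p_def \<sigma>.finite_measure_axioms\<close>)
qed

text \<open>The data processing inequality. On the source space the density of the image of \<open>P\<close>, composed
  with \<open>G\<close>, averages the density of \<open>P\<close>, and Jensen's inequality applies.\<close>

lemma f_divergence_distr_le:
  assumes f: "f \<in> csiszar_class"
    and P: "prob_space P" and Q: "prob_space Q" and sets: "sets P = sets Q"
    and G: "G \<in> measurable P N"
  shows "f_divergence f (distr P N G) (distr Q N G) \<le> f_divergence f P Q"
proof -
  obtain c where c: "\<And>t. ereal (c * (t - 1)) \<le> f t" using csiszar_class_minorant[OF f] by blast
  obtain \<sigma> p where \<sigma>: "finite_measure \<sigma>" "sets \<sigma> = sets P"
      and em: "\<And>A. A \<in> sets P \<Longrightarrow> emeasure \<sigma> A = emeasure P A + emeasure Q A"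
      and p[measurable]: "p \<in> borel_measurable \<sigma>" and p01: "\<And>x. p x \<in> {0..1}"
      and dens: "P = density \<sigma> (\<lambda>x. ennreal (p x))" "Q = density \<sigma> (\<lambda>x. ennreal (1 - p x))"
    by (rule density_wrt_sum[OF P Q sets]) blast
  have G_meas[measurable]: "G \<in> measurable \<sigma> N" "G \<in> measurable Q N"
    using G by (simp_all add: measurable_cong_sets[OF \<sigma>(2) refl] measurable_cong_sets[OF sets[symmetric] refl])
  define P' Q' where "P' = distr P N G" and "Q' = distr Q N G"
  have P': "prob_space P'" and Q': "prob_space Q'"
    unfolding P'_def Q'_def by (intro prob_space.prob_space_distr P Q G G_meas)+
  obtain \<tau> r where \<tau>: "finite_measure \<tau>" "sets \<tau> = sets P'"
      and em': "\<And>A. A \<in> sets P' \<Longrightarrow> emeasure \<tau> A = emeasure P' A + emeasure Q' A"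
      and r[measurable]: "r \<in> borel_measurable \<tau>" and r01: "\<And>x. r x \<in> {0..1}"
      and dens': "P' = density \<tau> (\<lambda>x. ennreal (r x))" "Q' = density \<tau> (\<lambda>x. ennreal (1 - r x))"
    by (rule density_wrt_sum[OF P' Q']) (auto simp: P'_def Q'_def)
  have setsN: "sets \<tau> = sets N" using \<tau>(2) by (simp add: P'_def)
  have rN[measurable]: "r \<in> borel_measurable N" using r by (simp add: measurable_cong_sets[OF setsN refl])
  have sp: "space Q = space P" "space \<sigma> = space P"
    using sets_eq_imp_space_eq[OF sets] sets_eq_imp_space_eq[OF \<sigma>(2)] by auto
  have \<tau>_distr: "\<tau> = distr \<sigma> N G"
  proof (rule measure_eqI)
    fix A assume "A \<in> sets \<tau>"
    then have A: "A \<in> sets N" by (simp add: setsN)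
    then show "emeasure \<tau> A = emeasure (distr \<sigma> N G) A"
      using em'[of A] em[of "G -` A \<inter> space P"] measurable_sets[OF G A] G G_meas
      by (simp add: P'_def Q'_def emeasure_distr sp)
  qed (simp add: setsN)
  have "averages \<sigma> p (\<lambda>x. r (G x))"
    unfolding averages_def
  proof
    fix E :: "real set" assume [measurable]: "E \<in> sets borel"
    have "(\<integral>x. indicator E (r (G x)) * p x \<partial>\<sigma>) = (\<integral>x. p x * indicator E (r (G x)) \<partial>\<sigma>)"
      by (simp add: mult.commute)
    also have "\<dots> = (\<integral>x. indicator E (r (G x)) \<partial>P)"
      unfolding dens(1) by (rule integral_real_density[symmetric]) (use p01 in auto)
    also have "\<dots> = (\<integral>y. indicator E (r y) \<partial>P')"
      unfolding P'_def by (rule integral_distr[symmetric, OF G]) measurable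
    also have "\<dots> = (\<integral>y. r y * indicator E (r y) \<partial>\<tau>)"
      unfolding dens'(1) by (rule integral_real_density) (use r01 in auto)
    also have "\<dots> = (\<integral>x. r (G x) * indicator E (r (G x)) \<partial>\<sigma>)"
      unfolding \<tau>_distr by (rule integral_distr) measurable
    finally show "(\<integral>x. indicator E (r (G x)) * p x \<partial>\<sigma>) = (\<integral>x. indicator E (r (G x)) * r (G x) \<partial>\<sigma>)"
      by (simp add: mult.commute)
  qed
  then have "(\<integral>\<^sup>+x. perspective f c (r (G x)) \<partial>\<sigma>) \<le> (\<integral>\<^sup>+x. perspective f c (p x) \<partial>\<sigma>)"
    using p01 r01
    by (intro conditional_jensen \<sigma> borel_measurable_perspective f has_supporting_lines_perspective) auto
  moreover have "(\<integral>\<^sup>+x. perspective f c (r (G x)) \<partial>\<sigma>) = (\<integral>\<^sup>+y. perspective f c (r y) \<partial>\<tau>)"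
    unfolding \<tau>_distr
    by (rule nn_integral_distr[symmetric])
      (use borel_measurable_perspective[OF f, measurable] in measurable)
  moreover have "f_divergence f P' Q' = enn2ereal (\<integral>\<^sup>+y. perspective f c (r y) \<partial>\<tau>)"
    by (rule f_divergence_eq_perspective[OF f c \<tau>(1) r r01 dens'(1) P' dens'(2) Q'])
  moreover have "f_divergence f P Q = enn2ereal (\<integral>\<^sup>+x. perspective f c (p x) \<partial>\<sigma>)"
    by (rule f_divergence_eq_perspective[OF f c \<sigma>(1) p p01 dens(1) P dens(2) Q])
  ultimately show ?thesis
    by (simp add: P'_def Q'_def less_eq_ennreal.rep_eq)
qed

text \<open>An independent component with the same law under both measures does not enter the densities.\<close>

lemma f_divergence_pair_measure:
  assumes f: "f \<in> csiszar_class"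
    and P: "prob_space P" and Q: "prob_space Q" and sets: "sets P = sets Q" and R: "prob_space R"
  shows "f_divergence f (R \<Otimes>\<^sub>M P) (R \<Otimes>\<^sub>M Q) = f_divergence f P Q"
proof -
  obtain c where c: "\<And>t. ereal (c * (t - 1)) \<le> f t" using csiszar_class_minorant[OF f] by blast
  obtain \<sigma> p where \<sigma>: "finite_measure \<sigma>" "sets \<sigma> = sets P"
      and p[measurable]: "p \<in> borel_measurable \<sigma>" and p01: "\<And>x. p x \<in> {0..1}"
      and dens: "P = density \<sigma> (\<lambda>x. ennreal (p x))" "Q = density \<sigma> (\<lambda>x. ennreal (1 - p x))"
    by (rule density_wrt_sum[OF P Q sets]) blast
  interpret \<sigma>: finite_measure \<sigma> by fact
  interpret R: prob_space R by fact
  have pair: "R \<Otimes>\<^sub>M density \<sigma> (\<lambda>x. ennreal (q x)) = density (R \<Otimes>\<^sub>M \<sigma>) (\<lambda>z. ennreal (q (snd z)))"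
    if q[measurable]: "q \<in> borel_measurable \<sigma>" and "prob_space (density \<sigma> (\<lambda>x. ennreal (q x)))" for q
  proof -
    have "density R (\<lambda>_. 1) \<Otimes>\<^sub>M density \<sigma> (\<lambda>x. ennreal (q x)) =
        density (R \<Otimes>\<^sub>M \<sigma>) (\<lambda>(x, y). 1 * ennreal (q y))"
      by (rule pair_measure_density)
        (use that(2) in \<open>auto intro: prob_space_imp_sigma_finite \<sigma>.sigma_finite_measure_axioms\<close>)
    then show ?thesis by (simp add: density_1 case_prod_unfold)
  qed
  interpret RP: pair_prob_space R P using R P by (simp add: pair_prob_space_def pair_sigma_finite_def prob_space_imp_sigma_finite)
  interpret RQ: pair_prob_space R Q using R Q by (simp add: pair_prob_space_def pair_sigma_finite_def prob_space_imp_sigma_finite)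
  have fin: "finite_measure (R \<Otimes>\<^sub>M \<sigma>)" by (rule finite_measure_pair_measure) unfold_locales
  have "f_divergence f (R \<Otimes>\<^sub>M P) (R \<Otimes>\<^sub>M Q) = enn2ereal (\<integral>\<^sup>+z. perspective f c (p (snd z)) \<partial>(R \<Otimes>\<^sub>M \<sigma>))"
  proof (rule f_divergence_eq_perspective[OF f c fin])
    show "R \<Otimes>\<^sub>M P = density (R \<Otimes>\<^sub>M \<sigma>) (\<lambda>z. ennreal (p (snd z)))"
      using pair[of p] dens(1) P by simp
    show "R \<Otimes>\<^sub>M Q = density (R \<Otimes>\<^sub>M \<sigma>) (\<lambda>z. ennreal (1 - p (snd z)))"
      using pair[of "\<lambda>x. 1 - p x"] dens(2) Q by simp
  qed (use p01 in \<open>auto intro: RP.prob_space_axioms RQ.prob_space_axioms\<close>)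
  also have "(\<integral>\<^sup>+z. perspective f c (p (snd z)) \<partial>(R \<Otimes>\<^sub>M \<sigma>)) = (\<integral>\<^sup>+x. perspective f c (p x) \<partial>\<sigma>)"
    using borel_measurable_perspective[OF f, measurable]
    by (subst \<sigma>.nn_integral_fst[symmetric]) (simp_all add: R.emeasure_space_1)
  also have "enn2ereal \<dots> = f_divergence f P Q"
    by (rule f_divergence_eq_perspective[OF f c \<sigma>(1) p p01 dens(1) P dens(2) Q, symmetric])
  finally show ?thesis .
qed

section \<open>Copulas and quantile transforms\<close>

lemma borel_measurable_vec_nth [measurable]:
  fixes f :: "'a \<Rightarrow> real^'d"
  assumes "f \<in> borel_measurable M"
  shows "(\<lambda>x. f x $ i) \<in> borel_measurable M"
  unfolding cart_eq_inner_axis using assms by (intro borel_measurable_inner borel_measurable_const)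

lemma borel_measurable_vec_lambda [measurable]:
  fixes f :: "'d::finite \<Rightarrow> 'a \<Rightarrow> real"
  assumes "\<And>i. f i \<in> borel_measurable M"
  shows "(\<lambda>x. (\<chi> i. f i x) :: real^'d) \<in> borel_measurable M"
proof (rule borel_measurable_euclidean_space[THEN iffD2], intro ballI)
  fix b :: "real^'d" assume "b \<in> Basis"
  then obtain i where b: "b = axis i 1" by (auto simp: Basis_vec_def)
  have "(\<lambda>x. (\<chi> i. f i x) \<bullet> b) = f i" by (simp add: b inner_axis)
  then show "(\<lambda>x. (\<chi> i. f i x) \<bullet> b) \<in> borel_measurable M" using assms by simp
qed

lemma borel_measurable_left_part [measurable]: "left_part \<in> borel_measurable borel"
  and borel_measurable_right_part [measurable]: "right_part \<in> borel_measurable borel"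
  unfolding left_part_def[abs_def] right_part_def[abs_def]
  by (rule borel_measurable_vec_lambda, rule borel_measurable_vec_nth, simp)+

lemma borel_measurable_join_vec [measurable]:
  fixes f :: "'a \<Rightarrow> real^'m" and g :: "'a \<Rightarrow> real^'n"
  assumes [measurable]: "f \<in> borel_measurable M" "g \<in> borel_measurable M"
  shows "(\<lambda>x. join_vec (f x) (g x)) \<in> borel_measurable M"
  unfolding join_vec_def
proof (rule borel_measurable_vec_lambda)
  fix k :: "'m + 'n" show "(\<lambda>x. case k of Inl i \<Rightarrow> f x $ i | Inr j \<Rightarrow> g x $ j) \<in> borel_measurable M"
    using assms by (cases k) (simp_all add: borel_measurable_vec_nth)
qed

lemma join_vec_parts [simp]:
  "join_vec x y $ Inl i = x $ i" "join_vec x y $ Inr j = y $ j"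
  "left_part (join_vec x y) = x" "right_part (join_vec x y) = y"
  "join_vec (left_part z) (right_part z) = z"
  by (auto simp: join_vec_def left_part_def right_part_def vec_eq_iff split: sum.split)

lemma join_vec_le_iff: "z \<le> join_vec x y \<longleftrightarrow> left_part z \<le> x \<and> right_part z \<le> y"
proof -
  have "(\<forall>k. z $ k \<le> join_vec x y $ k) \<longleftrightarrow> (\<forall>i. z $ Inl i \<le> x $ i) \<and> (\<forall>j. z $ Inr j \<le> y $ j)"
    by (metis join_vec_parts(1,2) sum.exhaust)
  then show ?thesis by (simp add: less_eq_vec_def left_part_def right_part_def)
qed

lemma join_vec_mem_cube: "join_vec x y \<in> {0..1} \<longleftrightarrow> x \<in> {0..1} \<and> y \<in> {0..1}"
proof -
  have "(\<forall>k. 0 \<le> join_vec x y $ k \<and> join_vec x y $ k \<le> 1) \<longleftrightarrow>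
      (\<forall>i. 0 \<le> x $ i \<and> x $ i \<le> 1) \<and> (\<forall>j. 0 \<le> y $ j \<and> y $ j \<le> 1)"
    by (metis join_vec_parts(1,2) sum.exhaust)
  then show ?thesis by (auto simp: less_eq_vec_def)
qed

lemma lower_orthant_borel [measurable]: "{..u :: real^'d} \<in> sets borel"
proof -
  have "{..u} = {x. \<forall>i. x $ i \<le> u $ i}" by (auto simp: less_eq_vec_def)
  then show ?thesis
    by (simp add: closed_Collect_all closed_Collect_le continuous_intros borel_closed)
qed

lemma finite_measure_eq_if_joint_cdf_eq:
  fixes \<mu> \<nu> :: "(real^'d) measure"
  assumes "finite_measure \<mu>" "finite_measure \<nu>" "sets \<mu> = sets borel" "sets \<nu> = sets borel"
    and eq: "\<And>z. joint_cdf \<mu> z = joint_cdf \<nu> z"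
  shows "\<mu> = \<nu>"
proof -
  interpret \<mu>: finite_measure \<mu> by fact
  interpret \<nu>: finite_measure \<nu> by fact
  let ?E = "range (\<lambda>a::real^'d. {..a})"
  have b: "sets borel = sigma_sets UNIV ?E"
    by (subst borel_eq_atMost) (simp add: sets_measure_of)
  show ?thesis
  proof (rule measure_eqI_generator_eq[where E="?E" and \<Omega>=UNIV and A="\<lambda>n::nat. {..(\<chi> i. real n)}"])
    show "Int_stable ?E"
    proof (rule Int_stableI, safe)
      fix a b :: "real^'d"
      have "{..a} \<inter> {..b} = {..(\<chi> i. min (a $ i) (b $ i))}"
        by (auto simp: less_eq_vec_def)
      then show "{..a} \<inter> {..b} \<in> ?E" by blast
    qed
    show "emeasure \<mu> A = emeasure \<nu> A" if "A \<in> ?E" for A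
      using that eq by (auto simp: \<mu>.emeasure_eq_measure \<nu>.emeasure_eq_measure joint_cdf_def)
    show "(\<Union>n. {..(\<chi> i. real n)::real^'d}) = UNIV"
    proof safe
      fix x :: "real^'d"
      obtain n :: nat where n: "Max (range (($) x)) \<le> real n" using real_arch_simple by blast
      have "x $ i \<le> real n" for i using n Max_ge[of "range (($) x)" "x $ i"] by simp
      then show "x \<in> (\<Union>n. {..(\<chi> i. real n)})" by (auto simp: less_eq_vec_def)
    qed simp
  qed (use assms b in auto)
qed

lemma copula_measure_eqI:
  assumes "copula_law \<mu>" "\<And>u. u \<in> {0..1} \<Longrightarrow> C u = joint_cdf \<mu> u"
  shows "copula_measure C = \<mu>"
  unfolding copula_measure_def
  using assms by (intro the_equality) (auto intro!: copula_law_unique)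

lemma is_copulaI:
  assumes "copula_law \<mu>" "\<And>u. u \<in> {0..1} \<Longrightarrow> C u = joint_cdf \<mu> u"
  shows "is_copula C"
  using assms unfolding is_copula_def by blast

lemma copula_lawD:
  assumes "copula_law \<mu>"
  shows "prob_space \<mu>" "sets \<mu> = sets borel" "space \<mu> = UNIV" "AE u in \<mu>. u \<in> {0..1}"
    "distr \<mu> borel (\<lambda>x. x $ i) = uniform_measure lborel {0..1}"
  using assms sets_eq_imp_space_eq[of \<mu> borel] by (auto simp: copula_law_def)

lemma uniform_01_AE:
  "AE t in uniform_measure lborel {0..1::real}. 0 < t \<and> t < 1"
  using AE_lborel_singleton[of 0] AE_lborel_singleton[of 1]
  by (auto intro!: AE_uniform_measureI elim!: eventually_elim2)

lemma copula_law_AE_interior: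
  fixes \<mu> :: "(real^'d) measure"
  assumes \<mu>: "copula_law \<mu>"
  shows "AE u in \<mu>. \<forall>i. 0 < u $ i \<and> u $ i < 1"
proof (rule AE_all_countable[THEN iffD2, rule_format])
  fix i :: 'd
  have [measurable_cong]: "sets \<mu> = sets borel" using copula_lawD[OF \<mu>] by simp
  have "AE t in distr \<mu> borel (\<lambda>x. x $ i). 0 < t \<and> t < 1"
    unfolding copula_lawD(5)[OF \<mu>] by (rule uniform_01_AE)
  then show "AE u in \<mu>. 0 < u $ i \<and> u $ i < 1"
    by (subst (asm) AE_distr_iff) auto
qed

text \<open>The infimum has its meaning only for levels in the open unit interval. The default value elsewhere
  keeps the function Borel measurable; those levels are null for a uniform law.\<close>

definition quantile :: "real measure \<Rightarrow> real \<Rightarrow> real" where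
  "quantile \<mu> t = (if 0 < t \<and> t < 1 then Inf {x. t \<le> cdf \<mu> x} else 0)"

lemma quantile_le_iff:
  assumes "real_distribution \<mu>" "0 < t" "t < 1"
  shows "quantile \<mu> t \<le> x \<longleftrightarrow> t \<le> cdf \<mu> x"
proof -
  interpret cdf_distribution \<mu> using assms(1) by (simp add: cdf_distribution_def)
  show ?thesis using assms(2,3) pseudoinverse[of t x] by (simp add: quantile_def)
qed

lemma borel_measurable_quantile:
  assumes "real_distribution \<mu>"
  shows "quantile \<mu> \<in> borel_measurable borel"
proof (rule borel_measurableI_le)
  fix x
  have "{t \<in> space borel. quantile \<mu> t \<le> x} =
      ({0<..<1} \<inter> {..cdf \<mu> x}) \<union> (if 0 \<le> x then - {0<..<1} else {})"
    using quantile_le_iff[OF assms, of _ x] by (auto simp: quantile_def)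
  then show "{t \<in> space borel. quantile \<mu> t \<le> x} \<in> sets borel" by auto
qed

definition quantile_vec :: "'w measure \<Rightarrow> ('w \<Rightarrow> real^'d) \<Rightarrow> real^'d \<Rightarrow> real^'d" where
  "quantile_vec M Z u = (\<chi> i. quantile (distr M borel (\<lambda>\<omega>. Z \<omega> $ i)) (u $ i))"

lemma borel_measurable_quantile_vec:
  assumes "prob_space M" and [measurable]: "Z \<in> borel_measurable M"
  shows "quantile_vec M Z \<in> borel_measurable borel"
proof -
  interpret prob_space M by fact
  have [measurable]: "quantile (distr M borel (\<lambda>\<omega>. Z \<omega> $ i)) \<in> borel_measurable borel" for i
    by (intro borel_measurable_quantile real_distribution_distr) measurable
  show ?thesis unfolding quantile_vec_def[abs_def] by measurable
qed

text \<open>The Galois connection between quantiles and distribution functions turns the event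
  \<open>quantile_vec M Z u \<le> z\<close> into a lower orthant for \<open>u\<close>, whose mass is a value of \<open>C\<close>.\<close>

lemma distr_copula_quantile_vec:
  fixes M :: "'w measure" and Z :: "'w \<Rightarrow> real^'d"
  assumes M: "prob_space M" and Z[measurable]: "Z \<in> borel_measurable M" and C: "is_copula_for M Z C"
  shows "distr (copula_measure C) borel (quantile_vec M Z) = distr M borel Z"
proof (rule finite_measure_eq_if_joint_cdf_eq)
  interpret M: prob_space M by fact
  note \<nu> = copula_measure[of C]
  have C': "is_copula C" using C by (simp add: is_copula_for_def)
  note law = copula_lawD[OF \<nu>(1)[OF C']]
  interpret \<nu>: prob_space "copula_measure C" by (rule law(1))
  have [measurable_cong]: "sets (copula_measure C) = sets borel" by (rule law(2))
  note [measurable] = borel_measurable_quantile_vec[OF M Z]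
  show "finite_measure (distr (copula_measure C) borel (quantile_vec M Z))"
    by (rule \<nu>.finite_measure_distr) measurable
  show "finite_measure (distr M borel Z)" by (rule M.finite_measure_distr) measurable
  fix z :: "real^'d"
  let ?F = "\<lambda>i. cdf (distr M borel (\<lambda>\<omega>. Z \<omega> $ i))"
  have rd: "real_distribution (distr M borel (\<lambda>\<omega>. Z \<omega> $ i))" for i by simp
  have "joint_cdf (distr (copula_measure C) borel (quantile_vec M Z)) z =
      measure (copula_measure C) (quantile_vec M Z -` {..z} \<inter> space (copula_measure C))"
    unfolding joint_cdf_def by (rule measure_distr) measurable
  also have "\<dots> = measure (copula_measure C) {..(\<chi> i. ?F i (z $ i))}"
  proof (rule \<nu>.finite_measure_eq_AE)
    show "AE u in copula_measure C. u \<in> quantile_vec M Z -` {..z} \<inter> space (copula_measure C) \<longleftrightarrow>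
        u \<in> {..(\<chi> i. ?F i (z $ i))}"
      using copula_law_AE_interior[OF \<nu>(1)[OF C']]
      by eventually_elim (simp add: law(3) less_eq_vec_def quantile_vec_def quantile_le_iff[OF rd])
  qed measurable
  also have "\<dots> = joint_cdf (copula_measure C) (\<chi> i. ?F i (z $ i))" by (simp add: joint_cdf_def)
  also have "\<dots> = C (\<chi> i. ?F i (z $ i))"
  proof (rule \<nu>(2)[OF C'])
    show "(\<chi> i. ?F i (z $ i)) \<in> {0..1}"
      using real_distribution.cdf_bounded_prob[OF rd] finite_borel_measure.cdf_nonneg[OF real_distribution.finite_borel_measure_M[OF rd]]
      by (auto simp: less_eq_vec_def)
  qed
  also have "\<dots> = joint_cdf (distr M borel Z) z" using C by (simp add: is_copula_for_def)
  finally show "joint_cdf (distr (copula_measure C) borel (quantile_vec M Z)) z = joint_cdf (distr M borel Z) z" .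
qed simp_all

lemma copula_law_parts:
  fixes \<mu> :: "(real^('m::finite + 'n::finite)) measure"
  assumes "copula_law \<mu>"
  shows "copula_law (distr \<mu> borel left_part)" "copula_law (distr \<mu> borel right_part)"
proof -
  note law = copula_lawD[OF assms]
  interpret prob_space \<mu> by (rule law(1))
  have [measurable_cong]: "sets \<mu> = sets borel" by (rule law(2))
  have "AE u in \<mu>. left_part u \<in> {0..1} \<and> right_part u \<in> {0..1}"
    using law(4) by eventually_elim (auto simp: less_eq_vec_def left_part_def right_part_def)
  then have AE: "AE u in distr \<mu> borel left_part. u \<in> {0..1}" "AE u in distr \<mu> borel right_part. u \<in> {0..1}"
    by (auto simp: AE_distr_iff elim!: eventually_mono)
  have marg: "distr (distr \<mu> borel left_part) borel (\<lambda>x. x $ i) = uniform_measure lborel {0..1}"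
    "distr (distr \<mu> borel right_part) borel (\<lambda>x. x $ j) = uniform_measure lborel {0..1}" for i j
    using law(5)[of "Inl i"] law(5)[of "Inr j"]
    by (simp_all add: distr_distr comp_def left_part_def right_part_def)
  show "copula_law (distr \<mu> borel left_part)" "copula_law (distr \<mu> borel right_part)"
    unfolding copula_law_def using AE marg by (auto intro!: prob_space_distr)
qed

lemma joint_cdf_distr:
  assumes [measurable]: "g \<in> borel_measurable \<mu>"
  shows "joint_cdf (distr \<mu> borel g) z = measure \<mu> {x \<in> space \<mu>. g x \<le> z}"
  unfolding joint_cdf_def by (subst measure_distr) (auto intro!: arg_cong[where f="measure \<mu>"])

lemma joint_cdf_parts:
  fixes \<mu> :: "(real^('m::finite + 'n::finite)) measure"
  assumes \<mu>: "copula_law \<mu>"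
  shows "joint_cdf (distr \<mu> borel left_part) x = joint_cdf \<mu> (join_vec x 1)"
    and "joint_cdf (distr \<mu> borel right_part) y = joint_cdf \<mu> (join_vec 1 y)"
proof -
  note law = copula_lawD[OF \<mu>]
  interpret prob_space \<mu> by (rule law(1))
  have [measurable_cong]: "sets \<mu> = sets borel" by (rule law(2))
  have left: "left_part \<in> borel_measurable \<mu>" and right: "right_part \<in> borel_measurable \<mu>" by measurable
  have AE: "AE u in \<mu>. left_part u \<le> 1 \<and> right_part u \<le> 1"
    using law(4) by eventually_elim (auto simp: less_eq_vec_def left_part_def right_part_def)
  have [measurable]: "Measurable.pred borel (\<lambda>u :: real^'a. u \<le> v)" for v
    using lower_orthant_borel[of v] by (simp add: pred_def atMost_def)
  show "joint_cdf (distr \<mu> borel left_part) x = joint_cdf \<mu> (join_vec x 1)"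
    unfolding joint_cdf_distr[OF left] joint_cdf_def[of \<mu>]
    by (rule finite_measure_eq_AE, use AE in eventually_elim) (auto simp: join_vec_le_iff law(3))
  show "joint_cdf (distr \<mu> borel right_part) y = joint_cdf \<mu> (join_vec 1 y)"
    unfolding joint_cdf_distr[OF right] joint_cdf_def[of \<mu>]
    by (rule finite_measure_eq_AE, use AE in eventually_elim) (auto simp: join_vec_le_iff law(3))
qed

definition tensor_law :: "(real^'m) measure \<Rightarrow> (real^'n) measure \<Rightarrow> (real^('m::finite + 'n::finite)) measure" where
  "tensor_law \<mu> \<nu> = distr (\<mu> \<Otimes>\<^sub>M \<nu>) borel (\<lambda>(x, y). join_vec x y)"

lemma distr_pair_fst_snd:
  assumes "prob_space \<mu>" "prob_space \<nu>"
  shows "distr (\<mu> \<Otimes>\<^sub>M \<nu>) \<mu> fst = \<mu>" "distr (\<mu> \<Otimes>\<^sub>M \<nu>) \<nu> snd = \<nu>"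
proof -
  interpret \<mu>: prob_space \<mu> by fact
  interpret \<nu>: prob_space \<nu> by fact
  interpret pair_sigma_finite \<mu> \<nu> ..
  show "distr (\<mu> \<Otimes>\<^sub>M \<nu>) \<mu> fst = \<mu>" by (rule \<nu>.distr_pair_fst)
  have "distr (\<mu> \<Otimes>\<^sub>M \<nu>) \<nu> snd = distr (distr (\<nu> \<Otimes>\<^sub>M \<mu>) (\<mu> \<Otimes>\<^sub>M \<nu>) (\<lambda>(x, y). (y, x))) \<nu> snd"
    using distr_pair_swap by simp
  also have "\<dots> = distr (\<nu> \<Otimes>\<^sub>M \<mu>) \<nu> fst"
    by (subst distr_distr) (auto intro!: distr_cong)
  also have "\<dots> = \<nu>" by (rule \<mu>.distr_pair_fst)
  finally show "distr (\<mu> \<Otimes>\<^sub>M \<nu>) \<nu> snd = \<nu>" .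
qed

lemma joint_cdf_tensor_law:
  fixes \<mu> :: "(real^'m) measure" and \<nu> :: "(real^'n) measure"
  assumes "prob_space \<mu>" "prob_space \<nu>" and sets: "sets \<mu> = sets borel" "sets \<nu> = sets borel"
  shows "joint_cdf (tensor_law \<mu> \<nu>) z = joint_cdf \<mu> (left_part z) * joint_cdf \<nu> (right_part z)"
proof -
  interpret \<mu>: prob_space \<mu> by fact
  interpret \<nu>: prob_space \<nu> by fact
  interpret pair_prob_space \<mu> \<nu> ..
  note [measurable_cong] = sets
  have "joint_cdf (tensor_law \<mu> \<nu>) z = measure (\<mu> \<Otimes>\<^sub>M \<nu>) {w \<in> space (\<mu> \<Otimes>\<^sub>M \<nu>). (case w of (x, y) \<Rightarrow> join_vec x y) \<le> z}"
    unfolding tensor_law_def by (rule joint_cdf_distr) measurable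
  also have "{w \<in> space (\<mu> \<Otimes>\<^sub>M \<nu>). (case w of (x, y) \<Rightarrow> join_vec x y) \<le> z} = {..left_part z} \<times> {..right_part z}"
  proof -
    have "join_vec x y \<le> z \<longleftrightarrow> x \<le> left_part z \<and> y \<le> right_part z" for x :: "real^'m" and y :: "real^'n"
      using join_vec_le_iff[of "join_vec x y" "left_part z" "right_part z"] by simp
    then show ?thesis using sets[THEN sets_eq_imp_space_eq] by (auto simp: space_pair_measure)
  qed
  also have "measure (\<mu> \<Otimes>\<^sub>M \<nu>) \<dots> = joint_cdf \<mu> (left_part z) * joint_cdf \<nu> (right_part z)"
    by (simp add: joint_cdf_def measure_def \<nu>.emeasure_pair_measure_Times sets enn2real_mult)
  finally show ?thesis .
qed

lemma copula_law_tensor_law: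
  fixes \<mu> :: "(real^'m) measure" and \<nu> :: "(real^'n) measure"
  assumes \<mu>: "copula_law \<mu>" and \<nu>: "copula_law \<nu>"
  shows "copula_law (tensor_law \<mu> \<nu>)"
proof -
  note m = copula_lawD[OF \<mu>] and n = copula_lawD[OF \<nu>]
  interpret \<mu>: prob_space \<mu> by (rule m(1))
  interpret \<nu>: prob_space \<nu> by (rule n(1))
  interpret pair_prob_space \<mu> \<nu> ..
  note [measurable_cong] = m(2) n(2)
  have mf: "distr (\<mu> \<Otimes>\<^sub>M \<nu>) borel fst = \<mu>" and ms: "distr (\<mu> \<Otimes>\<^sub>M \<nu>) borel snd = \<nu>"
    using distr_pair_fst_snd[OF m(1) n(1)] distr_cong[OF refl m(2), of "\<mu> \<Otimes>\<^sub>M \<nu>" fst fst]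
      distr_cong[OF refl n(2), of "\<mu> \<Otimes>\<^sub>M \<nu>" snd snd] by auto
  have "AE w in \<mu> \<Otimes>\<^sub>M \<nu>. fst w \<in> {0..1}"
    by (rule AE_distrD[where M'=borel]) (measurable, simp only: mf m(4))
  moreover have "AE w in \<mu> \<Otimes>\<^sub>M \<nu>. snd w \<in> {0..1}"
    by (rule AE_distrD[where M'=borel]) (measurable, simp only: ms n(4))
  ultimately have "AE w in \<mu> \<Otimes>\<^sub>M \<nu>. (case w of (x, y) \<Rightarrow> join_vec x y) \<in> {0..1}"
    by eventually_elim (simp add: case_prod_beta join_vec_mem_cube del: atLeastAtMost_iff)
  then have AE: "AE z in tensor_law \<mu> \<nu>. z \<in> {0..1}"
    unfolding tensor_law_def by (simp add: AE_distr_iff del: atLeastAtMost_iff)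
  have "distr (tensor_law \<mu> \<nu>) borel (\<lambda>z. z $ k) = uniform_measure lborel {0..1}" for k
  proof (cases k)
    case (Inl i)
    have "distr (tensor_law \<mu> \<nu>) borel (\<lambda>z. z $ k) = distr (distr (\<mu> \<Otimes>\<^sub>M \<nu>) borel fst) borel (\<lambda>x. x $ i)"
      unfolding tensor_law_def Inl by (subst (1 2) distr_distr) (auto intro!: distr_cong)
    then show ?thesis using m(5) mf by simp
  next
    case (Inr j)
    have "distr (tensor_law \<mu> \<nu>) borel (\<lambda>z. z $ k) = distr (distr (\<mu> \<Otimes>\<^sub>M \<nu>) borel snd) borel (\<lambda>x. x $ j)"
      unfolding tensor_law_def Inr by (subst (1 2) distr_distr) (auto intro!: distr_cong)
    then show ?thesis using n(5) ms by simp
  qed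
  then show ?thesis
    unfolding copula_law_def using AE
    by (auto simp: tensor_law_def intro!: P.prob_space_distr)
qed

text \<open>Identifies the first argument of the divergence on the copula side: the product of the laws of the
  two blocks of coordinates.\<close>

lemma copula_measure_tensor_copula:
  fixes C :: "real^('m::finite + 'n::finite) \<Rightarrow> real"
  assumes "is_copula C"
  shows "copula_measure (tensor_copula (left_marginal C) (right_marginal C)) =
    tensor_law (distr (copula_measure C) borel left_part) (distr (copula_measure C) borel right_part)"
proof (rule copula_measure_eqI)
  let ?\<mu> = "copula_measure C"
  note law = copula_measure(1)[OF assms]
  note parts = copula_law_parts[OF law]
  show "copula_law (tensor_law (distr ?\<mu> borel left_part) (distr ?\<mu> borel right_part))"
    by (intro copula_law_tensor_law parts)
  fix u :: "real^('m + 'n)" assume "u \<in> {0..1}"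
  then have "left_part u \<in> {0..1}" "right_part u \<in> {0..1}"
    using join_vec_mem_cube[of "left_part u" "right_part u"] by simp_all
  then have "join_vec (left_part u) 1 \<in> {0..1}" "join_vec 1 (right_part u) \<in> {0..1}"
    by (intro join_vec_mem_cube[THEN iffD2] conjI; simp add: less_eq_vec_def)+
  from this[THEN copula_measure(2)[OF assms]]
  show "tensor_copula (left_marginal C) (right_marginal C) u =
      joint_cdf (tensor_law (distr ?\<mu> borel left_part) (distr ?\<mu> borel right_part)) u"
    by (simp add: tensor_copula_def left_marginal_def right_marginal_def
      joint_cdf_tensor_law[OF copula_lawD(1)[OF parts(1)] copula_lawD(1)[OF parts(2)]] joint_cdf_parts[OF law])
qed

text \<open>Data processing for the map that applies the quantile transforms of \<open>X\<close> and \<open>Y\<close> to the two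
  blocks. That the law of each block is sent to the law of \<open>X\<close> or \<open>Y\<close> follows by
  projecting the identity for the joint law.\<close>

lemma csiszar_index_le_copula_divergence:
  fixes M :: "'w measure" and X :: "'w \<Rightarrow> real^'m" and Y :: "'w \<Rightarrow> real^'n"
  assumes M: "prob_space M" and X[measurable]: "X \<in> borel_measurable M" and Y[measurable]: "Y \<in> borel_measurable M"
    and f: "f \<in> csiszar_class" and C: "is_copula_for M (joint_rv X Y) C"
  shows "csiszar_index f M borel borel X Y
    \<le> copula_divergence f (tensor_copula (left_marginal C) (right_marginal C)) C"
proof -
  interpret M: prob_space M by fact
  have C': "is_copula C" using C by (simp add: is_copula_for_def)
  define \<mu> where "\<mu> = copula_measure C"
  define \<mu>X where "\<mu>X = distr \<mu> borel left_part"
  define \<mu>Y where "\<mu>Y = distr \<mu> borel right_part"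
  have law: "copula_law \<mu>" unfolding \<mu>_def by (rule copula_measure(1)[OF C'])
  have lawX: "copula_law \<mu>X" and lawY: "copula_law \<mu>Y"
    unfolding \<mu>X_def \<mu>Y_def by (rule copula_law_parts[OF law])+
  have lawT: "copula_law (tensor_law \<mu>X \<mu>Y)" by (rule copula_law_tensor_law[OF lawX lawY])
  note [measurable_cong] = copula_lawD(2)[OF law] copula_lawD(2)[OF lawX] copula_lawD(2)[OF lawY] copula_lawD(2)[OF lawT]
  note [measurable] = borel_measurable_quantile_vec[OF M X] borel_measurable_quantile_vec[OF M Y]
  define G where "G z = (quantile_vec M X (left_part z), quantile_vec M Y (right_part z))" for z
  have G[measurable]: "G \<in> borel \<rightarrow>\<^sub>M borel \<Otimes>\<^sub>M borel" unfolding G_def[abs_def] by measurable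
  have Z[measurable]: "joint_rv X Y \<in> borel_measurable M" unfolding joint_rv_def[abs_def] by measurable
  have G_eq: "G z = (left_part (quantile_vec M (joint_rv X Y) z), right_part (quantile_vec M (joint_rv X Y) z))" for z
    by (simp add: G_def quantile_vec_def left_part_def right_part_def joint_rv_def)
  have "distr \<mu> (borel \<Otimes>\<^sub>M borel) G =
      distr (distr \<mu> borel (quantile_vec M (joint_rv X Y))) (borel \<Otimes>\<^sub>M borel) (\<lambda>z. (left_part z, right_part z))"
    using borel_measurable_quantile_vec[OF M Z, measurable]
    by (subst distr_distr) (auto intro!: distr_cong simp: G_eq)
  also have "\<dots> = distr M (borel \<Otimes>\<^sub>M borel) (\<lambda>\<omega>. (X \<omega>, Y \<omega>))"
    unfolding \<mu>_def distr_copula_quantile_vec[OF M Z C]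
    by (subst distr_distr) (auto intro!: distr_cong simp: joint_rv_def)
  finally have distr_G: "distr \<mu> (borel \<Otimes>\<^sub>M borel) G = distr M (borel \<Otimes>\<^sub>M borel) (\<lambda>\<omega>. (X \<omega>, Y \<omega>))" .
  have "distr \<mu>X borel (quantile_vec M X) = distr (distr \<mu> (borel \<Otimes>\<^sub>M borel) G) borel fst"
    unfolding \<mu>X_def by (subst (1 2) distr_distr) (auto intro!: distr_cong simp: G_def)
  also have "\<dots> = distr M borel X"
    unfolding distr_G by (subst distr_distr) (auto intro!: distr_cong)
  finally have X_eq: "distr \<mu>X borel (quantile_vec M X) = distr M borel X" .
  have "distr \<mu>Y borel (quantile_vec M Y) = distr (distr \<mu> (borel \<Otimes>\<^sub>M borel) G) borel snd"
    unfolding \<mu>Y_def by (subst (1 2) distr_distr) (auto intro!: distr_cong simp: G_def)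
  also have "\<dots> = distr M borel Y"
    unfolding distr_G by (subst distr_distr) (auto intro!: distr_cong)
  finally have Y_eq: "distr \<mu>Y borel (quantile_vec M Y) = distr M borel Y" .
  have "distr (tensor_law \<mu>X \<mu>Y) (borel \<Otimes>\<^sub>M borel) G =
      distr (\<mu>X \<Otimes>\<^sub>M \<mu>Y) (borel \<Otimes>\<^sub>M borel) (\<lambda>(x, y). (quantile_vec M X x, quantile_vec M Y y))"
    unfolding tensor_law_def by (subst distr_distr) (auto intro!: distr_cong simp: G_def)
  also have "\<dots> = distr \<mu>X borel (quantile_vec M X) \<Otimes>\<^sub>M distr \<mu>Y borel (quantile_vec M Y)"
  proof (rule pair_measure_distr[symmetric])
    show "sigma_finite_measure (distr \<mu>Y borel (quantile_vec M Y))"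
      unfolding Y_eq by (intro prob_space_imp_sigma_finite M.prob_space_distr Y)
  qed measurable
  finally have distr_T: "distr (tensor_law \<mu>X \<mu>Y) (borel \<Otimes>\<^sub>M borel) G = distr M borel X \<Otimes>\<^sub>M distr M borel Y"
    by (simp add: X_eq Y_eq)
  have "f_divergence f (distr (tensor_law \<mu>X \<mu>Y) (borel \<Otimes>\<^sub>M borel) G) (distr \<mu> (borel \<Otimes>\<^sub>M borel) G)
      \<le> f_divergence f (tensor_law \<mu>X \<mu>Y) \<mu>"
    by (rule f_divergence_distr_le[OF f copula_lawD(1)[OF lawT] copula_lawD(1)[OF law]])
      (simp_all add: copula_lawD(2)[OF law] copula_lawD(2)[OF lawT])
  then show ?thesis
    unfolding csiszar_index_def copula_divergence_def copula_measure_tensor_copula[OF C']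
    by (simp add: distr_T distr_G flip: \<mu>_def \<mu>X_def \<mu>Y_def)
qed

section \<open>Independent randomization and the distributional transform\<close>

lemma nn_integral_pair_mult:
  assumes "sigma_finite_measure N"
    and [measurable]: "f \<in> borel_measurable M" "g \<in> borel_measurable N"
  shows "(\<integral>\<^sup>+p. f (fst p) * g (snd p) \<partial>(M \<Otimes>\<^sub>M N)) = (\<integral>\<^sup>+x. f x \<partial>M) * (\<integral>\<^sup>+y. g y \<partial>N)"
proof -
  interpret sigma_finite_measure N by fact
  show ?thesis
    by (subst nn_integral_fst[symmetric]) (simp_all add: nn_integral_cmult nn_integral_multc)
qed

lemma pair_measure_interchange:
  assumes "prob_space A" "prob_space B" "prob_space C" "prob_space D"
  shows "(A \<Otimes>\<^sub>M C) \<Otimes>\<^sub>M (B \<Otimes>\<^sub>M D) =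
    distr ((A \<Otimes>\<^sub>M B) \<Otimes>\<^sub>M (C \<Otimes>\<^sub>M D)) ((A \<Otimes>\<^sub>M C) \<Otimes>\<^sub>M (B \<Otimes>\<^sub>M D))
      (\<lambda>z. ((fst (fst z), fst (snd z)), (snd (fst z), snd (snd z))))"
proof (rule pair_measure_eqI)
  interpret A: prob_space A by fact
  interpret B: prob_space B by fact
  interpret C: prob_space C by fact
  interpret D: prob_space D by fact
  interpret AC: pair_prob_space A C ..
  interpret BD: pair_prob_space B D ..
  interpret CD: pair_prob_space C D ..
  show "sigma_finite_measure (A \<Otimes>\<^sub>M C)" "sigma_finite_measure (B \<Otimes>\<^sub>M D)" by unfold_locales
  fix E F assume E[measurable]: "E \<in> sets (A \<Otimes>\<^sub>M C)" and F[measurable]: "F \<in> sets (B \<Otimes>\<^sub>M D)"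
  let ?N = "(A \<Otimes>\<^sub>M B) \<Otimes>\<^sub>M (C \<Otimes>\<^sub>M D)"
  define \<alpha> where "\<alpha> a = (\<integral>\<^sup>+c. indicator E (a, c) \<partial>C)" for a
  define \<beta> where "\<beta> b = (\<integral>\<^sup>+d. indicator F (b, d) \<partial>D)" for b
  have [measurable]: "\<alpha> \<in> borel_measurable A" "\<beta> \<in> borel_measurable B"
    unfolding \<alpha>_def[abs_def] \<beta>_def[abs_def] by measurable
  have "emeasure (distr ?N ((A \<Otimes>\<^sub>M C) \<Otimes>\<^sub>M (B \<Otimes>\<^sub>M D)) (\<lambda>z. ((fst (fst z), fst (snd z)), (snd (fst z), snd (snd z))))) (E \<times> F) =
      (\<integral>\<^sup>+z. indicator (E \<times> F) ((\<lambda>z. ((fst (fst z), fst (snd z)), (snd (fst z), snd (snd z)))) z) \<partial>?N)"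
    by (subst nn_integral_indicator[symmetric], simp, subst nn_integral_distr) auto
  also have "\<dots> = (\<integral>\<^sup>+z. indicator E (fst (fst z), fst (snd z)) * indicator F (snd (fst z), snd (snd z)) \<partial>?N)"
    by (intro nn_integral_cong) (auto simp: indicator_def split: prod.splits)
  also have "\<dots> = (\<integral>\<^sup>+p. \<integral>\<^sup>+q. indicator E (fst p, fst q) * indicator F (snd p, snd q) \<partial>(C \<Otimes>\<^sub>M D) \<partial>(A \<Otimes>\<^sub>M B))"
    by (subst CD.P.nn_integral_fst[symmetric]) auto
  also have "\<dots> = (\<integral>\<^sup>+p. \<alpha> (fst p) * \<beta> (snd p) \<partial>(A \<Otimes>\<^sub>M B))"
  proof (rule nn_integral_cong)
    fix p assume "p \<in> space (A \<Otimes>\<^sub>M B)"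
    then have [measurable]: "fst p \<in> space A" "snd p \<in> space B" by (auto simp: space_pair_measure)
    show "(\<integral>\<^sup>+q. indicator E (fst p, fst q) * indicator F (snd p, snd q) \<partial>(C \<Otimes>\<^sub>M D)) = \<alpha> (fst p) * \<beta> (snd p)"
      unfolding \<alpha>_def \<beta>_def
      by (rule nn_integral_pair_mult[OF D.sigma_finite_measure_axioms, of "\<lambda>c. indicator E (fst p, c)" C "\<lambda>d. indicator F (snd p, d)"]) measurable
  qed
  also have "\<dots> = (\<integral>\<^sup>+a. \<alpha> a \<partial>A) * (\<integral>\<^sup>+b. \<beta> b \<partial>B)"
    by (rule nn_integral_pair_mult[OF B.sigma_finite_measure_axioms]) measurable
  also have "(\<integral>\<^sup>+a. \<alpha> a \<partial>A) = emeasure (A \<Otimes>\<^sub>M C) E"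
    unfolding \<alpha>_def by (subst C.nn_integral_fst) auto
  also have "(\<integral>\<^sup>+b. \<beta> b \<partial>B) = emeasure (B \<Otimes>\<^sub>M D) F"
    unfolding \<beta>_def by (subst D.nn_integral_fst) auto
  finally show "emeasure (A \<Otimes>\<^sub>M C) E * emeasure (B \<Otimes>\<^sub>M D) F =
      emeasure (distr ?N ((A \<Otimes>\<^sub>M C) \<Otimes>\<^sub>M (B \<Otimes>\<^sub>M D)) (\<lambda>z. ((fst (fst z), fst (snd z)), (snd (fst z), snd (snd z))))) (E \<times> F)" by simp
qed simp

text \<open>Data processing in the opposite direction: a vector built from \<open>X\<close> and private noise \<open>R\<close>,
  together with one built from \<open>Y\<close> and private noise \<open>S\<close>, is no more dependent than
  \<open>X\<close> and \<open>Y\<close>, provided that \<open>R\<close>, \<open>S\<close> and \<open>(X, Y)\<close> are independent.\<close>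

lemma f_divergence_randomized_le:
  fixes M :: "'w measure" and X :: "'w \<Rightarrow> 'a" and Y :: "'w \<Rightarrow> 'b" and A :: "'a measure" and B :: "'b measure"
    and \<psi> :: "'r \<times> 'a \<Rightarrow> real^'m" and \<theta> :: "'s \<times> 'b \<Rightarrow> real^'n"
  assumes M: "prob_space M" and f: "f \<in> csiszar_class"
    and [measurable]: "X \<in> measurable M A" "Y \<in> measurable M B" "R \<in> measurable M R'" "S \<in> measurable M S'"
    and law: "distr M ((R' \<Otimes>\<^sub>M S') \<Otimes>\<^sub>M (A \<Otimes>\<^sub>M B)) (\<lambda>\<omega>. ((R \<omega>, S \<omega>), (X \<omega>, Y \<omega>))) =
      (distr M R' R \<Otimes>\<^sub>M distr M S' S) \<Otimes>\<^sub>M distr M (A \<Otimes>\<^sub>M B) (\<lambda>\<omega>. (X \<omega>, Y \<omega>))"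
    and [measurable]: "\<psi> \<in> borel_measurable (R' \<Otimes>\<^sub>M A)" "\<theta> \<in> borel_measurable (S' \<Otimes>\<^sub>M B)"
  shows "f_divergence f
      (tensor_law (distr M borel (\<lambda>\<omega>. \<psi> (R \<omega>, X \<omega>))) (distr M borel (\<lambda>\<omega>. \<theta> (S \<omega>, Y \<omega>))))
      (distr M borel (\<lambda>\<omega>. join_vec (\<psi> (R \<omega>, X \<omega>)) (\<theta> (S \<omega>, Y \<omega>))))
    \<le> csiszar_index f M A B X Y"
proof -
  interpret M: prob_space M by fact
  define \<rho> \<sigma> PX PY PXY where defs: "\<rho> = distr M R' R" "\<sigma> = distr M S' S" "PX = distr M A X" "PY = distr M B Y"
    "PXY = distr M (A \<Otimes>\<^sub>M B) (\<lambda>\<omega>. (X \<omega>, Y \<omega>))"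
  have ps: "prob_space \<rho>" "prob_space \<sigma>" "prob_space PX" "prob_space PY" "prob_space PXY"
    unfolding defs by (intro M.prob_space_distr; measurable)+
  have [measurable_cong]: "sets \<rho> = sets R'" "sets \<sigma> = sets S'" "sets PX = sets A" "sets PY = sets B"
    "sets PXY = sets (A \<Otimes>\<^sub>M B)" by (simp_all add: defs)
  let ?P = "(\<rho> \<Otimes>\<^sub>M \<sigma>) \<Otimes>\<^sub>M (PX \<Otimes>\<^sub>M PY)" and ?Q = "(\<rho> \<Otimes>\<^sub>M \<sigma>) \<Otimes>\<^sub>M PXY"
  have law': "?Q = distr M ((R' \<Otimes>\<^sub>M S') \<Otimes>\<^sub>M (A \<Otimes>\<^sub>M B)) (\<lambda>\<omega>. ((R \<omega>, S \<omega>), (X \<omega>, Y \<omega>)))"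
    using law by (simp add: defs)
  define G where "G = (\<lambda>z. join_vec (\<psi> (fst (fst z), fst (snd z))) (\<theta> (snd (fst z), snd (snd z))))"
  have G[measurable]: "G \<in> borel_measurable ((R' \<Otimes>\<^sub>M S') \<Otimes>\<^sub>M (A \<Otimes>\<^sub>M B))"
    unfolding G_def
  proof (rule borel_measurable_join_vec)
    show "(\<lambda>z. \<psi> (fst (fst z), fst (snd z))) \<in> borel_measurable ((R' \<Otimes>\<^sub>M S') \<Otimes>\<^sub>M (A \<Otimes>\<^sub>M B))"
      by (rule measurable_compose[where N="R' \<Otimes>\<^sub>M A"]) measurable
    show "(\<lambda>z. \<theta> (snd (fst z), snd (snd z))) \<in> borel_measurable ((R' \<Otimes>\<^sub>M S') \<Otimes>\<^sub>M (A \<Otimes>\<^sub>M B))"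
      by (rule measurable_compose[where N="S' \<Otimes>\<^sub>M B"]) measurable
  qed
  have Q_eq: "distr ?Q borel G = distr M borel (\<lambda>\<omega>. join_vec (\<psi> (R \<omega>, X \<omega>)) (\<theta> (S \<omega>, Y \<omega>)))"
    unfolding law' by (subst distr_distr) (auto intro!: distr_cong simp: G_def)
  have RX: "distr M (R' \<Otimes>\<^sub>M A) (\<lambda>\<omega>. (R \<omega>, X \<omega>)) = \<rho> \<Otimes>\<^sub>M PX"
  proof -
    have PX: "distr PXY A fst = PX" unfolding defs by (subst distr_distr) (auto intro!: distr_cong)
    have \<rho>: "distr (\<rho> \<Otimes>\<^sub>M \<sigma>) R' fst = \<rho>"
    proof -
      have "distr (\<rho> \<Otimes>\<^sub>M \<sigma>) R' fst = distr (\<rho> \<Otimes>\<^sub>M \<sigma>) \<rho> fst"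
        by (rule distr_cong) (simp_all add: defs)
      then show ?thesis using distr_pair_fst_snd(1)[OF ps(1,2)] by simp
    qed
    have "distr M (R' \<Otimes>\<^sub>M A) (\<lambda>\<omega>. (R \<omega>, X \<omega>)) = distr ?Q (R' \<Otimes>\<^sub>M A) (\<lambda>(p, q). (fst p, fst q))"
      unfolding law' by (subst distr_distr) (auto intro!: distr_cong)
    also have "\<dots> = distr (\<rho> \<Otimes>\<^sub>M \<sigma>) R' fst \<Otimes>\<^sub>M distr PXY A fst"
      by (rule pair_measure_distr[symmetric]) (use PX ps prob_space_imp_sigma_finite in auto)
    finally show ?thesis by (simp add: PX \<rho>)
  qed
  have SY: "distr M (S' \<Otimes>\<^sub>M B) (\<lambda>\<omega>. (S \<omega>, Y \<omega>)) = \<sigma> \<Otimes>\<^sub>M PY"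
  proof -
    have PY: "distr PXY B snd = PY" unfolding defs by (subst distr_distr) (auto intro!: distr_cong)
    have \<sigma>: "distr (\<rho> \<Otimes>\<^sub>M \<sigma>) S' snd = \<sigma>"
    proof -
      have "distr (\<rho> \<Otimes>\<^sub>M \<sigma>) S' snd = distr (\<rho> \<Otimes>\<^sub>M \<sigma>) \<sigma> snd"
        by (rule distr_cong) (simp_all add: defs)
      then show ?thesis using distr_pair_fst_snd(2)[OF ps(1,2)] by simp
    qed
    have "distr M (S' \<Otimes>\<^sub>M B) (\<lambda>\<omega>. (S \<omega>, Y \<omega>)) = distr ?Q (S' \<Otimes>\<^sub>M B) (\<lambda>(p, q). (snd p, snd q))"
      unfolding law' by (subst distr_distr) (auto intro!: distr_cong)
    also have "\<dots> = distr (\<rho> \<Otimes>\<^sub>M \<sigma>) S' snd \<Otimes>\<^sub>M distr PXY B snd"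
      by (rule pair_measure_distr[symmetric]) (use PY ps prob_space_imp_sigma_finite in auto)
    finally show ?thesis by (simp add: PY \<sigma>)
  qed
  let ?U = "distr M borel (\<lambda>\<omega>. \<psi> (R \<omega>, X \<omega>))" and ?V = "distr M borel (\<lambda>\<omega>. \<theta> (S \<omega>, Y \<omega>))"
  have U: "?U = distr (\<rho> \<Otimes>\<^sub>M PX) borel \<psi>"
    unfolding RX[symmetric] by (subst distr_distr) (auto intro!: distr_cong)
  have V: "?V = distr (\<sigma> \<Otimes>\<^sub>M PY) borel \<theta>"
    unfolding SY[symmetric] by (subst distr_distr) (auto intro!: distr_cong)
  have "?U \<Otimes>\<^sub>M ?V = distr ((\<rho> \<Otimes>\<^sub>M PX) \<Otimes>\<^sub>M (\<sigma> \<Otimes>\<^sub>M PY)) (borel \<Otimes>\<^sub>M borel) (\<lambda>(p, q). (\<psi> p, \<theta> q))"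
    unfolding U V
  proof (rule pair_measure_distr)
    show "sigma_finite_measure (distr (\<sigma> \<Otimes>\<^sub>M PY) borel \<theta>)"
      unfolding V[symmetric] by (intro prob_space_imp_sigma_finite M.prob_space_distr) measurable
  qed measurable
  also have "\<dots> = distr ?P (borel \<Otimes>\<^sub>M borel) (\<lambda>z. (\<psi> (fst (fst z), fst (snd z)), \<theta> (snd (fst z), snd (snd z))))"
  proof (subst pair_measure_interchange[OF ps(1,2,3,4)], subst distr_distr)
    show "(\<lambda>(p, q). (\<psi> p, \<theta> q)) \<in> (\<rho> \<Otimes>\<^sub>M PX) \<Otimes>\<^sub>M (\<sigma> \<Otimes>\<^sub>M PY) \<rightarrow>\<^sub>M borel \<Otimes>\<^sub>M borel"
      by measurable
  qed (measurable, simp add: comp_def)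
  finally have UV: "?U \<Otimes>\<^sub>M ?V = \<dots>" .
  have "tensor_law ?U ?V = distr ?P borel G"
  proof -
    have pair: "(\<lambda>z. (\<psi> (fst (fst z), fst (snd z)), \<theta> (snd (fst z), snd (snd z)))) \<in> ?P \<rightarrow>\<^sub>M borel \<Otimes>\<^sub>M borel"
    proof (rule measurable_Pair)
      show "(\<lambda>z. \<psi> (fst (fst z), fst (snd z))) \<in> borel_measurable ?P"
        by (rule measurable_compose[where N="R' \<Otimes>\<^sub>M A"]) measurable
      show "(\<lambda>z. \<theta> (snd (fst z), snd (snd z))) \<in> borel_measurable ?P"
        by (rule measurable_compose[where N="S' \<Otimes>\<^sub>M B"]) measurable
    qed
    have join: "(\<lambda>(x, y). join_vec x y) \<in> borel_measurable (borel \<Otimes>\<^sub>M borel)"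
      unfolding case_prod_beta by (intro borel_measurable_join_vec) measurable
    show ?thesis
      unfolding tensor_law_def UV distr_distr[OF join pair] by (simp add: G_def comp_def)
  qed
  moreover have "f_divergence f (distr ?P borel G) (distr ?Q borel G) \<le> f_divergence f ?P ?Q"
    by (rule f_divergence_distr_le[OF f]) (intro prob_space_pair ps, intro prob_space_pair ps, auto intro!: sets_pair_measure_cong simp: defs)
  moreover have "f_divergence f ?P ?Q = f_divergence f (PX \<Otimes>\<^sub>M PY) PXY"
    by (rule f_divergence_pair_measure[OF f]) (intro prob_space_pair ps, rule ps, simp add: defs cong: sets_pair_measure_cong, intro prob_space_pair ps)
  ultimately show ?thesis by (simp add: csiszar_index_def Q_eq flip: defs)
qed

lemma measure_distr_singleton:
  assumes [measurable]: "Z \<in> borel_measurable M"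
  shows "measure (distr M borel Z) {x :: real} = measure M {\<omega> \<in> space M. Z \<omega> = x}"
  by (subst measure_distr) (auto intro!: arg_cong[where f="measure M"])

text \<open>The sum over the atoms has a nonzero term only at the value taken by \<open>Z\<close>, and off the atoms the
  coefficient vanishes by itself.\<close>

lemma interpolated_nth:
  fixes Z :: "'w \<Rightarrow> real^'d"
  assumes M: "prob_space M" and Z[measurable]: "Z \<in> borel_measurable M"
  shows "interpolated M Z T \<omega> $ i =
    measure (distr M borel (\<lambda>\<omega>. Z \<omega> $ i)) {..<Z \<omega> $ i} +
    measure (distr M borel (\<lambda>\<omega>. Z \<omega> $ i)) {Z \<omega> $ i} * T i (Z \<omega> $ i) \<omega>"
proof -
  interpret prob_space M by fact
  let ?\<mu> = "distr M borel (\<lambda>\<omega>. Z \<omega> $ i)"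
  let ?A = "atoms M (\<lambda>\<omega>. Z \<omega> $ i)"
  interpret \<mu>: real_distribution ?\<mu> by simp
  have m: "measure M {\<omega> \<in> space M. Z \<omega> $ i = x} = measure ?\<mu> {x}" for x
    by (rule measure_distr_singleton[symmetric]) measurable
  have "Lim (at_left (Z \<omega> $ i)) (cdf ?\<mu>) = measure ?\<mu> {..<Z \<omega> $ i}"
    by (rule tendsto_Lim[OF _ \<mu>.cdf_at_left]) simp
  moreover have "(\<Sum>\<^sub>\<infinity>x\<in>?A. measure ?\<mu> {x} * T i x \<omega> * of_bool (Z \<omega> $ i = x)) =
      (\<Sum>\<^sub>\<infinity>x\<in>{Z \<omega> $ i}. measure ?\<mu> {x} * T i x \<omega>)"
  proof (rule infsum_cong_neutral)
    fix x assume "x \<in> {Z \<omega> $ i} - ?A"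
    then show "measure ?\<mu> {x} * T i x \<omega> = 0" by (auto simp: atoms_def m not_less measure_le_0_iff)
  qed auto
  ultimately show ?thesis by (simp add: interpolated_def m)
qed

lemma uniform_01_real_distribution: "real_distribution (uniform_measure lborel {0..1::real})"
  by (intro real_distribution.intro prob_space_uniform_measure real_distribution_axioms.intro) auto

lemma cdf_uniform_01: "cdf (uniform_measure lborel {0..1}) t = max 0 (min 1 t)"
proof -
  have "{0..1} \<inter> {..t} = {0..min 1 t}" by auto
  then show ?thesis by (simp add: cdf_def)
qed

text \<open>For \<open>0 < u < 1\<close> let \<open>q\<close> be the \<open>u\<close>-quantile of \<open>Z\<close>. The event \<open>D\<close> that
  \<open>Z < q\<close>, or \<open>Z = q\<close> with \<open>T q\<close> below the level that fills up the missing mass, has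
  probability \<open>u\<close> and lies, up to null sets, between the events \<open>U < u\<close> and \<open>U \<le> u\<close>. Hence
  \<open>P (U < u) \<le> u \<le> P (U \<le> u)\<close>, which determines the law of \<open>U\<close>. As this law has no
  atoms, \<open>U\<close> almost surely avoids the single value at which the second claim could fail.\<close>

lemma distributional_transform:
  fixes Z :: "'w \<Rightarrow> real"
  assumes M: "prob_space M" and Z[measurable]: "Z \<in> borel_measurable M" and U[measurable]: "U \<in> borel_measurable M"
    and \<mu>_def: "\<mu> = distr M borel Z"
    and U_eq: "\<And>\<omega>. \<omega> \<in> space M \<Longrightarrow> U \<omega> = measure \<mu> {..<Z \<omega>} + measure \<mu> {Z \<omega>} * T (Z \<omega>) \<omega>"
    and T: "\<And>x. measure \<mu> {x} > 0 \<Longrightarrow> uniform_01 M (T x)"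
    and ind: "\<And>x t. measure \<mu> {x} > 0 \<Longrightarrow> 0 \<le> t \<Longrightarrow> t \<le> 1 \<Longrightarrow>
      measure M {\<omega> \<in> space M. Z \<omega> = x \<and> T x \<omega> \<le> t} = measure \<mu> {x} * t"
  shows "distr M borel U = uniform_measure lborel {0..1}"
    and "AE \<omega> in M. U \<omega> \<le> cdf \<mu> z \<longleftrightarrow> Z \<omega> \<le> z"
proof -
  interpret prob_space M by fact
  have rd: "real_distribution \<mu>" unfolding \<mu>_def by simp
  interpret \<mu>: real_distribution \<mu> by (rule rd)
  have T_meas: "T x \<in> borel_measurable M" if "measure \<mu> {x} > 0" for x
    using T[OF that] by (simp add: uniform_01_def)
  have T01: "AE \<omega> in M. 0 < T x \<omega> \<and> T x \<omega> < 1" if "measure \<mu> {x} > 0" for x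
  proof (rule AE_distrD[where M'=borel and f="T x" and P="\<lambda>t. 0 < t \<and> t < 1"])
    have "distr M borel (T x) = uniform_measure lborel {0..1}" using T[OF that] by (simp add: uniform_01_def)
    then show "AE t in distr M borel (T x). 0 < t \<and> t < 1" using uniform_01_AE by metis
  qed (rule T_meas[OF that])
  have "AE \<omega> in M. \<forall>x\<in>{x. measure \<mu> {x} > 0}. 0 < T x \<omega> \<and> T x \<omega> < 1"
    using T01 by (subst AE_ball_countable[OF \<mu>.countable_atoms]) auto
  note T01_all = this
  have split: "cdf \<mu> x = measure \<mu> {..<x} + measure \<mu> {x}" for x
  proof -
    have "{..x} = {..<x} \<union> {x}" by auto
    moreover have "measure \<mu> ({..<x} \<union> {x}) = measure \<mu> {..<x} + measure \<mu> {x}"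
      by (rule \<mu>.finite_measure_Union) auto
    ultimately show ?thesis by (simp only: cdf_def)
  qed
  from T01_all have bounds: "AE \<omega> in M. measure \<mu> {..<Z \<omega>} \<le> U \<omega> \<and> U \<omega> \<le> cdf \<mu> (Z \<omega>)"
    using AE_space
  proof eventually_elim
    case (elim \<omega>)
    show ?case
    proof (cases "measure \<mu> {Z \<omega>} = 0")
      case False
      then have "measure \<mu> {Z \<omega>} > 0" by (simp add: zero_less_measure_iff)
      then have "0 < T (Z \<omega>) \<omega>" "T (Z \<omega>) \<omega> < 1" using elim(1) by auto
      then show ?thesis
        using U_eq[OF elim(2)] by (simp add: split mult_left_le)
    qed (simp add: U_eq[OF elim(2)] split)
  qed
  have cdf_le: "cdf \<mu> x \<le> measure \<mu> {..<y}" if "x < y" for x y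
    unfolding cdf_def using that by (intro \<mu>.finite_measure_mono) auto
  have key: "prob {\<omega> \<in> space M. U \<omega> < u} \<le> u \<and> u \<le> prob {\<omega> \<in> space M. U \<omega> \<le> u}"
    if u: "0 < u" "u < 1" for u
  proof -
    define q where "q = quantile \<mu> u"
    define a where "a = measure \<mu> {..<q}"
    define m where "m = measure \<mu> {q}"
    note q = quantile_le_iff[OF rd u, folded q_def]
    have "u \<le> cdf \<mu> q" using q[of q] by simp
    also have "cdf \<mu> q = a + m" by (simp add: split a_def m_def)
    finally have ua: "u \<le> a + m" .
    have "a \<le> u"
      unfolding a_def
    proof (rule tendsto_upperbound[OF \<mu>.cdf_at_left])
      show "\<forall>\<^sub>F x in at_left q. cdf \<mu> x \<le> u"
        unfolding eventually_at_filter
      proof (intro always_eventually allI impI)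
        fix x assume "x \<in> {..<q}"
        then show "cdf \<mu> x \<le> u" using q[of x] by auto
      qed
    qed simp
    have "0 \<le> m" by (simp add: m_def)
    \<comment> \<open>The fraction of the mass at \<open>q\<close> that lies below level \<open>u\<close>; it is zero by convention if \<open>m = 0\<close>.\<close>
    define t where "t = (u - a) / m"
    have mt: "m * t = u - a" using ua \<open>a \<le> u\<close> by (cases "m = 0") (auto simp: t_def)
    have t: "0 \<le> t" "t \<le> 1" using ua \<open>a \<le> u\<close> \<open>0 \<le> m\<close> by (auto simp: t_def divide_le_eq)
    define B where "B = {\<omega> \<in> space M. m > 0 \<and> Z \<omega> = q \<and> T q \<omega> \<le> t}"
    define D where "D = {\<omega> \<in> space M. Z \<omega> < q} \<union> B"
    have B[measurable]: "B \<in> sets M"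
    proof (cases "m > 0")
      case True
      then have [measurable]: "T q \<in> borel_measurable M" using T_meas by (simp add: m_def)
      show ?thesis unfolding B_def by measurable
    qed (simp add: B_def)
    have "prob B = m * t"
      using ind[of q t] t \<open>0 \<le> m\<close> by (cases "m > 0") (auto simp: B_def m_def not_less measure_le_0_iff)
    moreover have "prob {\<omega> \<in> space M. Z \<omega> < q} = a"
      unfolding a_def \<mu>_def by (subst measure_distr) (auto intro!: arg_cong[where f=prob])
    moreover have "prob D = prob {\<omega> \<in> space M. Z \<omega> < q} + prob B"
      unfolding D_def
    proof (rule finite_measure_Union)
      show "{\<omega> \<in> space M. Z \<omega> < q} \<inter> B = {}" unfolding B_def by blast
    qed measurable
    ultimately have D: "prob D = u" using mt by simp
    have DU: "AE \<omega> in M. \<omega> \<in> D \<longrightarrow> U \<omega> \<le> u" and UD: "AE \<omega> in M. U \<omega> < u \<longrightarrow> \<omega> \<in> D"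
    proof -
      have "AE \<omega> in M. (\<omega> \<in> D \<longrightarrow> U \<omega> \<le> u) \<and> (U \<omega> < u \<longrightarrow> \<omega> \<in> D)"
        using bounds AE_space
      proof eventually_elim
        case (elim \<omega>)
        consider "Z \<omega> < q" | "Z \<omega> = q" | "Z \<omega> > q" by linarith
        then show ?case
        proof cases
          case 1
          then have "cdf \<mu> (Z \<omega>) < u" using q[of "Z \<omega>"] by simp
          then show ?thesis using elim 1 by (auto simp: D_def)
        next
          case 2
          then have Um: "U \<omega> = a + m * T q \<omega>" using U_eq[OF elim(2)] by (simp add: a_def m_def)
          show ?thesis
          proof (cases "m > 0")
            case True
            have "T q \<omega> \<le> t \<longleftrightarrow> m * T q \<omega> \<le> m * t" using True by simp
            then have "T q \<omega> \<le> t \<longleftrightarrow> U \<omega> \<le> u" using mt Um by linarith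
            then show ?thesis using 2 True elim by (auto simp: D_def B_def)
          next
            case False
            then have "m = 0" using \<open>0 \<le> m\<close> by simp
            then show ?thesis using False 2 Um ua by (auto simp: D_def B_def)
          qed
        next
          case 3
          then have "u \<le> measure \<mu> {..<Z \<omega>}" using cdf_le[OF 3] q[of q] by simp
          then show ?thesis using elim 3 by (auto simp: D_def B_def)
        qed
      qed
      then show "AE \<omega> in M. \<omega> \<in> D \<longrightarrow> U \<omega> \<le> u" "AE \<omega> in M. U \<omega> < u \<longrightarrow> \<omega> \<in> D" by auto
    qed
    have "prob {\<omega> \<in> space M. U \<omega> < u} \<le> prob D"
      using UD by (intro finite_measure_mono_AE) (auto simp: D_def)
    moreover have "prob D \<le> prob {\<omega> \<in> space M. U \<omega> \<le> u}"
      using DU AE_space by (intro finite_measure_mono_AE) (auto elim!: eventually_elim2 simp: D_def B_def)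
    ultimately show ?thesis by (simp add: D)
  qed
  have cdfU: "cdf (distr M borel U) x = prob {\<omega> \<in> space M. U \<omega> \<le> x}" for x
    unfolding cdf_def by (subst measure_distr) (auto intro!: arg_cong[where f=prob])
  have upper: "prob {\<omega> \<in> space M. U \<omega> \<le> x} \<le> max 0 x" if "x < 1" for x
  proof (rule dense_ge_bounded[of _ 1])
    show "max 0 x < 1" using that by simp
    fix u assume u: "max 0 x < u" "u < 1"
    have "prob {\<omega> \<in> space M. U \<omega> \<le> x} \<le> prob {\<omega> \<in> space M. U \<omega> < u}"
      using u by (intro finite_measure_mono) auto
    then show "prob {\<omega> \<in> space M. U \<omega> \<le> x} \<le> u" using key[of u] u by auto
  qed
  have lower: "min 1 x \<le> prob {\<omega> \<in> space M. U \<omega> \<le> x}" if "0 < x" for x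
  proof (rule dense_le_bounded[of 0])
    show "0 < min 1 x" using that by simp
    fix u assume u: "0 < u" "u < min 1 x"
    have "prob {\<omega> \<in> space M. U \<omega> \<le> u} \<le> prob {\<omega> \<in> space M. U \<omega> \<le> x}"
      using u by (intro finite_measure_mono) auto
    then show "u \<le> prob {\<omega> \<in> space M. U \<omega> \<le> x}" using key[of u] u by auto
  qed
  show uniform: "distr M borel U = uniform_measure lborel {0..1}"
  proof (rule cdf_unique)
    show "real_distribution (distr M borel U)" by simp
    show "cdf (distr M borel U) = cdf (uniform_measure lborel {0..1})"
    proof
      fix x
      show "cdf (distr M borel U) x = cdf (uniform_measure lborel {0..1}) x"
        unfolding cdfU cdf_uniform_01
        using upper[of x] lower[of x] prob_le_1[of "{\<omega> \<in> space M. U \<omega> \<le> x}"]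
          measure_nonneg[of M "{\<omega> \<in> space M. U \<omega> \<le> x}"]
        by (cases "x \<le> 0"; cases "x < 1") (auto simp: max_def min_def intro: antisym)
    qed
  qed (rule uniform_01_real_distribution)
  have "AE t in uniform_measure lborel {0..1::real}. t \<noteq> cdf \<mu> z"
    using AE_lborel_singleton[of "cdf \<mu> z"] by (intro AE_uniform_measureI) (auto elim!: eventually_mono)
  then have "AE \<omega> in M. U \<omega> \<noteq> cdf \<mu> z"
    unfolding uniform[symmetric] by (subst (asm) AE_distr_iff) auto
  then show "AE \<omega> in M. U \<omega> \<le> cdf \<mu> z \<longleftrightarrow> Z \<omega> \<le> z"
    using bounds
  proof eventually_elim
    case (elim \<omega>)
    show ?case
    proof (cases "Z \<omega> \<le> z")
      case True
      then show ?thesis using elim(2) \<mu>.cdf_nondecreasing[OF True] by simp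
    next
      case False
      then show ?thesis using elim cdf_le[of z "Z \<omega>"] by simp
    qed
  qed
qed

section \<open>Interpolating copulas\<close>

lemma borel_measurable_cdf_parts:
  assumes "real_distribution \<nu>"
  shows "(\<lambda>x. measure \<nu> {..<x}) \<in> borel_measurable borel" "(\<lambda>x. measure \<nu> {x}) \<in> borel_measurable borel"
proof -
  interpret real_distribution \<nu> by fact
  show left[measurable]: "(\<lambda>x. measure \<nu> {..<x}) \<in> borel_measurable borel"
    by (rule borel_measurable_mono) (auto simp: mono_def intro!: finite_measure_mono)
  have [measurable]: "cdf \<nu> \<in> borel_measurable borel"
    by (rule borel_measurable_mono) (auto simp: mono_def cdf_nondecreasing)
  have "measure \<nu> {x} = cdf \<nu> x - measure \<nu> {..<x}" for x
  proof -
    have "{..x} = {..<x} \<union> {x}" by auto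
    moreover have "measure \<nu> ({..<x} \<union> {x}) = measure \<nu> {..<x} + measure \<nu> {x}"
      by (rule finite_measure_Union) auto
    ultimately show ?thesis by (simp only: cdf_def)
  qed
  then show "(\<lambda>x. measure \<nu> {x}) \<in> borel_measurable borel" by simp
qed

text \<open>Interpolation as a function of an abstract source of randomness \<open>r\<close> and of the value of the
  vector; \<open>\<tau> r i x\<close> is the uniform variable used at the atom \<open>x\<close> of coordinate \<open>i\<close>. This
  form covers a separate variable for every atom as well as a common one per coordinate.\<close>

definition randomized_map :: "(real^'d) measure \<Rightarrow> ('r \<Rightarrow> 'd \<Rightarrow> real \<Rightarrow> real) \<Rightarrow> 'r \<times> (real^'d) \<Rightarrow> real^'d" where
  "randomized_map \<mu> \<tau> p = (\<chi> i.
     measure (distr \<mu> borel (\<lambda>x. x $ i)) {..<snd p $ i} +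
     measure (distr \<mu> borel (\<lambda>x. x $ i)) {snd p $ i} * \<tau> (fst p) i (snd p $ i))"

text \<open>The map evaluates \<open>\<tau>\<close> at a random atom. Measurability holds because there are only countably
  many atoms and the coefficient of \<open>\<tau>\<close> vanishes at all other points.\<close>

lemma borel_measurable_randomized_map:
  fixes \<mu> :: "(real^'d) measure" and R :: "'r measure"
  assumes \<mu>: "prob_space \<mu>" "sets \<mu> = sets borel"
    and \<tau>: "\<And>i x. measure (distr \<mu> borel (\<lambda>x. x $ i)) {x} > 0 \<Longrightarrow> (\<lambda>r. \<tau> r i x) \<in> borel_measurable R"
  shows "randomized_map \<mu> \<tau> \<in> borel_measurable (R \<Otimes>\<^sub>M borel)"
  unfolding randomized_map_def[abs_def]
proof (rule borel_measurable_vec_lambda)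
  fix i
  interpret \<mu>: prob_space \<mu> by fact
  note [measurable_cong] = \<mu>(2)
  let ?\<nu> = "distr \<mu> borel (\<lambda>x. x $ i)"
  have rd: "real_distribution ?\<nu>" by (rule \<mu>.real_distribution_distr) measurable
  interpret \<nu>: real_distribution ?\<nu> by (rule rd)
  note [measurable] = borel_measurable_cdf_parts[OF rd]
  define A where "A = {x. measure ?\<nu> {x} > 0}"
  have A: "countable A" unfolding A_def by (rule \<nu>.countable_atoms)
  define I where "I = insert None (Some ` A)"
  have I: "countable I" using A by (simp add: I_def)
  define g where "g p = (if snd p $ i \<in> A then Some (snd p $ i) else None)" for p :: "'r \<times> (real^'d)"
  \<comment> \<open>\<open>g\<close> selects the atom, with \<^const>\<open>None\<close> for the complement of the atoms.\<close>
  define h where "h k p = (case k of None \<Rightarrow> 0 | Some x \<Rightarrow> \<tau> (fst p) i x)" for k and p :: "'r \<times> (real^'d)"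
  have nth: "(\<lambda>p :: 'r \<times> (real^'d). snd p $ i) \<in> borel_measurable (R \<Otimes>\<^sub>M borel)"
    by (intro borel_measurable_vec_nth) measurable
  have g: "g \<in> R \<Otimes>\<^sub>M borel \<rightarrow>\<^sub>M count_space I"
    unfolding measurable_count_space_eq_countable[OF I]
  proof (intro conjI ballI)
    show "g \<in> space (R \<Otimes>\<^sub>M borel) \<rightarrow> I" by (auto simp: g_def I_def)
    fix k assume "k \<in> I"
    then consider "k = None" | x where "k = Some x" "x \<in> A" by (auto simp: I_def)
    then show "g -` {k} \<inter> space (R \<Otimes>\<^sub>M borel) \<in> sets (R \<Otimes>\<^sub>M borel)"
    proof cases
      case 1
      have "g -` {k} \<inter> space (R \<Otimes>\<^sub>M borel) = (\<lambda>p. snd p $ i) -` (- A) \<inter> space (R \<Otimes>\<^sub>M borel)"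
        by (auto simp: g_def 1)
      moreover have "A \<in> sets borel" using A by (rule sets.countable[rotated]) simp
      then have "- A \<in> sets borel" by (rule borel_comp)
      ultimately show ?thesis using measurable_sets[OF nth] by simp
    next
      case 2
      have "g -` {k} \<inter> space (R \<Otimes>\<^sub>M borel) = (\<lambda>p. snd p $ i) -` {x} \<inter> space (R \<Otimes>\<^sub>M borel)"
        using 2 by (auto simp: g_def split: if_splits)
      then show ?thesis using measurable_sets[OF nth, of "{x}"] by simp
    qed
  qed
  have "(\<lambda>p. h (g p) p) \<in> borel_measurable (R \<Otimes>\<^sub>M borel)"
  proof (rule measurable_compose_countable'[OF _ g I])
    fix k assume "k \<in> I"
    then consider "k = None" | x where "k = Some x" "x \<in> A" by (auto simp: I_def)
    then show "h k \<in> borel_measurable (R \<Otimes>\<^sub>M borel)"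
    proof cases
      case 2
      then have "(\<lambda>r. \<tau> r i x) \<in> borel_measurable R" by (intro \<tau>) (simp add: A_def)
      then have "(\<lambda>p :: 'r \<times> (real^'d). \<tau> (fst p) i x) \<in> borel_measurable (R \<Otimes>\<^sub>M borel)"
        by (rule measurable_compose[OF measurable_fst])
      then show ?thesis by (simp add: h_def[abs_def] 2)
    qed (simp add: h_def[abs_def])
  qed
  moreover have "(\<lambda>p. measure ?\<nu> {..<snd p $ i}) \<in> borel_measurable (R \<Otimes>\<^sub>M borel)"
    "(\<lambda>p. measure ?\<nu> {snd p $ i}) \<in> borel_measurable (R \<Otimes>\<^sub>M borel)"
    by (rule measurable_compose[OF nth borel_measurable_cdf_parts(1)[OF rd]],
        rule measurable_compose[OF nth borel_measurable_cdf_parts(2)[OF rd]])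
  ultimately have "(\<lambda>p. measure ?\<nu> {..<snd p $ i} + measure ?\<nu> {snd p $ i} * h (g p) p) \<in> borel_measurable (R \<Otimes>\<^sub>M borel)"
    by (intro borel_measurable_add borel_measurable_times)
  moreover have "measure ?\<nu> {snd p $ i} * h (g p) p = measure ?\<nu> {snd p $ i} * \<tau> (fst p) i (snd p $ i)" for p
    by (cases "snd p $ i \<in> A") (auto simp: g_def h_def A_def not_less measure_le_0_iff)
  ultimately show "(\<lambda>p. measure ?\<nu> {..<snd p $ i} + measure ?\<nu> {snd p $ i} * \<tau> (fst p) i (snd p $ i))
      \<in> borel_measurable (R \<Otimes>\<^sub>M borel)" by simp
qed

lemma mem_atoms_iff:
  assumes [measurable]: "Z \<in> borel_measurable M"
  shows "x \<in> atoms M Z \<longleftrightarrow> measure (distr M borel Z) {x} > 0"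
  by (simp add: atoms_def measure_distr_singleton[OF assms])

lemma distr_nth_distr:
  assumes [measurable]: "Z \<in> borel_measurable M"
  shows "distr (distr M borel Z) borel (\<lambda>x :: real^'d. x $ i) = distr M borel (\<lambda>\<omega>. Z \<omega> $ i)"
  by (subst distr_distr) (auto simp: comp_def)

lemma interpolated_eq_randomized_map:
  fixes Z :: "'w \<Rightarrow> real^'d"
  assumes M: "prob_space M" and Z[measurable]: "Z \<in> borel_measurable M"
    and T: "\<And>i x. x \<in> atoms M (\<lambda>\<omega>. Z \<omega> $ i) \<Longrightarrow> T i x \<omega> = \<tau> r i x"
  shows "interpolated M Z T \<omega> = randomized_map (distr M borel Z) \<tau> (r, Z \<omega>)"
proof (rule vec_eq_iff[THEN iffD2], intro allI)
  fix i
  let ?\<nu> = "distr M borel (\<lambda>\<omega>. Z \<omega> $ i)"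
  have "measure ?\<nu> {Z \<omega> $ i} * T i (Z \<omega> $ i) \<omega> = measure ?\<nu> {Z \<omega> $ i} * \<tau> r i (Z \<omega> $ i)"
    using T[of "Z \<omega> $ i" i] by (cases "measure ?\<nu> {Z \<omega> $ i} = 0") (auto simp: mem_atoms_iff zero_less_measure_iff)
  then show "interpolated M Z T \<omega> $ i = randomized_map (distr M borel Z) \<tau> (r, Z \<omega>) $ i"
    by (simp add: interpolated_nth[OF M Z] randomized_map_def distr_nth_distr)
qed

text \<open>Each coordinate is a distributional transform of its own, so the hypotheses concern one atom of one
  coordinate at a time. The joint law then follows from the coordinatewise equivalence of
  \<open>U $ i \<le> F\<^sub>i z\<close> and \<open>Z $ i \<le> z\<close>.\<close>

lemma interpolated_copula:
  fixes Z :: "'w \<Rightarrow> real^'d"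
  assumes M: "prob_space M" and Z[measurable]: "Z \<in> borel_measurable M"
    and U[measurable]: "interpolated M Z T \<in> borel_measurable M"
    and T: "\<And>i x. x \<in> atoms M (\<lambda>\<omega>. Z \<omega> $ i) \<Longrightarrow> uniform_01 M (T i x)"
    and ind: "\<And>i x t. x \<in> atoms M (\<lambda>\<omega>. Z \<omega> $ i) \<Longrightarrow> 0 \<le> t \<Longrightarrow> t \<le> 1 \<Longrightarrow>
      measure M {\<omega> \<in> space M. Z \<omega> $ i = x \<and> T i x \<omega> \<le> t} = measure M {\<omega> \<in> space M. Z \<omega> $ i = x} * t"
  shows "copula_law (distr M borel (interpolated M Z T))"
    and "is_copula_for M Z (joint_cdf (distr M borel (interpolated M Z T)))"
proof -
  interpret prob_space M by fact
  let ?U = "interpolated M Z T"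
  let ?\<nu> = "\<lambda>i. distr M borel (\<lambda>\<omega>. Z \<omega> $ i)"
  have transform: "distr M borel (\<lambda>\<omega>. ?U \<omega> $ i) = uniform_measure lborel {0..1}"
    "AE \<omega> in M. ?U \<omega> $ i \<le> cdf (?\<nu> i) z \<longleftrightarrow> Z \<omega> $ i \<le> z" for i z
  proof -
    have pos: "x \<in> atoms M (\<lambda>\<omega>. Z \<omega> $ i)" if "measure (?\<nu> i) {x} > 0" for x
      using that by (simp add: mem_atoms_iff)
    have ind': "measure M {\<omega> \<in> space M. Z \<omega> $ i = x \<and> T i x \<omega> \<le> t} = measure (?\<nu> i) {x} * t"
      if "measure (?\<nu> i) {x} > 0" "0 \<le> t" "t \<le> 1" for x t
      using ind[OF pos[OF that(1)] that(2,3)] by (simp add: measure_distr_singleton)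
    note tr = distributional_transform[where Z="\<lambda>\<omega>. Z \<omega> $ i" and U="\<lambda>\<omega>. ?U \<omega> $ i" and T="T i", OF M _ _ refl]
    show "distr M borel (\<lambda>\<omega>. ?U \<omega> $ i) = uniform_measure lborel {0..1}"
      by (rule tr(1)) (auto intro: T pos ind' interpolated_nth[OF M Z])
    show "AE \<omega> in M. ?U \<omega> $ i \<le> cdf (?\<nu> i) z \<longleftrightarrow> Z \<omega> $ i \<le> z"
      by (rule tr(2)) (auto intro: T pos ind' interpolated_nth[OF M Z])
  qed
  have U01: "AE \<omega> in M. \<forall>i. 0 < ?U \<omega> $ i \<and> ?U \<omega> $ i < 1"
  proof (rule AE_all_countable[THEN iffD2, rule_format])
    fix i
    have "AE t in distr M borel (\<lambda>\<omega>. ?U \<omega> $ i). 0 < t \<and> t < 1"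
      unfolding transform(1) by (rule uniform_01_AE)
    then show "AE \<omega> in M. 0 < ?U \<omega> $ i \<and> ?U \<omega> $ i < 1"
      by (rule AE_distrD[rotated]) measurable
  qed
  have "AE \<omega> in M. ?U \<omega> \<in> {0..1}"
    using U01 by eventually_elim (auto simp: less_eq_vec_def less_imp_le)
  then have "AE u in distr M borel ?U. u \<in> {0..1}"
    by (subst AE_distr_iff) (auto simp: less_eq_vec_def)
  then show law: "copula_law (distr M borel ?U)"
    unfolding copula_law_def using transform(1) by (auto simp: distr_nth_distr intro!: prob_space_distr)
  show "is_copula_for M Z (joint_cdf (distr M borel ?U))"
    unfolding is_copula_for_def
  proof (intro conjI allI)
    show "is_copula (joint_cdf (distr M borel ?U))" by (rule is_copulaI[OF law refl])
    fix z
    have [measurable]: "Measurable.pred borel (\<lambda>u :: real^'d. u \<le> v)" for v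
      using lower_orthant_borel[of v] by (simp add: pred_def atMost_def)
    have "AE \<omega> in M. \<forall>i. ?U \<omega> $ i \<le> cdf (?\<nu> i) (z $ i) \<longleftrightarrow> Z \<omega> $ i \<le> z $ i"
      using transform(2) by (rule AE_all_countable[THEN iffD2, rule_format])
    then have "AE \<omega> in M. Z \<omega> \<le> z \<longleftrightarrow> ?U \<omega> \<le> (\<chi> i. cdf (?\<nu> i) (z $ i))"
      by eventually_elim (simp add: less_eq_vec_def)
    then show "joint_cdf (distr M borel Z) z = joint_cdf (distr M borel ?U) (\<chi> i. cdf (?\<nu> i) (z $ i))"
      unfolding joint_cdf_distr[OF Z] joint_cdf_distr[OF U]
      by (intro finite_measure_eq_AE) auto
  qed
qed

lemma joint_rv_interpolated:
  "joint_rv (interpolated M X T) (interpolated M Y W) = interpolated M (joint_rv X Y) (case_sum T W)"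
proof
  fix \<omega>
  have "joint_rv (interpolated M X T) (interpolated M Y W) \<omega> $ k = interpolated M (joint_rv X Y) (case_sum T W) \<omega> $ k" for k
    by (cases k) (simp_all add: interpolated_def joint_rv_def)
  then show "joint_rv (interpolated M X T) (interpolated M Y W) \<omega> = interpolated M (joint_rv X Y) (case_sum T W) \<omega>"
    by (simp add: vec_eq_iff)
qed

text \<open>The common core of the results on interpolating and on checkerboard copulas, for sources of
  randomness \<open>R\<close> and \<open>S\<close> such that \<open>R\<close>, \<open>S\<close> and \<open>(X, Y)\<close> are independent.\<close>

lemma interpolated_copula_divergence:
  fixes M :: "'w measure" and X :: "'w \<Rightarrow> real^'m" and Y :: "'w \<Rightarrow> real^'n"
    and R :: "'w \<Rightarrow> 'r" and S :: "'w \<Rightarrow> 's" and T :: "'m \<Rightarrow> real \<Rightarrow> 'w \<Rightarrow> real" and W :: "'n \<Rightarrow> real \<Rightarrow> 'w \<Rightarrow> real"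
  assumes M: "prob_space M" and X[measurable]: "X \<in> borel_measurable M" and Y[measurable]: "Y \<in> borel_measurable M"
    and f: "f \<in> csiszar_class"
    and R[measurable]: "R \<in> measurable M R'" and S[measurable]: "S \<in> measurable M S'"
    and law: "distr M ((R' \<Otimes>\<^sub>M S') \<Otimes>\<^sub>M (borel \<Otimes>\<^sub>M borel)) (\<lambda>\<omega>. ((R \<omega>, S \<omega>), (X \<omega>, Y \<omega>))) =
      (distr M R' R \<Otimes>\<^sub>M distr M S' S) \<Otimes>\<^sub>M distr M (borel \<Otimes>\<^sub>M borel) (\<lambda>\<omega>. (X \<omega>, Y \<omega>))"
    and T: "\<And>i x. x \<in> atoms M (\<lambda>\<omega>. X \<omega> $ i) \<Longrightarrow> uniform_01 M (T i x)"
    and W: "\<And>j y. y \<in> atoms M (\<lambda>\<omega>. Y \<omega> $ j) \<Longrightarrow> uniform_01 M (W j y)"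
    and \<tau>: "\<And>i x. x \<in> atoms M (\<lambda>\<omega>. X \<omega> $ i) \<Longrightarrow> (\<lambda>r. \<tau> r i x) \<in> borel_measurable R'"
      "\<And>i x \<omega>. x \<in> atoms M (\<lambda>\<omega>. X \<omega> $ i) \<Longrightarrow> T i x \<omega> = \<tau> (R \<omega>) i x"
    and \<upsilon>: "\<And>j y. y \<in> atoms M (\<lambda>\<omega>. Y \<omega> $ j) \<Longrightarrow> (\<lambda>s. \<upsilon> s j y) \<in> borel_measurable S'"
      "\<And>j y \<omega>. y \<in> atoms M (\<lambda>\<omega>. Y \<omega> $ j) \<Longrightarrow> W j y \<omega> = \<upsilon> (S \<omega>) j y"
  defines "\<Lambda> \<equiv> distr M borel (joint_rv (interpolated M X T) (interpolated M Y W))"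
  shows "copula_law \<Lambda>"
    and "is_copula_for M (joint_rv X Y) (joint_cdf \<Lambda>)"
    and "csiszar_index f M borel borel X Y =
      copula_divergence f (tensor_copula (left_marginal (joint_cdf \<Lambda>)) (right_marginal (joint_cdf \<Lambda>))) (joint_cdf \<Lambda>)"
    and "joint_rv (interpolated M X T) (interpolated M Y W) \<in> borel_measurable M"
proof -
  interpret prob_space M by fact
  have Z[measurable]: "joint_rv X Y \<in> borel_measurable M" unfolding joint_rv_def[abs_def] by measurable
  define \<psi> where "\<psi> = randomized_map (distr M borel X) \<tau>"
  define \<theta> where "\<theta> = randomized_map (distr M borel Y) \<upsilon>"
  have \<psi>[measurable]: "\<psi> \<in> borel_measurable (R' \<Otimes>\<^sub>M borel)"
    unfolding \<psi>_def
  proof (rule borel_measurable_randomized_map)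
    show "(\<lambda>r. \<tau> r i x) \<in> borel_measurable R'" if "measure (distr (distr M borel X) borel (\<lambda>x. x $ i)) {x} > 0" for i x
      using that by (intro \<tau>(1)) (simp add: mem_atoms_iff distr_nth_distr)
  qed (auto intro: prob_space_distr)
  have \<theta>[measurable]: "\<theta> \<in> borel_measurable (S' \<Otimes>\<^sub>M borel)"
    unfolding \<theta>_def
  proof (rule borel_measurable_randomized_map)
    show "(\<lambda>r. \<upsilon> r i x) \<in> borel_measurable S'" if "measure (distr (distr M borel Y) borel (\<lambda>x. x $ i)) {x} > 0" for i x
      using that by (intro \<upsilon>(1)) (simp add: mem_atoms_iff distr_nth_distr)
  qed (auto intro: prob_space_distr)
  have IX: "interpolated M X T = (\<lambda>\<omega>. \<psi> (R \<omega>, X \<omega>))"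
    unfolding \<psi>_def by (intro ext interpolated_eq_randomized_map M X \<tau>(2))
  have IY: "interpolated M Y W = (\<lambda>\<omega>. \<theta> (S \<omega>, Y \<omega>))"
    unfolding \<theta>_def by (intro ext interpolated_eq_randomized_map M Y \<upsilon>(2))
  have IXm[measurable]: "interpolated M X T \<in> borel_measurable M"
    unfolding IX by (rule measurable_compose[where N="R' \<Otimes>\<^sub>M borel"]) measurable
  have IYm[measurable]: "interpolated M Y W \<in> borel_measurable M"
    unfolding IY by (rule measurable_compose[where N="S' \<Otimes>\<^sub>M borel"]) measurable
  have IZ[measurable]: "interpolated M (joint_rv X Y) (case_sum T W) \<in> borel_measurable M"
    unfolding joint_rv_interpolated[symmetric] by (simp add: joint_rv_def[abs_def])
  have product: "prob {\<omega> \<in> space M. (X \<omega>, Y \<omega>) \<in> F \<and> (R \<omega>, S \<omega>) \<in> E} =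
      prob {\<omega> \<in> space M. (X \<omega>, Y \<omega>) \<in> F} * prob {\<omega> \<in> space M. (R \<omega>, S \<omega>) \<in> E}"
    if [measurable]: "E \<in> sets (R' \<Otimes>\<^sub>M S')" "F \<in> sets (borel \<Otimes>\<^sub>M borel)" for E F
  proof -
    let ?RS = "distr M R' R \<Otimes>\<^sub>M distr M S' S" and ?XY = "distr M (borel \<Otimes>\<^sub>M borel) (\<lambda>\<omega>. (X \<omega>, Y \<omega>))"
    let ?J = "distr M ((R' \<Otimes>\<^sub>M S') \<Otimes>\<^sub>M (borel \<Otimes>\<^sub>M borel)) (\<lambda>\<omega>. ((R \<omega>, S \<omega>), (X \<omega>, Y \<omega>)))"
    interpret XY: prob_space ?XY by (rule prob_space_distr) measurable
    interpret RS: prob_space ?RS by (intro prob_space_pair prob_space_distr R S)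
    have rect: "measure ?J (E' \<times> F') = measure ?RS E' * measure ?XY F'"
      if "E' \<in> sets (R' \<Otimes>\<^sub>M S')" "F' \<in> sets (borel \<Otimes>\<^sub>M borel)" for E' F'
    proof -
      have "E' \<in> sets ?RS" using that(1) by (simp cong: sets_pair_measure_cong)
      then show ?thesis
        unfolding law using that(2) by (simp add: measure_def XY.emeasure_pair_measure_Times enn2real_mult)
    qed
    have J: "measure ?J (E' \<times> F') = prob {\<omega> \<in> space M. (X \<omega>, Y \<omega>) \<in> F' \<and> (R \<omega>, S \<omega>) \<in> E'}"
      if [measurable]: "E' \<in> sets (R' \<Otimes>\<^sub>M S')" "F' \<in> sets (borel \<Otimes>\<^sub>M borel)" for E' F'
      by (subst measure_distr) (auto intro!: arg_cong[where f=prob])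
    have XY: "measure ?XY F = prob {\<omega> \<in> space M. (X \<omega>, Y \<omega>) \<in> F}"
      by (subst measure_distr) (auto intro!: arg_cong[where f=prob])
    have UNIV: "UNIV \<in> sets ((borel :: (real^'m) measure) \<Otimes>\<^sub>M (borel :: (real^'n) measure))"
      using sets.top[of "(borel :: (real^'m) measure) \<Otimes>\<^sub>M (borel :: (real^'n) measure)"]
      by (simp add: space_pair_measure)
    have "prob {\<omega> \<in> space M. (R \<omega>, S \<omega>) \<in> E} = measure ?J (E \<times> UNIV)"
      by (subst J[OF _ UNIV]) auto
    also have "\<dots> = measure ?RS E"
      using rect[OF _ UNIV, of E] XY.prob_space by (simp add: space_pair_measure)
    finally show ?thesis using rect[of E F] J[of E F] XY by simp
  qed
  have unif: "uniform_01 M (case_sum T W k x)" if "x \<in> atoms M (\<lambda>\<omega>. joint_rv X Y \<omega> $ k)" for k x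
    using that T W by (cases k) (auto simp: joint_rv_def)
  have ind: "prob {\<omega> \<in> space M. joint_rv X Y \<omega> $ k = x \<and> case_sum T W k x \<omega> \<le> t} =
      prob {\<omega> \<in> space M. joint_rv X Y \<omega> $ k = x} * t"
    if x: "x \<in> atoms M (\<lambda>\<omega>. joint_rv X Y \<omega> $ k)" and t: "0 \<le> t" "t \<le> 1" for k x t
  proof -
    have "prob {\<omega> \<in> space M. case_sum T W k x \<omega> \<le> t} = measure (distr M borel (case_sum T W k x)) {..t}"
      using unif[OF x] by (subst measure_distr) (auto simp: uniform_01_def intro!: arg_cong[where f=prob])
    also have "\<dots> = t" using unif[OF x] cdf_uniform_01[of t] t by (simp add: uniform_01_def cdf_def)
    finally have Pt: "prob {\<omega> \<in> space M. case_sum T W k x \<omega> \<le> t} = t" .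
    show ?thesis
    proof (cases k)
      case (Inl i)
      then have xi: "x \<in> atoms M (\<lambda>\<omega>. X \<omega> $ i)" using x by (simp add: joint_rv_def)
      note [measurable] = \<tau>(1)[OF xi]
      have "{p \<in> space (R' \<Otimes>\<^sub>M S'). \<tau> (fst p) i x \<le> t} \<in> sets (R' \<Otimes>\<^sub>M S')"
        "{p \<in> space (borel \<Otimes>\<^sub>M borel). fst p $ i = x} \<in> sets (borel \<Otimes>\<^sub>M (borel :: (real^'n) measure))"
        by measurable
      from product[OF this] show ?thesis
        using Pt measurable_space[OF R] measurable_space[OF S]
        by (simp add: Inl joint_rv_def \<tau>(2)[OF xi] space_pair_measure cong: conj_cong)
    next
      case (Inr j)
      then have xj: "x \<in> atoms M (\<lambda>\<omega>. Y \<omega> $ j)" using x by (simp add: joint_rv_def)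
      note [measurable] = \<upsilon>(1)[OF xj]
      have "{p \<in> space (R' \<Otimes>\<^sub>M S'). \<upsilon> (snd p) j x \<le> t} \<in> sets (R' \<Otimes>\<^sub>M S')"
        "{p \<in> space (borel \<Otimes>\<^sub>M borel). snd p $ j = x} \<in> sets ((borel :: (real^'m) measure) \<Otimes>\<^sub>M borel)"
        by measurable
      from product[OF this] show ?thesis
        using Pt measurable_space[OF R] measurable_space[OF S]
        by (simp add: Inr joint_rv_def \<upsilon>(2)[OF xj] space_pair_measure cong: conj_cong)
    qed
  qed
  note copula = interpolated_copula[OF M Z IZ unif ind]
  show law': "copula_law \<Lambda>" and cop: "is_copula_for M (joint_rv X Y) (joint_cdf \<Lambda>)"
    using copula unfolding \<Lambda>_def joint_rv_interpolated by simp_all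
  have C: "is_copula (joint_cdf \<Lambda>)" using cop by (simp add: is_copula_for_def)
  have meas: "copula_measure (joint_cdf \<Lambda>) = \<Lambda>" by (rule copula_measure_eqI[OF law' refl])
  show joint[measurable]: "joint_rv (interpolated M X T) (interpolated M Y W) \<in> borel_measurable M"
    unfolding joint_rv_interpolated by (rule IZ)
  have left: "distr \<Lambda> borel left_part = distr M borel (interpolated M X T)"
    unfolding \<Lambda>_def distr_distr[OF borel_measurable_left_part joint] by (simp add: comp_def joint_rv_def)
  have right: "distr \<Lambda> borel right_part = distr M borel (interpolated M Y W)"
    unfolding \<Lambda>_def distr_distr[OF borel_measurable_right_part joint] by (simp add: comp_def joint_rv_def)
  have "f_divergence f (tensor_law (distr M borel (interpolated M X T)) (distr M borel (interpolated M Y W))) \<Lambda>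
      \<le> csiszar_index f M borel borel X Y"
    unfolding \<Lambda>_def joint_rv_def[abs_def] IX IY
    by (rule f_divergence_randomized_le[OF M f X Y R S law \<psi> \<theta>])
  then have "copula_divergence f (tensor_copula (left_marginal (joint_cdf \<Lambda>)) (right_marginal (joint_cdf \<Lambda>))) (joint_cdf \<Lambda>)
      \<le> csiszar_index f M borel borel X Y"
    unfolding copula_divergence_def copula_measure_tensor_copula[OF C] meas left right .
  moreover have "csiszar_index f M borel borel X Y \<le>
      copula_divergence f (tensor_copula (left_marginal (joint_cdf \<Lambda>)) (right_marginal (joint_cdf \<Lambda>))) (joint_cdf \<Lambda>)"
    by (rule csiszar_index_le_copula_divergence[OF M X Y f cop])
  ultimately show "csiszar_index f M borel borel X Y =
      copula_divergence f (tensor_copula (left_marginal (joint_cdf \<Lambda>)) (right_marginal (joint_cdf \<Lambda>))) (joint_cdf \<Lambda>)"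
    by (rule antisym[rotated])
qed

lemma indep_rvs_distr:
  assumes M: "prob_space M" and ind: "indep_rvs M S A T B"
  shows "distr M (S \<Otimes>\<^sub>M T) (\<lambda>\<omega>. (A \<omega>, B \<omega>)) = distr M S A \<Otimes>\<^sub>M distr M T B"
proof (rule pair_measure_eqI[symmetric])
  interpret prob_space M by fact
  have [measurable]: "A \<in> measurable M S" "B \<in> measurable M T" using ind by (auto simp: indep_rvs_def)
  show "sigma_finite_measure (distr M S A)" "sigma_finite_measure (distr M T B)"
    by (intro prob_space_imp_sigma_finite prob_space_distr; measurable)+
  show "sets (distr M S A \<Otimes>\<^sub>M distr M T B) = sets (distr M (S \<Otimes>\<^sub>M T) (\<lambda>\<omega>. (A \<omega>, B \<omega>)))"
    by (simp cong: sets_pair_measure_cong)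
  fix E F assume "E \<in> sets (distr M S A)" "F \<in> sets (distr M T B)"
  then have [measurable]: "E \<in> sets S" "F \<in> sets T" by auto
  have "prob ((A -` E \<inter> space M) \<inter> (B -` F \<inter> space M)) = prob (A -` E \<inter> space M) * prob (B -` F \<inter> space M)"
    by (rule indep_setD) (use ind \<open>E \<in> sets S\<close> \<open>F \<in> sets T\<close> in \<open>auto simp: indep_rvs_def\<close>)
  moreover have "(\<lambda>\<omega>. (A \<omega>, B \<omega>)) -` (E \<times> F) \<inter> space M = (A -` E \<inter> space M) \<inter> (B -` F \<inter> space M)" by auto
  ultimately show "emeasure (distr M S A) E * emeasure (distr M T B) F =
      emeasure (distr M (S \<Otimes>\<^sub>M T) (\<lambda>\<omega>. (A \<omega>, B \<omega>))) (E \<times> F)"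
    by (simp add: emeasure_distr emeasure_eq_measure ennreal_mult)
qed

section \<open>Checkerboard copulas and the minimum\<close>

abbreviation unit_uniform :: "real measure" where
  "unit_uniform \<equiv> uniform_measure lborel {0..1}"

abbreviation uniform_product :: "('i \<Rightarrow> real) measure" where
  "uniform_product \<equiv> PiM UNIV (\<lambda>_. unit_uniform)"

lemma prob_space_unit_uniform: "prob_space unit_uniform"
  by (rule prob_space_uniform_measure) auto

lemma prob_space_uniform_product: "prob_space (uniform_product :: ('i \<Rightarrow> real) measure)"
  by (intro prob_space_PiM prob_space_unit_uniform)

text \<open>The map that splits a family indexed by a sum type is inverse to a gluing map, and the image of a
  product law under gluing is identified on boxes.\<close>

lemma distr_uniform_product_parts:
  defines "\<Omega> \<equiv> (uniform_product :: ('m::finite + 'n::finite \<Rightarrow> real) measure)"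
  defines "split \<equiv> (\<lambda>t :: 'm + 'n \<Rightarrow> real. (\<lambda>i. t (Inl i), \<lambda>j. t (Inr j)))"
  shows "split \<in> \<Omega> \<rightarrow>\<^sub>M uniform_product \<Otimes>\<^sub>M uniform_product"
    and "distr \<Omega> (uniform_product \<Otimes>\<^sub>M uniform_product) split = uniform_product \<Otimes>\<^sub>M uniform_product"
proof -
  let ?m = "uniform_product :: ('m \<Rightarrow> real) measure" and ?n = "uniform_product :: ('n \<Rightarrow> real) measure"
  interpret sf: product_sigma_finite "\<lambda>_ :: 'm + 'n. unit_uniform"
    by (simp add: product_sigma_finite_def prob_space_imp_sigma_finite prob_space_unit_uniform)
  interpret sm: product_sigma_finite "\<lambda>_ :: 'm. unit_uniform"
    by (simp add: product_sigma_finite_def prob_space_imp_sigma_finite prob_space_unit_uniform)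
  interpret sn: product_sigma_finite "\<lambda>_ :: 'n. unit_uniform"
    by (simp add: product_sigma_finite_def prob_space_imp_sigma_finite prob_space_unit_uniform)
  interpret m: prob_space ?m by (rule prob_space_uniform_product)
  interpret n: prob_space ?n by (rule prob_space_uniform_product)
  have left: "(\<lambda>t i. t (Inl i)) \<in> \<Omega> \<rightarrow>\<^sub>M ?m" and right: "(\<lambda>t j. t (Inr j)) \<in> \<Omega> \<rightarrow>\<^sub>M ?n"
    unfolding \<Omega>_def by (rule measurable_PiM_single'; auto simp: space_PiM)+
  then show split: "split \<in> \<Omega> \<rightarrow>\<^sub>M ?m \<Otimes>\<^sub>M ?n"
    unfolding split_def by (rule measurable_Pair)
  define glue where "glue p = case_sum (fst p) (snd p)" for p :: "('m \<Rightarrow> real) \<times> ('n \<Rightarrow> real)"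
  have glue: "glue \<in> ?m \<Otimes>\<^sub>M ?n \<rightarrow>\<^sub>M \<Omega>"
    unfolding \<Omega>_def
  proof (rule measurable_PiM_single')
    fix k :: "'m + 'n"
    show "(\<lambda>p. glue p k) \<in> ?m \<Otimes>\<^sub>M ?n \<rightarrow>\<^sub>M unit_uniform"
    proof (cases k)
      case (Inl i)
      have "(\<lambda>p. fst p i) \<in> ?m \<Otimes>\<^sub>M ?n \<rightarrow>\<^sub>M unit_uniform"
        by (rule measurable_compose[OF measurable_fst measurable_component_singleton]) simp
      then show ?thesis by (simp add: glue_def Inl)
    next
      case (Inr j)
      have "(\<lambda>p. snd p j) \<in> ?m \<Otimes>\<^sub>M ?n \<rightarrow>\<^sub>M unit_uniform"
        by (rule measurable_compose[OF measurable_snd measurable_component_singleton]) simp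
      then show ?thesis by (simp add: glue_def Inr)
    qed
  qed (auto simp: space_PiM)
  have "distr (?m \<Otimes>\<^sub>M ?n) \<Omega> glue = \<Omega>"
    unfolding \<Omega>_def
  proof (rule sf.PiM_eqI)
    fix A :: "'m + 'n \<Rightarrow> real set" assume A: "\<And>k. k \<in> UNIV \<Longrightarrow> A k \<in> sets unit_uniform"
    have "emeasure (distr (?m \<Otimes>\<^sub>M ?n) \<Omega> glue) (Pi\<^sub>E UNIV A) =
        emeasure (?m \<Otimes>\<^sub>M ?n) (glue -` Pi\<^sub>E UNIV A \<inter> space (?m \<Otimes>\<^sub>M ?n))"
      by (rule emeasure_distr[OF glue]) (use A in \<open>simp add: \<Omega>_def sets_PiM_I_finite\<close>)
    also have "glue -` Pi\<^sub>E UNIV A \<inter> space (?m \<Otimes>\<^sub>M ?n) =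
        Pi\<^sub>E UNIV (\<lambda>i. A (Inl i)) \<times> Pi\<^sub>E UNIV (\<lambda>j. A (Inr j))"
    proof -
      have "(\<forall>k. glue (r, s) k \<in> A k) \<longleftrightarrow> (\<forall>i. r i \<in> A (Inl i)) \<and> (\<forall>j. s j \<in> A (Inr j))" for r s
        by (simp add: glue_def) (metis sum.case sum.exhaust)
      then show ?thesis by (auto simp: space_pair_measure space_PiM PiE_UNIV_domain Pi_iff)
    qed
    also have "emeasure (?m \<Otimes>\<^sub>M ?n) \<dots> =
        (\<Prod>i\<in>UNIV. emeasure unit_uniform (A (Inl i))) * (\<Prod>j\<in>UNIV. emeasure unit_uniform (A (Inr j)))"
      using A by (subst n.emeasure_pair_measure_Times)
        (auto simp: sets_PiM_I_finite sm.emeasure_PiM sn.emeasure_PiM)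
    also have "\<dots> = (\<Prod>k\<in>UNIV. emeasure unit_uniform (A k))"
      unfolding UNIV_Plus_UNIV[symmetric] by (subst prod.Plus) auto
    finally show "emeasure (distr (?m \<Otimes>\<^sub>M ?n) uniform_product glue) (Pi\<^sub>E UNIV A) =
        (\<Prod>k\<in>UNIV. emeasure unit_uniform (A k))" by (simp add: \<Omega>_def)
  qed auto
  then have "distr \<Omega> (?m \<Otimes>\<^sub>M ?n) split = distr (distr (?m \<Otimes>\<^sub>M ?n) \<Omega> glue) (?m \<Otimes>\<^sub>M ?n) split"
    by simp
  also have "\<dots> = distr (?m \<Otimes>\<^sub>M ?n) (?m \<Otimes>\<^sub>M ?n) (split \<circ> glue)"
    by (rule distr_distr[OF split glue])
  also have "split \<circ> glue = (\<lambda>p. p)"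
    by (simp add: split_def glue_def fun_eq_iff)
  finally show "distr \<Omega> (?m \<Otimes>\<^sub>M ?n) split = ?m \<Otimes>\<^sub>M ?n" by simp
qed

lemma distr_checkerboard_fst:
  fixes M :: "'w measure"
  assumes M: "prob_space M" and X: "X \<in> M \<rightarrow>\<^sub>M A"
  shows "distr (checkerboard_space M :: ('w \<times> ('d::finite \<Rightarrow> real)) measure) A (\<lambda>p. X (fst p)) = distr M A X"
proof -
  have "distr (checkerboard_space M :: ('w \<times> ('d::finite \<Rightarrow> real)) measure) A (\<lambda>p. X (fst p)) =
      distr (distr (checkerboard_space M :: ('w \<times> ('d::finite \<Rightarrow> real)) measure) M fst) A X"
    unfolding checkerboard_space_def by (subst distr_distr[OF X measurable_fst]) (simp add: comp_def)
  then show ?thesis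
    unfolding checkerboard_space_def by (simp add: distr_pair_fst_snd(1)[OF M prob_space_uniform_product])
qed

lemma prob_space_checkerboard_space:
  "prob_space M \<Longrightarrow> prob_space (checkerboard_space M)"
  unfolding checkerboard_space_def by (intro prob_space_pair prob_space_uniform_product)

lemma measurable_checkerboard_fst:
  "X \<in> M \<rightarrow>\<^sub>M A \<Longrightarrow> (\<lambda>p. X (fst p)) \<in> checkerboard_space M \<rightarrow>\<^sub>M A"
  unfolding checkerboard_space_def by (rule measurable_compose[OF measurable_fst])

lemma uniform_checkerboard_coordinate:
  fixes M :: "'w measure" and k :: "'d::finite"
  assumes M: "prob_space M"
  shows "(\<lambda>p. snd p k) \<in> borel_measurable (checkerboard_space M)"
    and "uniform_01 (checkerboard_space M) (\<lambda>p. snd p k)"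
proof -
  let ?\<Omega> = "uniform_product :: ('d \<Rightarrow> real) measure"
  have comp: "(\<lambda>t. t k) \<in> ?\<Omega> \<rightarrow>\<^sub>M unit_uniform" by (rule measurable_component_singleton) simp
  then have comp': "(\<lambda>t. t k) \<in> borel_measurable ?\<Omega>" by simp
  show meas: "(\<lambda>p. snd p k) \<in> borel_measurable (checkerboard_space M)"
    unfolding checkerboard_space_def by (rule measurable_compose[OF measurable_snd comp'])
  interpret product_prob_space "\<lambda>_ :: 'd. unit_uniform" UNIV
    by (intro product_prob_spaceI prob_space_unit_uniform)
  have "distr (checkerboard_space M) borel (\<lambda>p. snd p k) = distr (distr (checkerboard_space M) ?\<Omega> snd) borel (\<lambda>t. t k)"
    unfolding checkerboard_space_def by (subst distr_distr[OF comp' measurable_snd]) (simp add: comp_def)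
  also have "\<dots> = distr ?\<Omega> borel (\<lambda>t. t k)"
    unfolding checkerboard_space_def by (simp add: distr_pair_fst_snd(2)[OF M prob_space_uniform_product])
  also have "\<dots> = distr ?\<Omega> unit_uniform (\<lambda>t. t k)"
    by (rule distr_cong) auto
  also have "\<dots> = unit_uniform" by (rule PiM_component) simp
  finally show "uniform_01 (checkerboard_space M) (\<lambda>p. snd p k)"
    unfolding uniform_01_def using meas by simp
qed

lemma checkerboard_joint_law:
  fixes M :: "'w measure"
  assumes M: "prob_space M" and [measurable]: "X \<in> M \<rightarrow>\<^sub>M A" "Y \<in> M \<rightarrow>\<^sub>M B"
  defines "N \<equiv> (checkerboard_space M :: ('w \<times> ('m::finite + 'n::finite \<Rightarrow> real)) measure)"
  defines "R \<equiv> \<lambda>p :: 'w \<times> ('m + 'n \<Rightarrow> real). \<lambda>i. snd p (Inl i)"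
  defines "S \<equiv> \<lambda>p :: 'w \<times> ('m + 'n \<Rightarrow> real). \<lambda>j. snd p (Inr j)"
  shows "R \<in> N \<rightarrow>\<^sub>M uniform_product" "S \<in> N \<rightarrow>\<^sub>M uniform_product"
    and "distr N uniform_product R = uniform_product" "distr N uniform_product S = uniform_product"
    and "distr N ((uniform_product \<Otimes>\<^sub>M uniform_product) \<Otimes>\<^sub>M (A \<Otimes>\<^sub>M B)) (\<lambda>p. ((R p, S p), (X (fst p), Y (fst p)))) =
      (distr N uniform_product R \<Otimes>\<^sub>M distr N uniform_product S) \<Otimes>\<^sub>M
        distr N (A \<Otimes>\<^sub>M B) (\<lambda>p. (X (fst p), Y (fst p)))"
proof -
  interpret M: prob_space M by fact
  let ?m = "uniform_product :: ('m \<Rightarrow> real) measure" and ?n = "uniform_product :: ('n \<Rightarrow> real) measure"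
  let ?\<Omega> = "uniform_product :: ('m + 'n \<Rightarrow> real) measure"
  interpret \<Omega>: prob_space ?\<Omega> by (rule prob_space_uniform_product)
  interpret M\<Omega>: pair_sigma_finite M ?\<Omega> ..
  interpret \<Omega>M: pair_sigma_finite ?\<Omega> M ..
  define split where "split = (\<lambda>t :: 'm + 'n \<Rightarrow> real. (\<lambda>i. t (Inl i), \<lambda>j. t (Inr j)))"
  have split: "split \<in> ?\<Omega> \<rightarrow>\<^sub>M ?m \<Otimes>\<^sub>M ?n" and split_distr: "distr ?\<Omega> (?m \<Otimes>\<^sub>M ?n) split = ?m \<Otimes>\<^sub>M ?n"
    unfolding split_def by (rule distr_uniform_product_parts)+
  have RS: "(R p, S p) = split (snd p)" for p by (simp add: R_def S_def split_def)
  have RS_meas: "(\<lambda>p. split (snd p)) \<in> N \<rightarrow>\<^sub>M ?m \<Otimes>\<^sub>M ?n"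
    unfolding N_def checkerboard_space_def by (rule measurable_compose[OF measurable_snd split])
  have RS_distr: "distr N (?m \<Otimes>\<^sub>M ?n) (\<lambda>p. split (snd p)) = ?m \<Otimes>\<^sub>M ?n"
  proof -
    have "distr N (?m \<Otimes>\<^sub>M ?n) (\<lambda>p. split (snd p)) = distr (distr N ?\<Omega> snd) (?m \<Otimes>\<^sub>M ?n) split"
      unfolding N_def checkerboard_space_def by (subst distr_distr[OF split measurable_snd]) (simp add: comp_def)
    then show ?thesis
      unfolding N_def checkerboard_space_def
      by (simp add: distr_pair_fst_snd(2)[OF M prob_space_uniform_product] split_distr)
  qed
  have R_eq: "R = (\<lambda>p. fst (split (snd p)))" and S_eq: "S = (\<lambda>p. snd (split (snd p)))"
    by (auto simp: R_def S_def split_def)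
  show R: "R \<in> N \<rightarrow>\<^sub>M ?m" and S: "S \<in> N \<rightarrow>\<^sub>M ?n"
    unfolding R_eq S_eq by (rule measurable_compose[OF RS_meas measurable_fst], rule measurable_compose[OF RS_meas measurable_snd])
  have "distr N ?m R = distr (distr N (?m \<Otimes>\<^sub>M ?n) (\<lambda>p. split (snd p))) ?m fst"
    by (subst distr_distr[OF measurable_fst RS_meas]) (simp add: comp_def R_eq)
  then show Rd: "distr N ?m R = ?m"
    by (simp add: RS_distr distr_pair_fst_snd(1)[OF prob_space_uniform_product prob_space_uniform_product])
  have "distr N ?n S = distr (distr N (?m \<Otimes>\<^sub>M ?n) (\<lambda>p. split (snd p))) ?n snd"
    by (subst distr_distr[OF measurable_snd RS_meas]) (simp add: comp_def S_eq)
  then show Sd: "distr N ?n S = ?n"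
    by (simp add: RS_distr distr_pair_fst_snd(2)[OF prob_space_uniform_product prob_space_uniform_product])
  let ?XY = "\<lambda>\<omega>. (X \<omega>, Y \<omega>)"
  have XY: "?XY \<in> M \<rightarrow>\<^sub>M A \<Otimes>\<^sub>M B" by measurable
  have both: "(\<lambda>(t, \<omega>). (split t, ?XY \<omega>)) \<in> ?\<Omega> \<Otimes>\<^sub>M M \<rightarrow>\<^sub>M (?m \<Otimes>\<^sub>M ?n) \<Otimes>\<^sub>M (A \<Otimes>\<^sub>M B)"
    unfolding case_prod_beta
    by (rule measurable_Pair[OF measurable_compose[OF measurable_fst split] measurable_compose[OF measurable_snd XY]])
  have swap: "(\<lambda>(\<omega>, t). (t, \<omega>)) \<in> M \<Otimes>\<^sub>M ?\<Omega> \<rightarrow>\<^sub>M ?\<Omega> \<Otimes>\<^sub>M M" by (rule measurable_pair_swap')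
  have "distr N ((?m \<Otimes>\<^sub>M ?n) \<Otimes>\<^sub>M (A \<Otimes>\<^sub>M B)) (\<lambda>p. ((R p, S p), (X (fst p), Y (fst p)))) =
      distr (distr (M \<Otimes>\<^sub>M ?\<Omega>) (?\<Omega> \<Otimes>\<^sub>M M) (\<lambda>(\<omega>, t). (t, \<omega>))) ((?m \<Otimes>\<^sub>M ?n) \<Otimes>\<^sub>M (A \<Otimes>\<^sub>M B)) (\<lambda>(t, \<omega>). (split t, ?XY \<omega>))"
    unfolding distr_distr[OF both swap] N_def checkerboard_space_def
    by (rule distr_cong) (auto simp: RS)
  also have "distr (M \<Otimes>\<^sub>M ?\<Omega>) (?\<Omega> \<Otimes>\<^sub>M M) (\<lambda>(\<omega>, t). (t, \<omega>)) = ?\<Omega> \<Otimes>\<^sub>M M"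
    by (rule \<Omega>M.distr_pair_swap[symmetric])
  also have "distr (?\<Omega> \<Otimes>\<^sub>M M) ((?m \<Otimes>\<^sub>M ?n) \<Otimes>\<^sub>M (A \<Otimes>\<^sub>M B)) (\<lambda>(t, \<omega>). (split t, ?XY \<omega>)) =
      distr ?\<Omega> (?m \<Otimes>\<^sub>M ?n) split \<Otimes>\<^sub>M distr M (A \<Otimes>\<^sub>M B) ?XY"
    by (rule pair_measure_distr[OF split XY, symmetric]) (intro prob_space_imp_sigma_finite M.prob_space_distr XY)
  also have "distr M (A \<Otimes>\<^sub>M B) ?XY = distr N (A \<Otimes>\<^sub>M B) (\<lambda>p. (X (fst p), Y (fst p)))"
    unfolding N_def by (rule distr_checkerboard_fst[OF M XY, symmetric])
  finally show "distr N ((?m \<Otimes>\<^sub>M ?n) \<Otimes>\<^sub>M (A \<Otimes>\<^sub>M B)) (\<lambda>p. ((R p, S p), (X (fst p), Y (fst p)))) =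
      (distr N ?m R \<Otimes>\<^sub>M distr N ?n S) \<Otimes>\<^sub>M distr N (A \<Otimes>\<^sub>M B) (\<lambda>p. (X (fst p), Y (fst p)))"
    by (simp add: split_distr Rd Sd)
qed

lemma distr_checkerboard_reindex:
  fixes M :: "'w measure" and h :: "'c::finite \<Rightarrow> 'd::finite"
  assumes M: "prob_space M" and h: "inj h"
  defines "g \<equiv> \<lambda>p :: 'w \<times> ('d \<Rightarrow> real). (fst p, \<lambda>i. snd p (h i))"
  shows "g \<in> checkerboard_space M \<rightarrow>\<^sub>M checkerboard_space M"
    and "distr (checkerboard_space M) (checkerboard_space M) g = checkerboard_space M"
proof -
  let ?d = "uniform_product :: ('d \<Rightarrow> real) measure" and ?c = "uniform_product :: ('c \<Rightarrow> real) measure"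
  have r: "(\<lambda>t i. t (h i)) \<in> ?d \<rightarrow>\<^sub>M ?c"
    by (rule measurable_PiM_single') (auto simp: space_PiM)
  have rd: "distr ?d ?c (\<lambda>t i. t (h i)) = ?c"
    using distr_PiM_reindex[of UNIV "\<lambda>_. unit_uniform" h UNIV] h prob_space_unit_uniform
    by (simp add: restrict_def)
  show "g \<in> checkerboard_space M \<rightarrow>\<^sub>M checkerboard_space M"
    unfolding g_def checkerboard_space_def
    by (rule measurable_Pair[OF measurable_fst measurable_compose[OF measurable_snd r]])
  have "distr M M (\<lambda>x. x) \<Otimes>\<^sub>M distr ?d ?c (\<lambda>t i. t (h i)) =
      distr (M \<Otimes>\<^sub>M ?d) (M \<Otimes>\<^sub>M ?c) (\<lambda>(x, y). (x, \<lambda>i. y (h i)))"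
    by (rule pair_measure_distr) (use r rd in \<open>auto intro: prob_space_imp_sigma_finite prob_space_uniform_product\<close>)
  then show "distr (checkerboard_space M) (checkerboard_space M) g = checkerboard_space M"
    by (simp add: rd checkerboard_space_def g_def case_prod_unfold)
qed

text \<open>The checkerboard copula of a marginal vector is defined on an extension of \<open>M\<close> with fewer uniform
  variables. It can be computed on a larger extension by selecting coordinates, so that the
  checkerboard copulas of \<open>X\<close>, \<open>Y\<close> and \<open>(X, Y)\<close> can be compared on one space.\<close>

lemma checkerboard_copula_reindex:
  fixes M :: "'w measure" and X :: "'w \<Rightarrow> real^'c" and h :: "'c::finite \<Rightarrow> 'd::finite"
  assumes M: "prob_space M" and X[measurable]: "X \<in> borel_measurable M" and h: "inj h"
  shows "checkerboard_copula M X =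
    joint_cdf (distr (checkerboard_space M :: ('w \<times> ('d \<Rightarrow> real)) measure) borel
      (interpolated (checkerboard_space M) (\<lambda>p. X (fst p)) (\<lambda>i x p. snd p (h i))))"
proof -
  let ?C = "checkerboard_space M :: ('w \<times> ('c \<Rightarrow> real)) measure"
  let ?D = "checkerboard_space M :: ('w \<times> ('d \<Rightarrow> real)) measure"
  define g where "g p = (fst p, \<lambda>i. snd p (h i))" for p :: "'w \<times> ('d \<Rightarrow> real)"
  have g: "g \<in> ?D \<rightarrow>\<^sub>M ?C" and gd: "distr ?D ?C g = ?C"
    unfolding g_def[abs_def] by (rule distr_checkerboard_reindex[OF M h])+
  let ?IC = "interpolated ?C (\<lambda>p. X (fst p)) (\<lambda>i x p. snd p i)"
  have XC: "(\<lambda>p. X (fst p)) \<in> borel_measurable ?C" and XD: "(\<lambda>p. X (fst p)) \<in> borel_measurable ?D"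
    by (rule measurable_checkerboard_fst[OF X])+
  note pC = prob_space_checkerboard_space[OF M, where 'b='c] and pD = prob_space_checkerboard_space[OF M, where 'b='d]
  have IC: "?IC \<in> borel_measurable ?C"
  proof -
    have "?IC = (\<lambda>p. randomized_map (distr ?C borel (\<lambda>p. X (fst p))) (\<lambda>r i x. r i) (snd p, X (fst p)))"
      by (intro ext interpolated_eq_randomized_map pC XC) simp
    also have "\<dots> \<in> borel_measurable ?C"
    proof (rule measurable_compose[where N="uniform_product \<Otimes>\<^sub>M borel"])
      show "(\<lambda>p. (snd p, X (fst p))) \<in> ?C \<rightarrow>\<^sub>M uniform_product \<Otimes>\<^sub>M borel"
        using XC unfolding checkerboard_space_def by (intro measurable_Pair measurable_snd)
      show "randomized_map (distr ?C borel (\<lambda>p. X (fst p))) (\<lambda>r i x. r i) \<in> borel_measurable (uniform_product \<Otimes>\<^sub>M borel)"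
      proof (rule borel_measurable_randomized_map)
        fix i :: 'c
        have "(\<lambda>r. r i) \<in> uniform_product \<rightarrow>\<^sub>M unit_uniform" by (rule measurable_component_singleton) simp
        then show "(\<lambda>r. r i) \<in> borel_measurable uniform_product" by simp
      qed (auto intro: prob_space.prob_space_distr[OF pC XC])
    qed
    finally show ?thesis .
  qed
  have marg: "distr ?C borel (\<lambda>p. X (fst p) $ i) = distr ?D borel (\<lambda>p. X (fst p) $ i)" for i
    by (simp add: distr_checkerboard_fst[OF M, of "\<lambda>\<omega>. X \<omega> $ i"])
  have "checkerboard_copula M X = joint_cdf (distr (distr ?D ?C g) borel ?IC)"
    by (simp add: checkerboard_copula_def gd)
  also have "distr (distr ?D ?C g) borel ?IC = distr ?D borel (?IC \<circ> g)"
    by (rule distr_distr[OF IC g])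
  also have "?IC \<circ> g = interpolated ?D (\<lambda>p. X (fst p)) (\<lambda>i x p. snd p (h i))"
    by (simp add: fun_eq_iff vec_eq_iff interpolated_nth[OF pC XC] interpolated_nth[OF pD XD] marg g_def)
  finally show ?thesis .
qed

text \<open>On the extension for \<open>(X, Y)\<close> the two blocks of uniform variables serve as the private noise of
  \<open>X\<close> and of \<open>Y\<close>.\<close>

lemma checkerboard_copula_divergence:
  fixes M :: "'w measure" and X :: "'w \<Rightarrow> real^'m" and Y :: "'w \<Rightarrow> real^'n"
  assumes M: "prob_space M" and X[measurable]: "X \<in> borel_measurable M" and Y[measurable]: "Y \<in> borel_measurable M"
    and f: "f \<in> csiszar_class"
  defines "C \<equiv> checkerboard_copula M (joint_rv X Y)"
  shows "is_copula_for M (joint_rv X Y) C"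
    and "csiszar_index f M borel borel X Y = copula_divergence f (tensor_copula (left_marginal C) (right_marginal C)) C"
    and "csiszar_index f M borel borel X Y =
      copula_divergence f (tensor_copula (checkerboard_copula M X) (checkerboard_copula M Y)) C"
proof -
  let ?N = "checkerboard_space M :: ('w \<times> ('m + 'n \<Rightarrow> real)) measure"
  let ?X = "\<lambda>p :: 'w \<times> ('m + 'n \<Rightarrow> real). X (fst p)" and ?Y = "\<lambda>p :: 'w \<times> ('m + 'n \<Rightarrow> real). Y (fst p)"
  let ?T = "\<lambda>(i :: 'm) (x :: real) (p :: 'w \<times> ('m + 'n \<Rightarrow> real)). snd p (Inl i)"
  let ?W = "\<lambda>(j :: 'n) (y :: real) (p :: 'w \<times> ('m + 'n \<Rightarrow> real)). snd p (Inr j)"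
  have Z[measurable]: "joint_rv X Y \<in> borel_measurable M" unfolding joint_rv_def[abs_def] by measurable
  have N: "prob_space ?N" by (rule prob_space_checkerboard_space[OF M])
  interpret N: prob_space ?N by (rule N)
  have XN[measurable]: "?X \<in> borel_measurable ?N" and YN[measurable]: "?Y \<in> borel_measurable ?N"
    by (rule measurable_checkerboard_fst; fact)+
  define \<Lambda> where "\<Lambda> = distr ?N borel (joint_rv (interpolated ?N ?X ?T) (interpolated ?N ?Y ?W))"
  note laws = checkerboard_joint_law[OF M X Y]
  have comp: "(\<lambda>r. r i) \<in> borel_measurable uniform_product" for i :: "'i::finite"
  proof -
    have "(\<lambda>r. r i) \<in> uniform_product \<rightarrow>\<^sub>M unit_uniform" by (rule measurable_component_singleton) simp
    then show ?thesis by simp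
  qed
  note div = interpolated_copula_divergence[OF N XN YN f laws(1,2,5), where T="?T" and W="?W" and \<tau>="\<lambda>r i x. r i" and \<upsilon>="\<lambda>s j y. s j",
    OF uniform_checkerboard_coordinate(2)[OF M] uniform_checkerboard_coordinate(2)[OF M] comp refl comp refl, folded \<Lambda>_def]
  have C: "C = joint_cdf \<Lambda>"
  proof -
    have "case_sum ?T ?W = (\<lambda>k x p. snd p k)"
      by (simp add: fun_eq_iff split: sum.split)
    moreover have "joint_rv ?X ?Y = (\<lambda>p. joint_rv X Y (fst p))"
      by (simp add: joint_rv_def fun_eq_iff)
    ultimately show ?thesis
      by (simp add: C_def checkerboard_copula_def \<Lambda>_def joint_rv_interpolated)
  qed
  have index: "csiszar_index f ?N borel borel ?X ?Y = csiszar_index f M borel borel X Y"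
    unfolding csiszar_index_def
    using distr_checkerboard_fst[OF M X, where 'd="'m + 'n"] distr_checkerboard_fst[OF M Y, where 'd="'m + 'n"]
      distr_checkerboard_fst[OF M, of "\<lambda>\<omega>. (X \<omega>, Y \<omega>)" "borel \<Otimes>\<^sub>M borel", where 'd="'m + 'n"] by simp
  have "joint_rv ?X ?Y = (\<lambda>p. joint_rv X Y (fst p))"
    by (simp add: joint_rv_def fun_eq_iff)
  then have "is_copula_for ?N (joint_rv ?X ?Y) C \<longleftrightarrow> is_copula_for M (joint_rv X Y) C"
    by (simp add: is_copula_for_def distr_checkerboard_fst[OF M Z] distr_checkerboard_fst[OF M, of "\<lambda>\<omega>. joint_rv X Y \<omega> $ _"])
  then show cop: "is_copula_for M (joint_rv X Y) C"
    using div(2) by (simp add: C)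
  show eq: "csiszar_index f M borel borel X Y = copula_divergence f (tensor_copula (left_marginal C) (right_marginal C)) C"
    using div(3) by (simp add: index C)
  have joint: "joint_rv (interpolated ?N ?X ?T) (interpolated ?N ?Y ?W) \<in> borel_measurable ?N"
    by (rule div(4))
  have left: "distr \<Lambda> borel left_part = distr ?N borel (interpolated ?N ?X ?T)"
    unfolding \<Lambda>_def distr_distr[OF borel_measurable_left_part joint] by (simp add: comp_def joint_rv_def)
  have right: "distr \<Lambda> borel right_part = distr ?N borel (interpolated ?N ?Y ?W)"
    unfolding \<Lambda>_def distr_distr[OF borel_measurable_right_part joint] by (simp add: comp_def joint_rv_def)
  note parts = copula_law_parts[OF div(1)]
  have cX: "checkerboard_copula M X = joint_cdf (distr \<Lambda> borel left_part)"
    unfolding left by (rule checkerboard_copula_reindex[OF M X]) simp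
  have cY: "checkerboard_copula M Y = joint_cdf (distr \<Lambda> borel right_part)"
    unfolding right by (rule checkerboard_copula_reindex[OF M Y]) simp
  have "copula_measure (tensor_copula (checkerboard_copula M X) (checkerboard_copula M Y)) =
      tensor_law (distr \<Lambda> borel left_part) (distr \<Lambda> borel right_part)"
  proof (rule copula_measure_eqI)
    show "copula_law (tensor_law (distr \<Lambda> borel left_part) (distr \<Lambda> borel right_part))"
      by (rule copula_law_tensor_law[OF parts])
    show "tensor_copula (checkerboard_copula M X) (checkerboard_copula M Y) u =
        joint_cdf (tensor_law (distr \<Lambda> borel left_part) (distr \<Lambda> borel right_part)) u" for u
      by (simp add: tensor_copula_def cX cY joint_cdf_tensor_law[OF copula_lawD(1)[OF parts(1)] copula_lawD(1)[OF parts(2)]])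
  qed
  moreover have "copula_measure (tensor_copula (left_marginal C) (right_marginal C)) =
      tensor_law (distr \<Lambda> borel left_part) (distr \<Lambda> borel right_part)"
    using cop copula_measure_tensor_copula[of C] copula_measure_eqI[OF div(1) refl]
    by (simp add: is_copula_for_def C)
  ultimately show "csiszar_index f M borel borel X Y =
      copula_divergence f (tensor_copula (checkerboard_copula M X) (checkerboard_copula M Y)) C"
    using eq by (simp add: copula_divergence_def)
qed

text \<open>The families \<open>T\<close> and \<open>W\<close>, as random elements of product spaces, are the sources of
  randomness.\<close>

lemma interpolating_copula_divergence:
  fixes M :: "'w measure" and X :: "'w \<Rightarrow> real^'m" and Y :: "'w \<Rightarrow> real^'n"
  assumes M: "prob_space M" and X[measurable]: "X \<in> borel_measurable M" and Y[measurable]: "Y \<in> borel_measurable M"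
    and f: "f \<in> csiszar_class"
    and T: "\<forall>(i, x)\<in>atom_index M X. uniform_01 M (T i x)"
    and W: "\<forall>(j, y)\<in>atom_index M Y. uniform_01 M (W j y)"
    and TW: "indep_rvs M (family_space M X) (family_rv M X T) (family_space M Y) (family_rv M Y W)"
    and TWXY: "indep_rvs M (family_space M X \<Otimes>\<^sub>M family_space M Y) (\<lambda>\<omega>. (family_rv M X T \<omega>, family_rv M Y W \<omega>))
      (borel \<Otimes>\<^sub>M borel) (\<lambda>\<omega>. (X \<omega>, Y \<omega>))"
    and C: "C = joint_cdf (distr M borel (joint_rv (interpolated M X T) (interpolated M Y W)))"
  shows "csiszar_index f M borel borel X Y = copula_divergence f (tensor_copula (left_marginal C) (right_marginal C)) C"
proof -
  have fam: "family_rv M X T \<in> M \<rightarrow>\<^sub>M family_space M X" "family_rv M Y W \<in> M \<rightarrow>\<^sub>M family_space M Y"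
    using TW by (auto simp: indep_rvs_def)
  have law: "distr M ((family_space M X \<Otimes>\<^sub>M family_space M Y) \<Otimes>\<^sub>M (borel \<Otimes>\<^sub>M borel))
      (\<lambda>\<omega>. ((family_rv M X T \<omega>, family_rv M Y W \<omega>), (X \<omega>, Y \<omega>))) =
      (distr M (family_space M X) (family_rv M X T) \<Otimes>\<^sub>M distr M (family_space M Y) (family_rv M Y W)) \<Otimes>\<^sub>M
      distr M (borel \<Otimes>\<^sub>M borel) (\<lambda>\<omega>. (X \<omega>, Y \<omega>))"
    using indep_rvs_distr[OF M TWXY] indep_rvs_distr[OF M TW] by simp
  have idx: "(i, x) \<in> atom_index M Z \<longleftrightarrow> x \<in> atoms M (\<lambda>\<omega>. Z \<omega> $ i)" for i x and Z :: "'w \<Rightarrow> real^'c"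
    by (simp add: atom_index_def)
  show ?thesis
    unfolding C
  proof (rule interpolated_copula_divergence(3)[OF M X Y f fam law,
      where \<tau>="\<lambda>r i x. r (i, x)" and \<upsilon>="\<lambda>s j y. s (j, y)"])
    show "uniform_01 M (T i x)" if "x \<in> atoms M (\<lambda>\<omega>. X \<omega> $ i)" for i x
      using T that by (auto simp: idx[symmetric])
    show "uniform_01 M (W j y)" if "y \<in> atoms M (\<lambda>\<omega>. Y \<omega> $ j)" for j y
      using W that by (auto simp: idx[symmetric])
    show "(\<lambda>r. r (i, x)) \<in> borel_measurable (family_space M X)" if "x \<in> atoms M (\<lambda>\<omega>. X \<omega> $ i)" for i x
      using that by (intro measurable_component_singleton) (simp add: idx)
    show "(\<lambda>r. r (j, y)) \<in> borel_measurable (family_space M Y)" if "y \<in> atoms M (\<lambda>\<omega>. Y \<omega> $ j)" for j y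
      using that by (intro measurable_component_singleton) (simp add: idx)
    show "T i x \<omega> = family_rv M X T \<omega> (i, x)" if "x \<in> atoms M (\<lambda>\<omega>. X \<omega> $ i)" for i x \<omega>
      using that by (simp add: family_rv_def idx)
    show "W j y \<omega> = family_rv M Y W \<omega> (j, y)" if "y \<in> atoms M (\<lambda>\<omega>. Y \<omega> $ j)" for j y \<omega>
      using that by (simp add: family_rv_def idx)
  qed
qed

theorem theorem12:
  fixes M :: "'w measure" and X :: "'w \<Rightarrow> real^'m" and Y :: "'w \<Rightarrow> real^'n"
    and f :: "real \<Rightarrow> ereal"
  assumes "prob_space M"
    and "X \<in> borel_measurable M" and "Y \<in> borel_measurable M"
    and "f \<in> csiszar_class"
  shows
    "(\<forall>C. is_copula_for M (joint_rv X Y) C \<longrightarrow>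
        csiszar_index f M borel borel X Y
          \<le> copula_divergence f (tensor_copula (left_marginal C) (right_marginal C)) C) \<and>
     (\<forall>T W C.
        (\<forall>(i, x)\<in>atom_index M X. uniform_01 M (T i x)) \<and>
        (\<forall>(j, y)\<in>atom_index M Y. uniform_01 M (W j y)) \<and>
        indep_rvs M
          (family_space M X) (family_rv M X T)
          (family_space M Y) (family_rv M Y W) \<and>
        indep_rvs M
          (family_space M X \<Otimes>\<^sub>M family_space M Y) (\<lambda>\<omega>. (family_rv M X T \<omega>, family_rv M Y W \<omega>))
          (borel \<Otimes>\<^sub>M borel) (\<lambda>\<omega>. (X \<omega>, Y \<omega>)) \<and>
        C = joint_cdf (distr M borel (joint_rv (interpolated M X T) (interpolated M Y W))) \<longrightarrow>
        csiszar_index f M borel borel X Y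
          = copula_divergence f (tensor_copula (left_marginal C) (right_marginal C)) C) \<and>
     (csiszar_index f M borel borel X Y
        = copula_divergence f
            (tensor_copula (checkerboard_copula M X) (checkerboard_copula M Y))
            (checkerboard_copula M (joint_rv X Y)) \<and>
      (\<exists>C. is_copula_for M (joint_rv X Y) C \<and>
        csiszar_index f M borel borel X Y
          = copula_divergence f (tensor_copula (left_marginal C) (right_marginal C)) C) \<and>
      (\<forall>C. is_copula_for M (joint_rv X Y) C \<longrightarrow>
        csiszar_index f M borel borel X Y
          \<le> copula_divergence f (tensor_copula (left_marginal C) (right_marginal C)) C))"
proof (intro conjI allI impI; (elim conjE)?)
  show "csiszar_index f M borel borel X Y
      \<le> copula_divergence f (tensor_copula (left_marginal C) (right_marginal C)) C"
    if "is_copula_for M (joint_rv X Y) C" for C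
    by (rule csiszar_index_le_copula_divergence[OF assms that])
  then show "csiszar_index f M borel borel X Y
      \<le> copula_divergence f (tensor_copula (left_marginal C) (right_marginal C)) C"
    if "is_copula_for M (joint_rv X Y) C" for C
    using that .
  show "csiszar_index f M borel borel X Y
      = copula_divergence f (tensor_copula (left_marginal C) (right_marginal C)) C"
    if "\<forall>(i, x)\<in>atom_index M X. uniform_01 M (T i x)"
      "\<forall>(j, y)\<in>atom_index M Y. uniform_01 M (W j y)"
      "indep_rvs M (family_space M X) (family_rv M X T) (family_space M Y) (family_rv M Y W)"
      "indep_rvs M (family_space M X \<Otimes>\<^sub>M family_space M Y) (\<lambda>\<omega>. (family_rv M X T \<omega>, family_rv M Y W \<omega>))
        (borel \<Otimes>\<^sub>M borel) (\<lambda>\<omega>. (X \<omega>, Y \<omega>))"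
      "C = joint_cdf (distr M borel (joint_rv (interpolated M X T) (interpolated M Y W)))" for T W C
    by (rule interpolating_copula_divergence[OF assms that])
  show "csiszar_index f M borel borel X Y =
      copula_divergence f (tensor_copula (checkerboard_copula M X) (checkerboard_copula M Y))
        (checkerboard_copula M (joint_rv X Y))"
    by (rule checkerboard_copula_divergence(3)[OF assms])
  show "\<exists>C. is_copula_for M (joint_rv X Y) C \<and> csiszar_index f M borel borel X Y
      = copula_divergence f (tensor_copula (left_marginal C) (right_marginal C)) C"
    using checkerboard_copula_divergence(1,2)[OF assms] by blast
qed

end
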